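(* Let $d\ge1$, $R>0$, $\alpha\in(0,1)$, $t_1,\dots,t_d\ge0$, $s>0$, and suppose $$b_l^2=\prod_{j=1}^d l_j^{-2t_j},\qquad a_l^2=\prod_{j=1}^d e^{2sl_j},\qquad l\in\mathbb{N}_*^d .$$ Then: (1) The minimax separation rate $r_\epsilon^\star$ over $\Theta_{a,R}$ satisfies $r_\epsilon^\star\sim\epsilon\,(\ln(\epsilon^{-1}))^{\sum_{j=1}^d(t_j+1/4)}$ as $\epsilon\to0$. (2) If $r_\epsilon=C\epsilon\,(\ln(\epsilon^{-1}))^{\sum_{j=1}^d(t_j+1/4)}$ for some positive constant $C$, then $u_\epsilon(r_\epsilon)=\mathcal{O}(1)$ as $\epsilon\to0$ and the sharp asymptotics $$\beta_\epsilon(\Theta_{a,R}(r_\epsilon),\alpha)=\Phi\big(H^{(\alpha)}-u_\epsilon(r_\epsilon)\big)+o(1)\quad\text{as }\epsilon\to0$$ hold true.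
   Context: $\mathbb{N}_*=\{1,2,3,\dots\}$. For a noise level $\epsilon>0$ one observes $y=(y_l)_{l\in\mathbb{N}_*^d}$, $y_l=b_l\theta_l+\epsilon\xi_l$, where the $\xi_l$ are i.i.d. standard Gaussian, $b=(b_l)$ is a known sequence and $\theta\in\ell^2(\mathbb{N}_*^d)$ is unknown. $\mathbb{P}_\theta$ is the law of $y$; $\mathbb{P}_0$ corresponds to $\theta=0$. $\|\cdot\|$ is the $\ell^2$ norm. $\Theta_{a,R}=\{\theta\in\ell^2(\mathbb{N}_*^d):\sum_l a_l^2\theta_l^2\le R^2\}$ and $\Theta_{a,R}(r)=\{\theta\in\Theta_{a,R}:\|\theta\|\ge r\}$. All parameters other than $\epsilon$ are fixed. One tests $H_0:\theta=0$ against $\theta\in\Theta_{a,R}(r_\epsilon)$. A test $\psi$ is a measurable function of the data with values in $\{0,1\}$. A level-$\alpha$ test is a test function $\psi_\alpha$ (which may depend on $\epsilon$) satisfying $\mathbb{P}_0(\psi_\alpha=1)\le\alpha+o(1)$ as $\epsilon\to0$. $\beta_\epsilon(\Theta_{a,R}(r_\epsilon),\psi)=\sup_{\theta\in\Theta_{a,R}(r_\epsilon)}\mathbb{P}_\theta(\psi=0)$, and $\beta_\epsilon(\Theta_{a,R}(r_\epsilon),\alpha)=\inf_{\psi_\alpha}\beta_\epsilon(\Theta_{a,R}(r_\epsilon),\psi_\alpha)$, the infimum being over all level-$\alpha$ tests. A family $r^\star_\epsilon$ is a minimax separation rate over $\Theta_{a,R}$ if, as $\epsilon\to0$, $\beta_\epsilon(\Theta_{a,R}(r_\epsilon),\alpha)\to1-\alpha$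 whenever $r_\epsilon/r_\epsilon^\star\to0$, and $\beta_\epsilon(\Theta_{a,R}(r_\epsilon),\alpha)\to0$ whenever $r_\epsilon/r_\epsilon^\star\to\infty$. $v_\epsilon\sim w_\epsilon$ as $\epsilon\to0$ means that there are two positive constants $k_0,k_1$ such that $k_0w_\epsilon\le v_\epsilon\le k_1w_\epsilon$ for all $\epsilon>0$. Extremal problem: $u_\epsilon^2(r_\epsilon)=\frac{1}{2\epsilon^4}\inf_{\theta\in\Theta_{a,R}(r_\epsilon)}\sum_k b_k^4\theta_k^4$, with $u_\epsilon(r_\epsilon)\ge0$. $\Phi$ is the standard Gaussian distribution function and $H^{(\alpha)}$ its $(1-\alpha)$-quantile.
   Formalization: "~" is required for all sufficiently small ε (ln(1/ε) ≤ 0 for ε ≥ 1), with rates positive for small ε; the infimum over level-α tests is taken at each ε over tests of level α+η(ε), for every remainder η(ε)→0, since a bare o(1) excludes no test at fixed ε. *)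

theory Defs
  imports "HOL-Analysis.Analysis" "HOL-Probability.Probability"
begin

text \<open>Multi-indices are the vectors of \<^typ>\<open>nat ^ 'd\<close> with positive entries. Sequences are
  total functions on \<^typ>\<open>nat ^ 'd\<close>, of which only the values on \<open>idx\<close> matter.\<close>

definition idx :: "(nat ^ 'd) set"
  where "idx = {l. \<forall>j. 1 \<le> l $ j}"

definition ell2 :: "(nat ^ 'd \<Rightarrow> real) set"
  where "ell2 = {\<theta>. (\<lambda>l. (\<theta> l)\<^sup>2) summable_on idx}"

definition ell2_norm :: "(nat ^ 'd \<Rightarrow> real) \<Rightarrow> real"
  where "ell2_norm \<theta> = sqrt (\<Sum>\<^sub>\<infinity>l\<in>idx. (\<theta> l)\<^sup>2)"

text \<open>The summability condition is needed because \<^const>\<open>infsum\<close> is 0 on divergent families.\<close>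

definition ellipsoid :: "(nat ^ 'd \<Rightarrow> real) \<Rightarrow> real \<Rightarrow> (nat ^ 'd \<Rightarrow> real) set"
  where "ellipsoid a R = {\<theta> \<in> ell2. (\<lambda>l. (a l)\<^sup>2 * (\<theta> l)\<^sup>2) summable_on idx \<and>
           (\<Sum>\<^sub>\<infinity>l\<in>idx. (a l)\<^sup>2 * (\<theta> l)\<^sup>2) \<le> R\<^sup>2}"

definition alternative :: "(nat ^ 'd \<Rightarrow> real) \<Rightarrow> real \<Rightarrow> real \<Rightarrow> (nat ^ 'd \<Rightarrow> real) set"
  where "alternative a R r = {\<theta> \<in> ellipsoid a R. ell2_norm \<theta> \<ge> r}"

definition obs_space :: "(nat ^ 'd \<Rightarrow> real) measure"
  where "obs_space = (\<Pi>\<^sub>M l\<in>idx. borel)"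

definition obs_law :: "(nat ^ 'd \<Rightarrow> real) \<Rightarrow> real \<Rightarrow> (nat ^ 'd \<Rightarrow> real) \<Rightarrow> (nat ^ 'd \<Rightarrow> real) measure"
  where "obs_law b \<epsilon> \<theta> =
           distr (\<Pi>\<^sub>M l\<in>idx. std_normal_distribution) obs_space
             (\<lambda>\<xi>. \<lambda>l\<in>idx. b l * \<theta> l + \<epsilon> * \<xi> l)"

definition tests :: "((nat ^ 'd \<Rightarrow> real) \<Rightarrow> nat) set"
  where "tests = measurable obs_space (count_space {0, 1})"

definition tests_of_level ::
    "(nat ^ 'd \<Rightarrow> real) \<Rightarrow> real \<Rightarrow> real \<Rightarrow> ((nat ^ 'd \<Rightarrow> real) \<Rightarrow> nat) set"
  where "tests_of_level b \<epsilon> q =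
           {\<psi> \<in> tests. measure (obs_law b \<epsilon> (\<lambda>_. 0)) {y \<in> space obs_space. \<psi> y = 1} \<le> q}"

text \<open>The supremum is taken in \<^typ>\<open>ennreal\<close>, so that it is 0 for an empty alternative.\<close>

definition type_II_error ::
    "(nat ^ 'd \<Rightarrow> real) \<Rightarrow> real \<Rightarrow> (nat ^ 'd \<Rightarrow> real) set \<Rightarrow> ((nat ^ 'd \<Rightarrow> real) \<Rightarrow> nat) \<Rightarrow> real"
  where "type_II_error b \<epsilon> T \<psi> =
           enn2real (SUP \<theta>\<in>T. emeasure (obs_law b \<epsilon> \<theta>) {y \<in> space obs_space. \<psi> y = 0})"

definition minimax_type_II_error ::
    "(nat ^ 'd \<Rightarrow> real) \<Rightarrow> real \<Rightarrow> (nat ^ 'd \<Rightarrow> real) set \<Rightarrow> real \<Rightarrow> real"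
  where "minimax_type_II_error b \<epsilon> T q = (INF \<psi>\<in>tests_of_level b \<epsilon> q. type_II_error b \<epsilon> T \<psi>)"

text \<open>A level-\<open>\<alpha>\<close> test has type I error at most \<open>\<alpha> + o(1)\<close> as \<open>\<epsilon> \<rightarrow> 0\<close>. For a single \<open>\<epsilon>\<close> such
  an asymptotic bound excludes no test, so the infimum over level-\<open>\<alpha>\<close> tests is taken with a
  prescribed remainder: at noise level \<open>\<epsilon>\<close> it runs over the tests of level \<open>\<alpha> + \<eta> \<epsilon>\<close>, and every
  asymptotic assertion is required for all remainders \<open>\<eta>\<close> tending to 0.\<close>

definition level_remainder :: "(real \<Rightarrow> real) \<Rightarrow> bool"
  where "level_remainder \<eta> \<longleftrightarrow> (\<eta> \<longlongrightarrow> 0) (at_right 0)"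

text \<open>A separation rate is a family of positive reals, here for all small \<open>\<epsilon>\<close>, since
  the powers of \<open>ln (1 / \<epsilon>)\<close> are positive only for \<open>\<epsilon> < 1\<close>.\<close>

definition minimax_separation_rate ::
    "(nat ^ 'd \<Rightarrow> real) \<Rightarrow> (nat ^ 'd \<Rightarrow> real) \<Rightarrow> real \<Rightarrow> real \<Rightarrow> (real \<Rightarrow> real) \<Rightarrow> bool"
  where "minimax_separation_rate a b R \<alpha> rs \<longleftrightarrow>
    (\<forall>\<^sub>F \<epsilon> in at_right 0. rs \<epsilon> > 0) \<and>
    (\<forall>\<eta> r. level_remainder \<eta> \<longrightarrow>
      (((\<lambda>\<epsilon>. r \<epsilon> / rs \<epsilon>) \<longlongrightarrow> 0) (at_right 0) \<longrightarrow>
        ((\<lambda>\<epsilon>. minimax_type_II_error b \<epsilon> (alternative a R (r \<epsilon>)) (\<alpha> + \<eta> \<epsilon>)) \<longlongrightarrow> 1 - \<alpha>)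
          (at_right 0)) \<and>
      (filterlim (\<lambda>\<epsilon>. r \<epsilon> / rs \<epsilon>) at_top (at_right 0) \<longrightarrow>
        ((\<lambda>\<epsilon>. minimax_type_II_error b \<epsilon> (alternative a R (r \<epsilon>)) (\<alpha> + \<eta> \<epsilon>)) \<longlongrightarrow> 0)
          (at_right 0)))"

definition same_order :: "(real \<Rightarrow> real) \<Rightarrow> (real \<Rightarrow> real) \<Rightarrow> bool"
  where "same_order v w \<longleftrightarrow>
    (\<exists>k0>0. \<exists>k1>0. \<forall>\<^sub>F \<epsilon> in at_right 0. k0 * w \<epsilon> \<le> v \<epsilon> \<and> v \<epsilon> \<le> k1 * w \<epsilon>)"

definition extremal_u ::
    "(nat ^ 'd \<Rightarrow> real) \<Rightarrow> (nat ^ 'd \<Rightarrow> real) \<Rightarrow> real \<Rightarrow> real \<Rightarrow> real \<Rightarrow> real"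
  where "extremal_u a b R \<epsilon> r =
    sqrt (1 / (2 * \<epsilon> ^ 4) * (INF \<theta>\<in>alternative a R r. \<Sum>\<^sub>\<infinity>k\<in>idx. (b k) ^ 4 * (\<theta> k) ^ 4))"

definition std_normal_cdf :: "real \<Rightarrow> real"
  where "std_normal_cdf = cdf std_normal_distribution"

definition upper_quantile :: "real \<Rightarrow> real"
  where "upper_quantile \<alpha> = Inf {x. 1 - \<alpha> \<le> std_normal_cdf x}"

end

theory Submission
  imports Defs "HOL-Real_Asymp.Real_Asymp"
begin

text \<open>On the set of multi-indices with \<open>l\<^sub>1 + \<dots> + l\<^sub>d \<le> N\<close>, where \<open>N\<close> is close to \<open>ln (1/\<epsilon>) / s\<close>, the smoothness
  constraint is nearly inactive, and beyond that set the constraint leaves only energy of order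
  \<open>\<epsilon>\<^sup>2\<close>, negligible against \<open>r\<^sup>2\<close>. So the explicit sequence \<open>\<theta>\<^sub>l\<^sup>2\<close> proportional to \<open>b\<^sub>l\<close> to the power
  \<open>-4\<close> on this set nearly solves the extremal problem, and it matches a Cauchy-Schwarz lower bound up
  to \<open>o(1)\<close>, because the sums of these powers for \<open>N\<close> and for \<open>N - \<surd>N\<close> are asymptotically equal.

  Upper bound: test with the chi-square statistic weighted by \<open>1/b\<^sub>l\<^sup>2\<close>; its mean is at least \<open>u\<close> on the
  whole alternative and its noise part is asymptotically standard normal. Lower bound: put independent
  random signs on the extremal sequence, which keeps it in the alternative. The likelihood ratio \<open>L\<close> is
  then a product of \<open>exp (-v\<^sup>2/2) cosh (v \<xi>)\<close> and close to \<open>exp (u Z - u\<^sup>2/2)\<close> with \<open>Z\<close> standard normal, and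
  for every test and every \<open>c \<ge> 0\<close> the Bayes type II error plus \<open>c\<close> times the type I error is at least
  the expectation of \<open>min L c\<close> under the null hypothesis.\<close>

section \<open>The central limit theorem for weighted chi-square sums\<close>

text \<open>The noise level is a continuous parameter, and the index set, the weights and the
  truncated likelihood all move with it. Asymptotic normality is therefore stated as a threshold:
  one \<delta> serves all finite index sets, all normalised weights below \<delta> and all test
  functions with common bounds. Both error bounds inherit this form, and cutoffs depending on
  \<epsilon> are inserted only at the end.

  The extremal problem is never solved exactly. A test at one cutoff and a prior at a slightly
  smaller one enclose \<open>u\<close> between two explicit numbers whose difference vanishes, and
  since the normal distribution function is Lipschitz, this closes the gap between the two error
  bounds.

  That single coordinates are negligible comes from counting. On the index set of level N the
  largest \<open>1 / b\<^sub>l\<^sup>2\<close> has order at most N to the power 2\<tau>, with \<tau>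
  the sum of the \<open>t\<^sub>j\<close>, while the root of the sum of their squares has order N to
  the power 2\<tau> + d/2. The surplus d/2 drives both the test weights and the squared prior
  signals to 0.\<close>

lemma exp_minus_second_order:
  fixes x :: real
  assumes "0 \<le> x"
  shows "\<bar>exp (- x) - (1 - x)\<bar> \<le> x\<^sup>2"
proof -
  have 1: "1 - x \<le> exp (- x)"
    using exp_ge_add_one_self[of "- x"] by simp
  have "exp (- x) = 1 / exp x" by (simp add: exp_minus inverse_eq_divide)
  also have "\<dots> \<le> 1 / (1 + x)"
    using exp_ge_add_one_self[of x] assms by (intro divide_left_mono) auto
  also have "\<dots> \<le> 1 - x + x\<^sup>2"
  proof -
    have "1 \<le> (1 - x + x\<^sup>2) * (1 + x)"
      using assms by (simp add: algebra_simps power2_eq_square)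
    thus ?thesis using assms by (simp add: field_simps)
  qed
  finally show ?thesis using 1 by auto
qed

abbreviation std_normal :: "real measure" where "std_normal \<equiv> std_normal_distribution"

lemma std_normal_moment_0: "integral\<^sup>L std_normal (\<lambda>x. 1) = (1::real)"
proof -
  interpret prob_space std_normal by (simp add: prob_space_normal_density)
  show ?thesis using prob_space by simp
qed

lemma std_normal_moments:
  shows "integral\<^sup>L std_normal (\<lambda>x. x\<^sup>2) = 1"
    and "integral\<^sup>L std_normal (\<lambda>x. x ^ 4) = 3"
    and "integral\<^sup>L std_normal (\<lambda>x. x ^ 8) = 105"
  using std_normal_distribution_even_moments(1)[of 1] std_normal_distribution_even_moments(1)[of 2]
    std_normal_distribution_even_moments(1)[of 4]
  by (simp_all add: fact_numeral)

text \<open>\<open>J\<close> may be infinite while every sum below runs over a finite subset of it: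
  one probability space carries the statistics of all cutoffs and noise levels, so that a threshold
  can be uniform in the index set.\<close>

locale white_noise = prob_space M for M :: "'a measure" +
  fixes X :: "'i \<Rightarrow> 'a \<Rightarrow> real" and J :: "'i set"
  assumes indep: "indep_vars (\<lambda>_. borel) X J"
    and distr_X: "\<And>i. i \<in> J \<Longrightarrow> distr M borel (X i) = std_normal"
begin

lemma random_variable_X [measurable]: "i \<in> J \<Longrightarrow> X i \<in> borel_measurable M"
  using indep unfolding indep_vars_def2 by auto

lemma expectation_X:
  fixes f :: "real \<Rightarrow> real"
  assumes "i \<in> J" and [measurable]: "f \<in> borel_measurable borel"
  shows "expectation (\<lambda>\<omega>. f (X i \<omega>)) = integral\<^sup>L std_normal f"
  using integral_distr[OF random_variable_X[OF assms(1)], of f] assms by (simp add: distr_X)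

lemma integrable_X:
  fixes f :: "real \<Rightarrow> real"
  assumes "i \<in> J" and [measurable]: "f \<in> borel_measurable borel" and "integrable std_normal f"
  shows "integrable M (\<lambda>\<omega>. f (X i \<omega>))"
  using integrable_distr_eq[OF random_variable_X[OF assms(1)], of f] assms by (simp add: distr_X)

lemma integrable_power_X: "i \<in> J \<Longrightarrow> integrable M (\<lambda>\<omega>. X i \<omega> ^ k)"
  using integrable_X[of i "\<lambda>x. x ^ k"] integrable_std_normal_distribution_moment by simp

lemma expectation_power_X:
  assumes "i \<in> J"
  shows "expectation (X i) = 0" "expectation (\<lambda>\<omega>. (X i \<omega>)\<^sup>2) = 1"
    "expectation (\<lambda>\<omega>. X i \<omega> ^ 4) = 3" "expectation (\<lambda>\<omega>. X i \<omega> ^ 8) = 105"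
  using expectation_X[OF assms, of "\<lambda>x. x"] expectation_X[OF assms, of "\<lambda>x. x ^ 2"]
    expectation_X[OF assms, of "\<lambda>x. x ^ 4"] expectation_X[OF assms, of "\<lambda>x. x ^ 8"]
    std_normal_moments integral_std_normal_distribution_moment_odd[of 1]
  by simp_all

text \<open>The square of a standard normal variable has variance 2. The recurring normalisation,
  squared weights adding up to 1/2, therefore gives this centred sum variance 1.\<close>

definition chi2 :: "'i set \<Rightarrow> ('i \<Rightarrow> real) \<Rightarrow> 'a \<Rightarrow> real"
  where "chi2 I w \<omega> = (\<Sum>i\<in>I. w i * ((X i \<omega>)\<^sup>2 - 1))"

lemma chi2_measurable: "I \<subseteq> J \<Longrightarrow> chi2 I w \<in> borel_measurable M"
  unfolding chi2_def by (intro borel_measurable_sum borel_measurable_times borel_measurable_const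
      borel_measurable_diff borel_measurable_power random_variable_X) auto

lemma expectation_square_chi2_single:
  assumes "i \<in> J"
  shows "integrable M (\<lambda>\<omega>. w * ((X i \<omega>)\<^sup>2 - 1))"
    and "expectation (\<lambda>\<omega>. w * ((X i \<omega>)\<^sup>2 - 1)) = 0"
    and "integrable M (\<lambda>\<omega>. (w * ((X i \<omega>)\<^sup>2 - 1))\<^sup>2)"
    and "expectation (\<lambda>\<omega>. (w * ((X i \<omega>)\<^sup>2 - 1))\<^sup>2) = 2 * w\<^sup>2"
proof -
  note [simp] = integrable_power_X[OF assms] expectation_power_X[OF assms]
  show "integrable M (\<lambda>\<omega>. w * ((X i \<omega>)\<^sup>2 - 1))"
    by (intro integrable_mult_right Bochner_Integration.integrable_diff) simp_all
  show "expectation (\<lambda>\<omega>. w * ((X i \<omega>)\<^sup>2 - 1)) = 0"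
    by (simp add: Bochner_Integration.integral_diff prob_space)
  have *: "(w * ((X i \<omega>)\<^sup>2 - 1))\<^sup>2 = w\<^sup>2 * (X i \<omega> ^ 4 - 2 * (X i \<omega>)\<^sup>2 + 1)" for \<omega>
    by (simp add: power_mult_distrib power2_diff flip: power_mult)
  show "integrable M (\<lambda>\<omega>. (w * ((X i \<omega>)\<^sup>2 - 1))\<^sup>2)"
    unfolding * by (intro integrable_mult_right Bochner_Integration.integrable_add Bochner_Integration.integrable_diff) simp_all
  show "expectation (\<lambda>\<omega>. (w * ((X i \<omega>)\<^sup>2 - 1))\<^sup>2) = 2 * w\<^sup>2"
    unfolding * by (simp add: Bochner_Integration.integral_add Bochner_Integration.integral_diff prob_space)
qed

definition \<kappa>3 :: real where "\<kappa>3 = integral\<^sup>L std_normal (\<lambda>x. \<bar>x\<^sup>2 - 1\<bar> ^ 3)"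

lemma integrable_third: "integrable std_normal (\<lambda>x. \<bar>x\<^sup>2 - 1\<bar> ^ 3)"
proof -
  have int: "integrable std_normal (\<lambda>x. x ^ 6 + 3 * x ^ 4 + 3 * x ^ 2 + 1)"
    using integrable_std_normal_distribution_moment[of 6] integrable_std_normal_distribution_moment[of 4]
      integrable_std_normal_distribution_moment[of 2] integrable_std_normal_distribution_moment[of 0]
    by (intro Bochner_Integration.integrable_add integrable_mult_right) simp_all
  show ?thesis
  proof (rule Bochner_Integration.integrable_bound[OF int])
    show "AE x in std_normal. norm (\<bar>x\<^sup>2 - 1\<bar> ^ 3) \<le> norm (x ^ 6 + 3 * x ^ 4 + 3 * x ^ 2 + 1)"
    proof (rule AE_I2)
      fix x :: real
      have "\<bar>x\<^sup>2 - 1\<bar> ^ 3 \<le> (x\<^sup>2 + 1) ^ 3"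
        by (intro power_mono) (auto simp: abs_le_iff)
      also have "\<dots> = x ^ 6 + 3 * x ^ 4 + 3 * x ^ 2 + 1"
        by (simp add: eval_nat_numeral algebra_simps)
      finally show "norm (\<bar>x\<^sup>2 - 1\<bar> ^ 3) \<le> norm (x ^ 6 + 3 * x ^ 4 + 3 * x ^ 2 + 1)"
        by simp
    qed
  qed simp
qed

lemma \<kappa>3_nonneg: "0 \<le> \<kappa>3"
  unfolding \<kappa>3_def by (rule integral_nonneg_AE) simp

text \<open>Third-order expansion of a characteristic function: the summand is centred with variance
  \<open>2 * w\<^sup>2\<close>, which leaves \<open>t\<^sup>2 * w\<^sup>2\<close> after
  halving.\<close>

lemma char_chi2_single:
  assumes i: "i \<in> J"
  shows "cmod (char (distr M borel (\<lambda>\<omega>. w * ((X i \<omega>)\<^sup>2 - 1))) t - (1 - t\<^sup>2 * w\<^sup>2))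
    \<le> \<bar>t\<bar> ^ 3 * \<bar>w\<bar> ^ 3 * \<kappa>3 / 6"
proof -
  note [measurable] = random_variable_X[OF i]
  note e = expectation_square_chi2_single[OF i]
  let ?Y = "\<lambda>\<omega>. w * ((X i \<omega>)\<^sup>2 - 1)"
  have "cmod (char (distr M borel ?Y) t - (1 - t\<^sup>2 * (2 * w\<^sup>2) / 2))
    \<le> (t\<^sup>2 / 6) * expectation (\<lambda>\<omega>. min (6 * (?Y \<omega>)\<^sup>2) (\<bar>t\<bar> * \<bar>?Y \<omega>\<bar> ^ 3))"
    using e(1,3) e(2,4)[of w] by (intro char_approx3') (auto simp only: diff_zero, measurable)
  \<comment> \<open>Of the two branches of the minimum only the cubic one is kept, third moments
    being finite.\<close>
  moreover have "expectation (\<lambda>\<omega>. min (6 * (?Y \<omega>)\<^sup>2) (\<bar>t\<bar> * \<bar>?Y \<omega>\<bar> ^ 3))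
     \<le> expectation (\<lambda>\<omega>. \<bar>t\<bar> * \<bar>w\<bar> ^ 3 * \<bar>(X i \<omega>)\<^sup>2 - 1\<bar> ^ 3)"
  proof (rule integral_mono_AE')
    show "integrable M (\<lambda>\<omega>. \<bar>t\<bar> * \<bar>w\<bar> ^ 3 * \<bar>(X i \<omega>)\<^sup>2 - 1\<bar> ^ 3)"
      using integrable_X[OF i _ integrable_third] by (intro integrable_mult_right) simp
  qed (auto simp: abs_mult power_mult_distrib)
  moreover have "expectation (\<lambda>\<omega>. \<bar>t\<bar> * \<bar>w\<bar> ^ 3 * \<bar>(X i \<omega>)\<^sup>2 - 1\<bar> ^ 3) = \<bar>t\<bar> * \<bar>w\<bar> ^ 3 * \<kappa>3"
    using expectation_X[OF i, of "\<lambda>x. \<bar>x\<^sup>2 - 1\<bar> ^ 3"] by (simp add: \<kappa>3_def)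
  ultimately have "cmod (char (distr M borel ?Y) t - (1 - t\<^sup>2 * (2 * w\<^sup>2) / 2))
    \<le> (t\<^sup>2 / 6) * (\<bar>t\<bar> * \<bar>w\<bar> ^ 3 * \<kappa>3)"
    by (smt (verit) mult_left_mono zero_le_power2 divide_nonneg_pos)
  also have "\<dots> = \<bar>t\<bar> ^ 3 * \<bar>w\<bar> ^ 3 * \<kappa>3 / 6"
    by (simp add: power3_eq_cube power2_eq_square)
  finally show ?thesis by simp
qed

text \<open>Both sides factor over \<open>I\<close>, and products of numbers of modulus at most 1
  differ by no more than the sum of the differences of their factors. Each such difference is cubic
  or quartic in the weight, hence at most \<open>(w i)\<^sup>2\<close> times a quantity vanishing
  with \<open>d\<close>, and the normalisation adds these up.\<close>

lemma char_chi2: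
  assumes I: "finite I" "I \<subseteq> J" and w: "(\<Sum>i\<in>I. (w i)\<^sup>2) = 1 / 2" and d: "\<And>i. i \<in> I \<Longrightarrow> \<bar>w i\<bar> \<le> d" "0 \<le> d"
  shows "cmod (char (distr M borel (chi2 I w)) t - exp (- t\<^sup>2 / 2)) \<le> d * (\<bar>t\<bar> ^ 3 * \<kappa>3 / 6) + d\<^sup>2 * t ^ 4"
proof -
  let ?Y = "\<lambda>i \<omega>. w i * ((X i \<omega>)\<^sup>2 - 1)"
  have "indep_vars (\<lambda>i. borel) ?Y I"
    by (rule indep_vars_compose2[where X=X, OF indep_vars_subset[OF indep I(2)]]) auto
  then have "char (distr M borel (chi2 I w)) t = (\<Prod>i\<in>I. char (distr M borel (?Y i)) t)"
    unfolding chi2_def[abs_def] by (rule char_distr_sum)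
  moreover have "complex_of_real (exp (- t\<^sup>2 / 2)) = (\<Prod>i\<in>I. complex_of_real (exp (- (t\<^sup>2 * (w i)\<^sup>2))))"
  proof -
    have "- t\<^sup>2 / 2 = (\<Sum>i\<in>I. - (t\<^sup>2 * (w i)\<^sup>2))"
      using w by (simp add: sum_negf flip: sum_distrib_left)
    thus ?thesis by (simp add: exp_sum I(1))
  qed
  ultimately have "cmod (char (distr M borel (chi2 I w)) t - exp (- t\<^sup>2 / 2))
    \<le> (\<Sum>i\<in>I. cmod (char (distr M borel (?Y i)) t - exp (- (t\<^sup>2 * (w i)\<^sup>2))))"
  proof (simp only:, intro norm_prod_diff)
    fix i assume i: "i \<in> I"
    have "random_variable borel (?Y i)" using i I by (auto intro!: borel_measurable_times borel_measurable_diff borel_measurable_power random_variable_X)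
    then interpret Y: real_distribution "distr M borel (?Y i)" by (rule real_distribution_distr)
    show "cmod (char (distr M borel (?Y i)) t) \<le> 1" by (rule Y.cmod_char_le_1)
    show "cmod (complex_of_real (exp (- (t\<^sup>2 * (w i)\<^sup>2)))) \<le> 1" by simp
  qed
  also have "\<dots> \<le> (\<Sum>i\<in>I. 2 * (w i)\<^sup>2 * (d * (\<bar>t\<bar> ^ 3 * \<kappa>3 / 6) + d\<^sup>2 * t ^ 4))"
  proof (rule sum_mono)
    fix i assume i: "i \<in> I"
    have "cmod (char (distr M borel (?Y i)) t - exp (- (t\<^sup>2 * (w i)\<^sup>2)))
      = cmod ((char (distr M borel (?Y i)) t - (1 - t\<^sup>2 * (w i)\<^sup>2)) - complex_of_real (exp (- (t\<^sup>2 * (w i)\<^sup>2)) - (1 - t\<^sup>2 * (w i)\<^sup>2)))"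
      by simp
    also have "\<dots> \<le> \<bar>t\<bar> ^ 3 * \<bar>w i\<bar> ^ 3 * \<kappa>3 / 6 + \<bar>exp (- (t\<^sup>2 * (w i)\<^sup>2)) - (1 - t\<^sup>2 * (w i)\<^sup>2)\<bar>"
      using i I by (intro order.trans[OF norm_triangle_ineq4] add_mono char_chi2_single) (auto simp only: norm_of_real)
    also have "\<dots> \<le> \<bar>t\<bar> ^ 3 * \<bar>w i\<bar> ^ 3 * \<kappa>3 / 6 + (t\<^sup>2 * (w i)\<^sup>2)\<^sup>2"
      by (intro add_mono order_refl exp_minus_second_order) simp
    also have "\<dots> = (w i)\<^sup>2 * (\<bar>w i\<bar> * (\<bar>t\<bar> ^ 3 * \<kappa>3 / 6) + (w i)\<^sup>2 * t ^ 4)"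
    proof -
      have "\<bar>w i\<bar> ^ 3 = (w i)\<^sup>2 * \<bar>w i\<bar>" by (simp add: power3_eq_cube power2_eq_square)
      thus ?thesis by (simp add: algebra_simps power2_eq_square power4_eq_xxxx)
    qed
    also have "\<dots> \<le> (w i)\<^sup>2 * (d * (\<bar>t\<bar> ^ 3 * \<kappa>3 / 6) + d\<^sup>2 * t ^ 4)"
      using d(1)[OF i] \<kappa>3_nonneg by (intro mult_left_mono add_mono mult_right_mono) (auto simp: abs_le_square_iff[symmetric])
    \<comment> \<open>The spare factor 2 makes the coefficients \<open>2 * (w i)\<^sup>2\<close> add
      up to 1.\<close>
    also have "\<dots> \<le> 2 * (w i)\<^sup>2 * (d * (\<bar>t\<bar> ^ 3 * \<kappa>3 / 6) + d\<^sup>2 * t ^ 4)"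
      using d(2) \<kappa>3_nonneg by (intro mult_right_mono) auto
    finally show "cmod (char (distr M borel (?Y i)) t - exp (- (t\<^sup>2 * (w i)\<^sup>2))) \<le> 2 * (w i)\<^sup>2 * (d * (\<bar>t\<bar> ^ 3 * \<kappa>3 / 6) + d\<^sup>2 * t ^ 4)" .
  qed
  also have "\<dots> = d * (\<bar>t\<bar> ^ 3 * \<kappa>3 / 6) + d\<^sup>2 * t ^ 4"
    using w by (simp flip: sum_distrib_right sum_distrib_left)
  finally show ?thesis .
qed

lemma chi2_weak_conv:
  assumes I: "\<And>n. finite (I n)" "\<And>n. I n \<subseteq> J" and w: "\<And>n. (\<Sum>i\<in>I n. (w n i)\<^sup>2) = 1 / 2"
    and d: "\<And>n i. i \<in> I n \<Longrightarrow> \<bar>w n i\<bar> \<le> d n" "\<And>n. 0 \<le> d n" "d \<longlonglongrightarrow> (0::real)"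
  shows "weak_conv_m (\<lambda>n. distr M borel (chi2 (I n) (w n))) std_normal"
proof (rule levy_continuity)
  show "real_distribution (distr M borel (chi2 (I n) (w n)))" for n
    by (rule real_distribution_distr[OF chi2_measurable[OF I(2)]])
  show "real_distribution std_normal" by (rule real_dist_normal_dist)
  fix t :: real
  have "(\<lambda>n. d n * (\<bar>t\<bar> ^ 3 * \<kappa>3 / 6) + (d n)\<^sup>2 * t ^ 4) \<longlonglongrightarrow> 0 * (\<bar>t\<bar> ^ 3 * \<kappa>3 / 6) + 0\<^sup>2 * t ^ 4"
    by (intro tendsto_intros d)
  then have "(\<lambda>n. d n * (\<bar>t\<bar> ^ 3 * \<kappa>3 / 6) + (d n)\<^sup>2 * t ^ 4) \<longlonglongrightarrow> 0" by simp
  moreover have "\<forall>\<^sub>F n in sequentially. cmod (char (distr M borel (chi2 (I n) (w n))) t - exp (- t\<^sup>2 / 2))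
      \<le> d n * (\<bar>t\<bar> ^ 3 * \<kappa>3 / 6) + (d n)\<^sup>2 * t ^ 4"
    by (intro always_eventually allI char_chi2 I w d)
  ultimately have "(\<lambda>n. char (distr M borel (chi2 (I n) (w n))) t - exp (- t\<^sup>2 / 2)) \<longlonglongrightarrow> 0"
    by (rule Lim_null_comparison[rotated])
  then show "(\<lambda>n. char (distr M borel (chi2 (I n) (w n))) t) \<longlonglongrightarrow> char std_normal t"
    by (subst char_std_normal_distribution) (simp add: LIM_zero_iff)
qed

text \<open>By contradiction: counterexamples for \<open>\<delta> = 1 / Suc n\<close> form a
  sequence along which weak convergence holds. As the test functions also vary with n, weak
  convergence alone is not enough. Skorohod's representation turns it into pointwise convergence,
  the common Lipschitz constant \<open>K\<close> then controls
  \<open>g n (Y_seq n x) - g n (Y x)\<close>, and the common bound \<open>B\<close> gives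
  domination.\<close>

lemma chi2_uniform_clt:
  fixes B K e :: real
  assumes "0 < e"
  obtains \<delta> where "0 < \<delta>"
    "\<And>I w g. finite I \<Longrightarrow> I \<subseteq> J \<Longrightarrow> (\<Sum>i\<in>I. (w i)\<^sup>2) = 1 / 2 \<Longrightarrow> (\<And>i. i \<in> I \<Longrightarrow> \<bar>w i\<bar> \<le> \<delta>) \<Longrightarrow>
      (\<And>x. \<bar>g x\<bar> \<le> B) \<Longrightarrow> (\<And>x y. \<bar>g x - g y\<bar> \<le> K * \<bar>x - y\<bar>) \<Longrightarrow>
      \<bar>expectation (\<lambda>\<omega>. g (chi2 I w \<omega>)) - integral\<^sup>L std_normal g\<bar> \<le> e"
proof -
  define good where "good \<delta> I w g \<longleftrightarrow> finite I \<and> I \<subseteq> J \<and> (\<Sum>i\<in>I. (w i)\<^sup>2) = 1 / 2 \<and> (\<forall>i\<in>I. \<bar>w i\<bar> \<le> \<delta>) \<and>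
      (\<forall>x. \<bar>g x\<bar> \<le> B) \<and> (\<forall>x y. \<bar>g x - g y\<bar> \<le> K * \<bar>x - y\<bar>)" for \<delta> :: real and I w g
  have "\<exists>\<delta>>0. \<forall>I w g. good \<delta> I w g \<longrightarrow> \<bar>expectation (\<lambda>\<omega>. g (chi2 I w \<omega>)) - integral\<^sup>L std_normal g\<bar> \<le> e"
  proof (rule ccontr)
    assume "\<not> ?thesis"
    then have "\<exists>I w g. good (1 / Suc n) I w g \<and> e < \<bar>expectation (\<lambda>\<omega>. g (chi2 I w \<omega>)) - integral\<^sup>L std_normal g\<bar>" for n
      by (auto simp: not_le dest!: spec[of _ "1 / Suc n"])
    then obtain I w g where g: "\<And>n::nat. good (1 / Suc n) (I n) (w n) (g n)"
      and far: "\<And>n. e < \<bar>expectation (\<lambda>\<omega>. g n (chi2 (I n) (w n) \<omega>)) - integral\<^sup>L std_normal (g n)\<bar>"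
      by metis
    note G = g[unfolded good_def]
    have gB: "\<bar>g n x\<bar> \<le> B" and gK: "\<bar>g n x - g n y\<bar> \<le> K * \<bar>x - y\<bar>" and IJ: "I n \<subseteq> J" for n x y
      using G[of n] by blast+
    have "weak_conv_m (\<lambda>n. distr M borel (chi2 (I n) (w n))) std_normal"
      using G LIMSEQ_inverse_real_of_nat by (intro chi2_weak_conv[where d="\<lambda>n. 1 / Suc n"]) (auto simp: inverse_eq_divide)
    moreover have rd: "real_distribution (distr M borel (chi2 (I n) (w n)))" for n
      by (intro real_distribution_distr chi2_measurable IJ)
    ultimately have "\<exists>\<Omega>::real measure. \<exists>Y_seq Y. prob_space \<Omega> \<and> (\<forall>n. Y_seq n \<in> borel_measurable \<Omega>) \<and>
        (\<forall>n. distr \<Omega> borel (Y_seq n) = distr M borel (chi2 (I n) (w n))) \<and>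
        Y \<in> measurable \<Omega> lborel \<and> distr \<Omega> borel Y = std_normal \<and> (\<forall>x\<in>space \<Omega>. (\<lambda>n. Y_seq n x) \<longlonglongrightarrow> Y x)"
      by (intro Skorohod rd real_dist_normal_dist)
    then obtain \<Omega> :: "real measure" and Y_seq Y where \<Omega>: "prob_space \<Omega>"
      and Y_seq [measurable]: "\<And>n. Y_seq n \<in> borel_measurable \<Omega>"
      and dY_seq: "\<And>n. distr \<Omega> borel (Y_seq n) = distr M borel (chi2 (I n) (w n))"
      and Y: "Y \<in> measurable \<Omega> lborel" and dY: "distr \<Omega> borel Y = std_normal"
      and lim: "\<And>x. x \<in> space \<Omega> \<Longrightarrow> (\<lambda>n. Y_seq n x) \<longlonglongrightarrow> Y x"
      by blast
    interpret \<Omega>: prob_space \<Omega> by fact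
    have [measurable]: "Y \<in> borel_measurable \<Omega>" using Y by simp
    \<comment> \<open>No sign of \<open>K\<close> is assumed; it is read off from one instance of
      the Lipschitz bound.\<close>
    have "\<bar>g 0 0 - g 0 1\<bar> \<le> K * \<bar>0 - 1\<bar>" by (rule gK)
    then have Kpos: "0 \<le> K" by simp
    have cont: "continuous_on UNIV (g n)" for n
    proof -
      have "K-lipschitz_on UNIV (g n)" using gK Kpos by (simp add: lipschitz_on_def dist_real_def)
      thus ?thesis by (rule lipschitz_on_continuous_on)
    qed
    have [measurable]: "g n \<in> borel_measurable borel" for n
      by (rule borel_measurable_continuous_onI[OF cont])
    have [measurable]: "chi2 (I n) (w n) \<in> borel_measurable M" for n
      by (intro chi2_measurable IJ)
    have "expectation (\<lambda>\<omega>. g n (chi2 (I n) (w n) \<omega>)) = (\<integral>x. g n x \<partial>distr M borel (chi2 (I n) (w n)))" for n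
      by (simp add: integral_distr)
    also have "\<And>n. \<dots> n = (\<integral>x. g n (Y_seq n x) \<partial>\<Omega>)"
      by (simp add: integral_distr flip: dY_seq)
    finally have 1: "\<And>n. expectation (\<lambda>\<omega>. g n (chi2 (I n) (w n) \<omega>)) = (\<integral>x. g n (Y_seq n x) \<partial>\<Omega>)" .
    have 2: "integral\<^sup>L std_normal (g n) = (\<integral>x. g n (Y x) \<partial>\<Omega>)" for n
      by (simp add: integral_distr flip: dY)
    have int: "integrable \<Omega> (\<lambda>x. g n (Z x))" if [measurable]: "Z \<in> borel_measurable \<Omega>" for n Z
      using gB by (intro \<Omega>.integrable_const_bound[where B=B]) auto
    have "(\<lambda>n. \<integral>x. g n (Y_seq n x) - g n (Y x) \<partial>\<Omega>) \<longlonglongrightarrow> (\<integral>x. 0 \<partial>\<Omega>)"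
    proof (rule integral_dominated_convergence[where w="\<lambda>_. 2 * B"])
      show "AE x in \<Omega>. (\<lambda>n. g n (Y_seq n x) - g n (Y x)) \<longlonglongrightarrow> 0"
      proof (rule AE_I2)
        fix x assume "x \<in> space \<Omega>"
        from lim[OF this] have "(\<lambda>n. K * \<bar>Y_seq n x - Y x\<bar>) \<longlonglongrightarrow> K * \<bar>Y x - Y x\<bar>"
          by (intro tendsto_intros)
        then have "(\<lambda>n. K * \<bar>Y_seq n x - Y x\<bar>) \<longlonglongrightarrow> 0" by simp
        moreover have "\<forall>\<^sub>F n in sequentially. norm (g n (Y_seq n x) - g n (Y x)) \<le> K * \<bar>Y_seq n x - Y x\<bar>"
          unfolding real_norm_def by (intro always_eventually allI gK)
        ultimately show "(\<lambda>n. g n (Y_seq n x) - g n (Y x)) \<longlonglongrightarrow> 0"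
          by (rule Lim_null_comparison[rotated])
      qed
      show "AE x in \<Omega>. norm (g n (Y_seq n x) - g n (Y x)) \<le> 2 * B" for n
      proof (rule AE_I2)
        fix x show "norm (g n (Y_seq n x) - g n (Y x)) \<le> 2 * B"
          using gB[of n "Y_seq n x"] gB[of n "Y x"] unfolding real_norm_def by linarith
      qed
    qed simp_all
    then have "(\<lambda>n. expectation (\<lambda>\<omega>. g n (chi2 (I n) (w n) \<omega>)) - integral\<^sup>L std_normal (g n)) \<longlonglongrightarrow> 0"
      by (simp add: 1 2 int Bochner_Integration.integral_diff)
    then have "eventually (\<lambda>n. \<bar>expectation (\<lambda>\<omega>. g n (chi2 (I n) (w n) \<omega>)) - integral\<^sup>L std_normal (g n)\<bar> < e) sequentially"
      using \<open>0 < e\<close> by (auto dest!: tendstoD simp: dist_real_def)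
    then obtain n where "\<bar>expectation (\<lambda>\<omega>. g n (chi2 (I n) (w n) \<omega>)) - integral\<^sup>L std_normal (g n)\<bar> < e"
      by (auto dest: eventually_happens)
    with far[of n] show False by simp
  qed
  then obtain \<delta> where "\<delta> > 0" "\<And>I w g. good \<delta> I w g \<Longrightarrow> \<bar>expectation (\<lambda>\<omega>. g (chi2 I w \<omega>)) - integral\<^sup>L std_normal g\<bar> \<le> e"
    by auto
  then show ?thesis by (intro that[of \<delta>]) (auto simp: good_def)
qed

end

section \<open>Gaussian noise and its shifts\<close>

lemma real_distribution_std_normal: "real_distribution std_normal"
  by (rule real_dist_normal_dist)

lemma std_normal_cdf_eq: "std_normal_cdf x = measure std_normal {..x}"
  by (simp add: std_normal_cdf_def cdf_def)

lemma std_normal_cdf_diff: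
  assumes "x \<le> y"
  shows "std_normal_cdf y - std_normal_cdf x = measure std_normal {x<..y}"
proof -
  interpret real_distribution std_normal by (rule real_distribution_std_normal)
  show ?thesis
    using cdf_diff_eq[of x y] assms by (cases "x = y") (auto simp: std_normal_cdf_def)
qed

lemma std_normal_cdf_mono: "x \<le> y \<Longrightarrow> std_normal_cdf x \<le> std_normal_cdf y"
  using std_normal_cdf_diff[of x y] measure_nonneg[of std_normal "{x<..y}"] by linarith

text \<open>The density is at most 1. This crude constant suffices everywhere below to trade an
  error in the argument for an error in the probability.\<close>

lemma std_normal_cdf_lipschitz:
  assumes "x \<le> y"
  shows "std_normal_cdf y \<le> std_normal_cdf x + (y - x)"
proof -
  interpret real_distribution std_normal by (rule real_distribution_std_normal)
  have "emeasure std_normal {x<..y} = (\<integral>\<^sup>+t. ennreal (std_normal_density t) * indicator {x<..y} t \<partial>lborel)"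
    by (simp add: emeasure_density)
  also have "\<dots> \<le> (\<integral>\<^sup>+t. indicator {x<..y} t \<partial>lborel)"
  proof (intro nn_integral_mono)
    fix t :: real
    have "std_normal_density t \<le> 1"
    proof -
      have "exp (- t\<^sup>2 / 2) \<le> 1" by simp
      moreover have "1 / sqrt (2 * pi) \<le> 1" using pi_ge_two by (simp add: real_le_rsqrt)
      ultimately show ?thesis unfolding std_normal_density_def
        by (intro mult_le_one) auto
    qed
    then show "ennreal (std_normal_density t) * indicator {x<..y} t \<le> indicator {x<..y} t"
      by (auto simp: indicator_def)
  qed
  also have "\<dots> = ennreal (y - x)" using assms by simp
  finally have "measure std_normal {x<..y} \<le> y - x"
    using assms by (simp add: emeasure_eq_measure)
  thus ?thesis using std_normal_cdf_diff[OF assms] by linarith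
qed

text \<open>The density never vanishes, so an interval of normal measure 0 would be Lebesgue null.
  Strictness identifies the quantile and later yields a positive safety margin in the level of a
  test.\<close>

lemma std_normal_cdf_strict_mono:
  assumes "x < y"
  shows "std_normal_cdf x < std_normal_cdf y"
proof -
  interpret real_distribution std_normal by (rule real_distribution_std_normal)
  have "measure std_normal {x<..y} \<noteq> 0"
  proof
    assume "measure std_normal {x<..y} = 0"
    then have "{x<..y} \<in> null_sets std_normal" by (simp add: null_sets_def emeasure_eq_measure)
    then have "AE t in lborel. t \<in> {x<..y} \<longrightarrow> ennreal (std_normal_density t) = 0"
      by (subst (asm) null_sets_density_iff) auto
    moreover have "ennreal (std_normal_density t) \<noteq> 0" for t
      using normal_density_pos[of 1 0 t] by (simp add: ennreal_eq_0_iff)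
    ultimately have "AE t in lborel. t \<notin> {x<..y}" by auto
    then have "{x<..y} \<in> null_sets lborel" by (subst AE_iff_null_sets) auto
    then have "emeasure lborel {x<..y} = 0" by auto
    with assms show False by simp
  qed
  with std_normal_cdf_diff[of x y] assms measure_nonneg[of std_normal "{x<..y}"] show ?thesis by linarith
qed

text \<open>Continuity and the limits at both ends give a solution by the intermediate value
  theorem; strict monotonicity makes it the least element of the set whose infimum defines the
  quantile.\<close>

lemma std_normal_cdf_upper_quantile:
  assumes "0 < \<alpha>" "\<alpha> < 1"
  shows "std_normal_cdf (upper_quantile \<alpha>) = 1 - \<alpha>"
proof -
  interpret real_distribution std_normal by (rule real_distribution_std_normal)
  have cont: "isCont std_normal_cdf x" for x
  proof -
    have "1-lipschitz_on UNIV std_normal_cdf"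
    proof (rule lipschitz_onI)
      fix x y show "dist (std_normal_cdf x) (std_normal_cdf y) \<le> 1 * dist x y"
        using std_normal_cdf_lipschitz[of x y] std_normal_cdf_lipschitz[of y x] std_normal_cdf_mono[of x y]
          std_normal_cdf_mono[of y x] by (cases "x \<le> y") (auto simp: dist_real_def)
    qed simp
    from lipschitz_on_continuous_on[OF this] show ?thesis by (simp add: continuous_on_eq_continuous_at)
  qed
  have lim: "(std_normal_cdf \<longlongrightarrow> 1) at_top" "(std_normal_cdf \<longlongrightarrow> 0) at_bot"
    unfolding std_normal_cdf_def by (rule cdf_lim_at_top_prob, rule cdf_lim_at_bot)
  have "\<forall>\<^sub>F x in at_top. 1 - \<alpha> < std_normal_cdf x" "\<forall>\<^sub>F x in at_bot. std_normal_cdf x < 1 - \<alpha>"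
    using order_tendstoD(1)[OF lim(1), of "1 - \<alpha>"] order_tendstoD(2)[OF lim(2), of "1 - \<alpha>"] assms by auto
  then obtain x1 x0 where x: "1 - \<alpha> < std_normal_cdf x1" "std_normal_cdf x0 < 1 - \<alpha>"
    by (meson eventually_at_top_linorder eventually_at_bot_linorder order_refl)
  then have "x0 \<le> x1" using std_normal_cdf_mono[of x1 x0] by linarith
  then obtain z where z: "std_normal_cdf z = 1 - \<alpha>"
    using IVT[of std_normal_cdf x0 "1 - \<alpha>" x1] x cont by auto
  have "upper_quantile \<alpha> = z"
    unfolding upper_quantile_def
  proof (rule cInf_eq_minimum)
    show "z \<in> {x. 1 - \<alpha> \<le> std_normal_cdf x}" using z by simp
    fix x assume "x \<in> {x. 1 - \<alpha> \<le> std_normal_cdf x}"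
    then show "z \<le> x" using std_normal_cdf_strict_mono[of x z] z by (cases "z \<le> x") auto
  qed
  with z show ?thesis by simp
qed

section \<open>Translations of Gaussian noise and their densities\<close>

lemma vimage_shift_borel: "A \<in> sets borel \<Longrightarrow> (\<lambda>x::real. x + m) -` A \<in> sets borel"
  using measurable_sets[of "\<lambda>x. x + m" borel borel A] by simp

text \<open>The Cameron-Martin formula in dimension one. After the substitution of
  \<open>m + x\<close> for \<open>x\<close>, completing the square cancels the exponential factor
  against the change of the normal density.\<close>

lemma gaussian_shift:
  "distr std_normal borel (\<lambda>x. x + m) = density std_normal (\<lambda>x. ennreal (exp (m * x - m\<^sup>2 / 2)))"
proof (rule measure_eqI)
  fix A assume "A \<in> sets (distr std_normal borel (\<lambda>x. x + m))"
  then have A [measurable]: "A \<in> sets borel" by simp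
  note A' [measurable] = vimage_shift_borel[OF A]
  have "emeasure (density std_normal (\<lambda>x. ennreal (exp (m * x - m\<^sup>2 / 2)))) A
      = (\<integral>\<^sup>+x. ennreal (std_normal_density x) * (ennreal (exp (m * x - m\<^sup>2 / 2)) * indicator A x) \<partial>lborel)"
    by (simp add: emeasure_density nn_integral_density)
  also have "\<dots> = (\<integral>\<^sup>+x. ennreal (std_normal_density (m + x)) * (ennreal (exp (m * (m + x) - m\<^sup>2 / 2)) * indicator A (m + x)) \<partial>lborel)"
    using nn_integral_real_affine[of "\<lambda>x. ennreal (std_normal_density x) * (ennreal (exp (m * x - m\<^sup>2 / 2)) * indicator A x)" 1 m]
    by simp
  also have "\<dots> = (\<integral>\<^sup>+x. ennreal (std_normal_density x) * indicator A (x + m) \<partial>lborel)"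
  proof (intro nn_integral_cong)
    fix x
    have "std_normal_density (m + x) * exp (m * (m + x) - m\<^sup>2 / 2) = std_normal_density x"
      unfolding std_normal_density_def
      by (simp add: exp_add[symmetric] power2_eq_square field_simps)
    then show "ennreal (std_normal_density (m + x)) * (ennreal (exp (m * (m + x) - m\<^sup>2 / 2)) * indicator A (m + x))
      = ennreal (std_normal_density x) * indicator A (x + m)"
      by (simp add: add.commute[of x m] mult.assoc[symmetric] flip: ennreal_mult')
  qed
  also have "\<dots> = emeasure std_normal ((\<lambda>x. x + m) -` A)"
    by (subst emeasure_density) (auto intro!: nn_integral_cong simp: indicator_def A')
  also have "\<dots> = emeasure (distr std_normal borel (\<lambda>x. x + m)) A"
    by (subst emeasure_distr) auto
  finally show "emeasure (distr std_normal borel (\<lambda>x. x + m)) A = emeasure (density std_normal (\<lambda>x. ennreal (exp (m * x - m\<^sup>2 / 2)))) A" ..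
qed simp

text \<open>The likelihood ratio of a normal law with mean \<open>u\<close> against mean 0 crosses
  the truncation level exactly at \<open>H\<close>. Below \<open>H\<close> the integral is a
  probability under the shifted law, above it is a constant times a tail. For the quantile
  \<open>H\<close> the first term is the target type II error and the second is the level times the
  truncation constant.\<close>

lemma integral_exp_min:
  assumes "0 < u"
  shows "integral\<^sup>L std_normal (\<lambda>x. min (exp (u * x - u\<^sup>2 / 2)) (exp (u * H - u\<^sup>2 / 2)))
    = std_normal_cdf (H - u) + exp (u * H - u\<^sup>2 / 2) * (1 - std_normal_cdf H)"
proof -
  interpret real_distribution std_normal by (rule real_distribution_std_normal)
  let ?c = "exp (u * H - u\<^sup>2 / 2)"
  have "emeasure (distr std_normal borel (\<lambda>x. x + u)) {..H} = (\<integral>\<^sup>+x. ennreal (exp (u * x - u\<^sup>2 / 2) * indicator {..H} x) \<partial>std_normal)"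
    unfolding gaussian_shift by (simp add: emeasure_density ennreal_mult' ennreal_indicator)
  moreover have "emeasure (distr std_normal borel (\<lambda>x. x + u)) {..H} = ennreal (std_normal_cdf (H - u))"
  proof -
    have "(\<lambda>x. x + u) -` {..H} = {..H - u}" by auto
    then show ?thesis by (simp add: emeasure_distr std_normal_cdf_eq emeasure_eq_measure)
  qed
  ultimately have "has_bochner_integral std_normal (\<lambda>x. exp (u * x - u\<^sup>2 / 2) * indicator {..H} x) (std_normal_cdf (H - u))"
    by (intro has_bochner_integral_nn_integral) (auto simp: std_normal_cdf_eq)
  moreover have "has_bochner_integral std_normal (\<lambda>x. ?c * indicator {H<..} x) (?c * (1 - std_normal_cdf H))"
  proof -
    have "measure std_normal {H<..} = 1 - std_normal_cdf H"
      using prob_compl[of "{..H}"] by (simp add: std_normal_cdf_eq Compl_eq_Diff_UNIV[symmetric] not_le)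
    then show ?thesis
      using has_bochner_integral_real_indicator[of "{H<..}" std_normal]
      by (intro has_bochner_integral_mult_right) (auto simp: emeasure_eq_measure)
  qed
  ultimately have "has_bochner_integral std_normal (\<lambda>x. exp (u * x - u\<^sup>2 / 2) * indicator {..H} x + ?c * indicator {H<..} x)
     (std_normal_cdf (H - u) + ?c * (1 - std_normal_cdf H))"
    by (rule has_bochner_integral_add)
  moreover have "exp (u * x - u\<^sup>2 / 2) * indicator {..H} x + ?c * indicator {H<..} x = min (exp (u * x - u\<^sup>2 / 2)) ?c" for x
    using assms by (auto simp: indicator_def min_def)
  ultimately show ?thesis by (simp add: has_bochner_integral_iff)
qed

lemma prob_space_std_normal: "prob_space std_normal"
  by (simp add: prob_space_normal_density)

abbreviation noise :: "'i set \<Rightarrow> ('i \<Rightarrow> real) measure"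
  where "noise J \<equiv> \<Pi>\<^sub>M l\<in>J. std_normal"

lemma sets_noise: "sets (noise J) = sets (\<Pi>\<^sub>M l\<in>J. borel)"
  by (intro sets_PiM_cong) auto

lemma measurable_noise_iff [simp]: "measurable (noise J) = measurable (\<Pi>\<^sub>M l\<in>J. borel)"
  by (intro ext measurable_cong_sets sets_noise refl)

lemma prob_space_noise: "prob_space (noise J)"
  by (intro prob_space_PiM prob_space_std_normal)

text \<open>Independence is equivalent to the joint law being the product of the marginals, and here
  the joint map is the identity, points of the product space being extensional. The criterion is for
  nonempty index sets.\<close>

lemma white_noise_coordinates:
  assumes "J \<noteq> {}"
  shows "white_noise (noise J) (\<lambda>l \<xi>. \<xi> l) J"
proof -
  interpret prob_space "noise J" by (rule prob_space_noise)
  interpret N: product_prob_space "\<lambda>_. std_normal" J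
    by (intro product_prob_spaceI prob_space_std_normal)
  have d: "distr (noise J) borel (\<lambda>\<xi>. \<xi> l) = std_normal" if "l \<in> J" for l
  proof -
    have "distr (noise J) borel (\<lambda>\<xi>. \<xi> l) = distr (noise J) std_normal (\<lambda>\<xi>. \<xi> l)"
      by (intro distr_cong) auto
    with N.PiM_component[OF that] show ?thesis by simp
  qed
  have "distr (noise J) (\<Pi>\<^sub>M l\<in>J. borel) (\<lambda>\<xi>. \<lambda>l\<in>J. \<xi> l) = distr (noise J) (noise J) (\<lambda>\<xi>. \<xi>)"
    by (intro distr_cong) (auto simp: sets_noise space_PiM PiE_def extensional_restrict)
  also have "\<dots> = noise J" by simp
  also have "\<dots> = (\<Pi>\<^sub>M l\<in>J. distr (noise J) borel (\<lambda>\<xi>. \<xi> l))"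
    by (intro PiM_cong) (simp_all add: d)
  finally have "indep_vars (\<lambda>_. borel) (\<lambda>l \<xi>. \<xi> l) J"
    by (subst indep_vars_iff_distr_eq_PiM'[OF assms]) auto
  with d show ?thesis by unfold_locales auto
qed

text \<open>Cameron-Martin for a shift of finitely many coordinates of an infinite product. Both
  sides are compared on cylinders, where the one-dimensional formula applies coordinate by
  coordinate and independence reassembles the density.\<close>

lemma noise_shift:
  fixes m :: "'i \<Rightarrow> real"
  assumes I: "finite I" "I \<subseteq> J" and "J \<noteq> {}"
  shows "distr (noise J) (\<Pi>\<^sub>M l\<in>J. borel) (\<lambda>\<xi>. \<lambda>l\<in>J. \<xi> l + (if l \<in> I then m l else 0))
    = density (noise J) (\<lambda>\<xi>. \<Prod>l\<in>I. ennreal (exp (m l * \<xi> l - (m l)\<^sup>2 / 2)))" (is "?P = ?Q")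
proof (rule measure_eqI_PiM_infinite)
  interpret white_noise "noise J" "\<lambda>l \<xi>. \<xi> l" J by (rule white_noise_coordinates[OF assms(3)])
  let ?S = "\<lambda>\<xi>. \<lambda>l\<in>J. \<xi> l + (if l \<in> I then m l else 0)"
  have S [measurable]: "?S \<in> measurable (\<Pi>\<^sub>M l\<in>J. borel) (\<Pi>\<^sub>M l\<in>J. borel)"
    by (intro measurable_restrict) auto
  show "sets ?P = sets (\<Pi>\<^sub>M l\<in>J. borel)" by simp
  show "sets ?Q = sets (\<Pi>\<^sub>M l\<in>J. borel)" by (simp add: sets_noise)
  show "finite_measure ?P"
    by (intro prob_space.finite_measure prob_space_distr) simp
  fix A :: "'i \<Rightarrow> real set" and K
  assume K: "finite K" "K \<subseteq> J" and A: "\<And>l. l \<in> K \<Longrightarrow> A l \<in> sets borel"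
  \<comment> \<open>The shift lives on \<open>I\<close> and the cylinder on \<open>K\<close>.
    Extending the shift by 0 and the sides of the cylinder by the whole line lets both be treated
    over \<open>I \<union> K\<close>.\<close>
  let ?m = "\<lambda>l. if l \<in> I then m l else 0"
  let ?E = "\<lambda>l. if l \<in> K then A l else UNIV"
  have E [measurable]: "?E l \<in> sets borel" for l using A by auto
  have "?P (prod_emb J (\<lambda>_. borel) K (Pi\<^sub>E K A)) = emeasure (noise J) (prod_emb J (\<lambda>_. std_normal) K (\<Pi>\<^sub>E l\<in>K. (\<lambda>x. x + ?m l) -` A l))"
  proof -
    have "prod_emb J (\<lambda>_. borel) K (Pi\<^sub>E K A) \<in> sets (\<Pi>\<^sub>M l\<in>J. borel)"
      using K A by (intro sets_PiM_I) auto
    then have "?P (prod_emb J (\<lambda>_. borel) K (Pi\<^sub>E K A))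
        = emeasure (noise J) (?S -` prod_emb J (\<lambda>_. borel) K (Pi\<^sub>E K A) \<inter> space (noise J))"
      by (intro emeasure_distr) (simp_all add: S)
    also have "?S -` prod_emb J (\<lambda>_. borel) K (Pi\<^sub>E K A) \<inter> space (noise J)
        = prod_emb J (\<lambda>_. std_normal) K (\<Pi>\<^sub>E l\<in>K. (\<lambda>x. x + ?m l) -` A l)"
    proof -
      define T where "T = ?S"
      have "T \<xi> \<in> J \<rightarrow>\<^sub>E UNIV" and "restrict (T \<xi>) K \<in> Pi\<^sub>E K A \<longleftrightarrow> restrict \<xi> K \<in> (\<Pi>\<^sub>E l\<in>K. (\<lambda>x. x + ?m l) -` A l)" for \<xi>
        unfolding restrict_PiE_iff T_def using K by (auto simp: subset_iff)
      then have "T -` prod_emb J (\<lambda>_. borel) K (Pi\<^sub>E K A) \<inter> space (noise J)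
        = prod_emb J (\<lambda>_. std_normal) K (\<Pi>\<^sub>E l\<in>K. (\<lambda>x. x + ?m l) -` A l)"
        unfolding prod_emb_def space_PiM by auto
      then show ?thesis unfolding T_def .
    qed
    finally show ?thesis .
  qed
  also have "\<dots> = (\<Prod>l\<in>K. emeasure std_normal ((\<lambda>x. x + ?m l) -` A l))"
    using K A by (intro emeasure_PiM_emb prob_space_std_normal) (auto intro!: vimage_shift_borel)
  also have "\<dots> = (\<Prod>l\<in>K. \<integral>\<^sup>+x. ennreal (exp (?m l * x - (?m l)\<^sup>2 / 2)) * indicator (A l) x \<partial>std_normal)"
  proof (intro prod.cong refl)
    fix l assume l: "l \<in> K"
    have "emeasure std_normal ((\<lambda>x. x + ?m l) -` A l) = emeasure (distr std_normal borel (\<lambda>x. x + ?m l)) (A l)"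
      using A[OF l] by (subst emeasure_distr) auto
    also have "\<dots> = (\<integral>\<^sup>+x. ennreal (exp (?m l * x - (?m l)\<^sup>2 / 2)) * indicator (A l) x \<partial>std_normal)"
      using A[OF l] unfolding gaussian_shift by (subst emeasure_density) auto
    finally show "emeasure std_normal ((\<lambda>x. x + ?m l) -` A l) = (\<integral>\<^sup>+x. ennreal (exp (?m l * x - (?m l)\<^sup>2 / 2)) * indicator (A l) x \<partial>std_normal)" .
  qed
  \<comment> \<open>The added factors, at shifted indices outside the cylinder, are total masses of
    translated normal laws, that is 1.\<close>
  also have "\<dots> = (\<Prod>l\<in>I \<union> K. \<integral>\<^sup>+x. ennreal (exp (?m l * x - (?m l)\<^sup>2 / 2)) * indicator (?E l) x \<partial>std_normal)"
  proof (rule prod.mono_neutral_cong_left)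
    show "\<forall>l\<in>I \<union> K - K. (\<integral>\<^sup>+x. ennreal (exp (?m l * x - (?m l)\<^sup>2 / 2)) * indicator (?E l) x \<partial>std_normal) = 1"
    proof
      fix l assume "l \<in> I \<union> K - K"
      have "prob_space (distr std_normal borel (\<lambda>x. x + ?m l))"
        by (intro prob_space.prob_space_distr prob_space_std_normal) auto
      from prob_space.emeasure_space_1[OF this]
      have "emeasure (density std_normal (\<lambda>x. ennreal (exp (?m l * x - (?m l)\<^sup>2 / 2)))) UNIV = 1"
        unfolding gaussian_shift by simp
      with \<open>l \<in> I \<union> K - K\<close> show "(\<integral>\<^sup>+x. ennreal (exp (?m l * x - (?m l)\<^sup>2 / 2)) * indicator (?E l) x \<partial>std_normal) = 1"
        by (subst (asm) emeasure_density) auto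
    qed
  qed (use I K in auto)
  also have "\<dots> = (\<Prod>l\<in>I \<union> K. \<integral>\<^sup>+\<xi>. ennreal (exp (?m l * \<xi> l - (?m l)\<^sup>2 / 2)) * indicator (?E l) (\<xi> l) \<partial>noise J)"
  proof (intro prod.cong refl)
    fix l assume "l \<in> I \<union> K"
    then have l: "l \<in> J" using I K by auto
    show "(\<integral>\<^sup>+x. ennreal (exp (?m l * x - (?m l)\<^sup>2 / 2)) * indicator (?E l) x \<partial>std_normal)
      = (\<integral>\<^sup>+\<xi>. ennreal (exp (?m l * \<xi> l - (?m l)\<^sup>2 / 2)) * indicator (?E l) (\<xi> l) \<partial>noise J)"
      using E[of l] by (subst distr_X[OF l, symmetric], subst nn_integral_distr) (auto simp: l)
  qed
  also have "\<dots> = (\<integral>\<^sup>+\<xi>. (\<Prod>l\<in>I \<union> K. ennreal (exp (?m l * \<xi> l - (?m l)\<^sup>2 / 2)) * indicator (?E l) (\<xi> l)) \<partial>noise J)"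
  proof (rule indep_vars_nn_integral[symmetric])
    show "finite (I \<union> K)" using I K by auto
    have "indep_vars (\<lambda>_. borel) (\<lambda>l \<xi>. \<xi> l) (I \<union> K)"
      using I K by (intro indep_vars_subset[OF indep]) auto
    then show "indep_vars (\<lambda>_. borel) (\<lambda>l \<xi>. ennreal (exp (?m l * \<xi> l - (?m l)\<^sup>2 / 2)) * indicator (?E l) (\<xi> l)) (I \<union> K)"
      by (rule indep_vars_compose2) (use E in measurable)
  qed auto
  also have "\<dots> = (\<integral>\<^sup>+\<xi>. (\<Prod>l\<in>I. ennreal (exp (m l * \<xi> l - (m l)\<^sup>2 / 2))) * indicator (prod_emb J (\<lambda>_. borel) K (Pi\<^sub>E K A)) \<xi> \<partial>noise J)"
  proof (intro nn_integral_cong)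
    fix \<xi> assume \<xi>: "\<xi> \<in> space (noise J)"
    have "(\<Prod>l\<in>I \<union> K. ennreal (exp (?m l * \<xi> l - (?m l)\<^sup>2 / 2))) = (\<Prod>l\<in>I. ennreal (exp (m l * \<xi> l - (m l)\<^sup>2 / 2)))"
      using I K by (intro prod.mono_neutral_cong_right) auto
    moreover have "(\<Prod>l\<in>I \<union> K. indicator (?E l) (\<xi> l) :: ennreal) = indicator (prod_emb J (\<lambda>_. borel) K (Pi\<^sub>E K A)) \<xi>"
    proof -
      have "(\<Prod>l\<in>I \<union> K. indicator (?E l) (\<xi> l) :: ennreal) = (\<Prod>l\<in>K. indicator (A l) (\<xi> l))"
        using I K by (intro prod.mono_neutral_cong_right) auto
      also have "\<dots> = indicator (prod_emb J (\<lambda>_. borel) K (Pi\<^sub>E K A)) \<xi>"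
        using K \<xi> by (auto simp: indicator_def prod_emb_def space_PiM PiE_iff prod_zero_iff)
      finally show ?thesis .
    qed
    ultimately show "(\<Prod>l\<in>I \<union> K. ennreal (exp (?m l * \<xi> l - (?m l)\<^sup>2 / 2)) * indicator (?E l) (\<xi> l))
      = (\<Prod>l\<in>I. ennreal (exp (m l * \<xi> l - (m l)\<^sup>2 / 2))) * indicator (prod_emb J (\<lambda>_. borel) K (Pi\<^sub>E K A)) \<xi>"
      by (simp add: prod.distrib)
  qed
  also have "\<dots> = ?Q (prod_emb J (\<lambda>_. borel) K (Pi\<^sub>E K A))"
  proof (rule emeasure_density[symmetric])
    show "(\<lambda>\<xi>. \<Prod>l\<in>I. ennreal (exp (m l * \<xi> l - (m l)\<^sup>2 / 2))) \<in> borel_measurable (noise J)"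
    proof (rule borel_measurable_prod_ennreal)
      fix l assume "l \<in> I"
      then have [measurable]: "(\<lambda>\<xi>. \<xi> l) \<in> borel_measurable (noise J)"
        using I by (intro random_variable_X) auto
      show "(\<lambda>\<xi>. ennreal (exp (m l * \<xi> l - (m l)\<^sup>2 / 2))) \<in> borel_measurable (noise J)"
        by measurable
    qed
    show "prod_emb J (\<lambda>_. borel) K (Pi\<^sub>E K A) \<in> sets (noise J)"
      unfolding sets_noise using K A by (intro sets_PiM_I) auto
  qed
  finally show "?P (prod_emb J (\<lambda>_. borel) K (Pi\<^sub>E K A)) = ?Q (prod_emb J (\<lambda>_. borel) K (Pi\<^sub>E K A))" .
qed

section \<open>Inequalities for the hyperbolic cosine and the truncated exponential\<close>

text \<open>Three integrations of derivative bounds: \<open>tanh\<close> has derivative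
  \<open>1 - tanh\<^sup>2\<close>, so it lies below the identity, hence above x - x^3/3, and it is
  the derivative of \<open>ln cosh\<close>. This bounds a sign-averaged likelihood from below by a
  Gaussian exponent with a quartic correction.\<close>

lemma cosh_ge_exp:
  fixes z :: real
  shows "exp (z\<^sup>2 / 2 - z ^ 4 / 12) \<le> cosh z"
proof -
  have tanh_le: "tanh x \<le> x" if "0 \<le> x" for x :: real
  proof -
    have "0 - tanh 0 \<le> x - tanh x"
      by (rule DERIV_nonneg_imp_nondecreasing[OF that, where f="\<lambda>x. x - tanh x"])
        (auto intro!: exI derivative_eq_intros)
    thus ?thesis by simp
  qed
  have tanh_ge: "x - x ^ 3 / 3 \<le> tanh x" if "0 \<le> x" for x :: real
  proof -
    have "tanh 0 - (0 - 0 ^ 3 / 3) \<le> tanh x - (x - x ^ 3 / 3)"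
    proof (rule DERIV_nonneg_imp_nondecreasing[OF that, where f="\<lambda>x. tanh x - (x - x ^ 3 / 3)"])
      fix y :: real assume y: "0 \<le> y"
      have "(tanh y)\<^sup>2 \<le> y\<^sup>2" using tanh_le[OF y] y by (intro power_mono) auto
      moreover have "((\<lambda>x. tanh x - (x - x ^ 3 / 3)) has_real_derivative (y\<^sup>2 - (tanh y)\<^sup>2)) (at y)"
        by (auto intro!: derivative_eq_intros)
      ultimately show "\<exists>D. ((\<lambda>x. tanh x - (x - x ^ 3 / 3)) has_real_derivative D) (at y) \<and> 0 \<le> D"
        by (auto intro!: exI[of _ "y\<^sup>2 - (tanh y)\<^sup>2"])
    qed
    thus ?thesis by simp
  qed
  have main: "x\<^sup>2 / 2 - x ^ 4 / 12 \<le> ln (cosh x)" if "0 \<le> x" for x :: real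
  proof -
    have "ln (cosh 0) - (0\<^sup>2 / 2 - 0 ^ 4 / 12) \<le> ln (cosh x) - (x\<^sup>2 / 2 - x ^ 4 / 12)"
    proof (rule DERIV_nonneg_imp_nondecreasing[OF that, where f="\<lambda>x. ln (cosh x) - (x\<^sup>2 / 2 - x ^ 4 / 12)"])
      fix y :: real assume y: "0 \<le> y"
      have "((\<lambda>x. ln (cosh x) - (x\<^sup>2 / 2 - x ^ 4 / 12)) has_real_derivative (tanh y - (y - y ^ 3 / 3))) (at y)"
        by (auto intro!: derivative_eq_intros simp: tanh_def cosh_real_pos)
      with tanh_ge[OF y] show "\<exists>D. ((\<lambda>x. ln (cosh x) - (x\<^sup>2 / 2 - x ^ 4 / 12)) has_real_derivative D) (at y) \<and> 0 \<le> D"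
        by (intro exI[of _ "tanh y - (y - y ^ 3 / 3)"]) auto
    qed
    thus ?thesis by simp
  qed
  have "\<bar>z\<bar>\<^sup>2 / 2 - \<bar>z\<bar> ^ 4 / 12 \<le> ln (cosh \<bar>z\<bar>)" by (rule main) simp
  then have "z\<^sup>2 / 2 - z ^ 4 / 12 \<le> ln (cosh z)" by simp
  then show ?thesis by (simp add: ln_ge_iff cosh_real_pos)
qed

text \<open>The slope of the exponential is at most \<open>c\<close> as long as its value is, and
  after truncation the function is constant.\<close>

lemma min_exp_lipschitz:
  fixes a b c :: real
  assumes "0 < c"
  shows "\<bar>min (exp a) c - min (exp b) c\<bar> \<le> c * \<bar>a - b\<bar>"
proof -
  have *: "min (exp b) c - min (exp a) c \<le> c * (b - a)" if "a \<le> b" for a b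
  proof (cases "exp a \<le> c")
    case False
    with that exp_le_cancel_iff[of a b] have "c \<le> exp b" by linarith
    with False that assms show ?thesis by (simp add: min_def)
  next
    case True
    \<comment> \<open>Moving \<open>b\<close> back to the truncation point leaves the truncated
      value unchanged and keeps the slope below \<open>c\<close>.\<close>
    define t where "t = min b (ln c)"
    have t: "min (exp b) c = exp t" "exp t \<le> c" "t \<le> b"
      using assms by (auto simp: t_def min_def ln_ge_iff) (smt (verit) exp_ln exp_le_cancel_iff)+
    have at: "a \<le> t" using that True assms by (simp add: t_def ln_ge_iff)
    have "exp t - exp a = exp t * (1 - exp (a - t))" by (simp add: algebra_simps flip: exp_add)
    also have "\<dots> \<le> exp t * (t - a)"
    proof (rule mult_left_mono)
      show "1 - exp (a - t) \<le> t - a" using exp_ge_add_one_self[of "a - t"] by linarith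
    qed simp
    also have "\<dots> \<le> c * (b - a)" using t at assms by (intro mult_mono) auto
    finally show ?thesis using t True by simp
  qed
  have mono: "min (exp a) c \<le> min (exp b) c" if "a \<le> b" for a b
    using that by (intro min.mono) auto
  show ?thesis using *[of a b] *[of b a] mono[of a b] mono[of b a] by (cases "a \<le> b") auto
qed

section \<open>Shifted statistics and likelihoods over independent Gaussian coordinates\<close>

context white_noise
begin

text \<open>Cross terms vanish by independence and centring. The four claims form one conjunction
  because the induction step needs integrability and mean of the partial sum along with its second
  moment.\<close>

lemma expectation_square_sum:
  fixes f :: "'i \<Rightarrow> real \<Rightarrow> real"
  assumes I: "finite I" "I \<subseteq> J"
    and f [measurable]: "\<And>i. i \<in> I \<Longrightarrow> f i \<in> borel_measurable borel"
    and f1: "\<And>i. i \<in> I \<Longrightarrow> integrable std_normal (f i)"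
    and f0: "\<And>i. i \<in> I \<Longrightarrow> integral\<^sup>L std_normal (f i) = 0"
    and f2: "\<And>i. i \<in> I \<Longrightarrow> integrable std_normal (\<lambda>x. (f i x)\<^sup>2)"
  shows "integrable M (\<lambda>\<omega>. \<Sum>i\<in>I. f i (X i \<omega>)) \<and> expectation (\<lambda>\<omega>. \<Sum>i\<in>I. f i (X i \<omega>)) = 0 \<and>
    integrable M (\<lambda>\<omega>. (\<Sum>i\<in>I. f i (X i \<omega>))\<^sup>2) \<and>
    expectation (\<lambda>\<omega>. (\<Sum>i\<in>I. f i (X i \<omega>))\<^sup>2) = (\<Sum>i\<in>I. integral\<^sup>L std_normal (\<lambda>x. (f i x)\<^sup>2))"
  using I f f1 f0 f2
proof (induction I rule: finite_induct)
  case empty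
  then show ?case by simp
next
  case (insert i I)
  let ?S = "\<lambda>\<omega>. \<Sum>i\<in>I. f i (X i \<omega>)" and ?Y = "\<lambda>\<omega>. f i (X i \<omega>)"
  have i: "i \<in> J" using insert by auto
  have [measurable]: "f i \<in> borel_measurable borel" using insert by auto
  have IH: "integrable M ?S" "expectation ?S = 0" "integrable M (\<lambda>\<omega>. (?S \<omega>)\<^sup>2)"
     "expectation (\<lambda>\<omega>. (?S \<omega>)\<^sup>2) = (\<Sum>i\<in>I. integral\<^sup>L std_normal (\<lambda>x. (f i x)\<^sup>2))"
    using insert by auto
  have Y: "integrable M ?Y" "expectation ?Y = 0" "integrable M (\<lambda>\<omega>. (?Y \<omega>)\<^sup>2)"
    "expectation (\<lambda>\<omega>. (?Y \<omega>)\<^sup>2) = integral\<^sup>L std_normal (\<lambda>x. (f i x)\<^sup>2)"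
    using insert integrable_X[OF i, of "f i"] expectation_X[OF i, of "f i"]
      integrable_X[OF i, of "\<lambda>x. (f i x)\<^sup>2"] expectation_X[OF i, of "\<lambda>x. (f i x)\<^sup>2"] by auto
  have "indep_vars (\<lambda>_. borel) X (insert i I)"
    using insert by (intro indep_vars_subset[OF indep]) auto
  then have "indep_vars (\<lambda>_. borel) (\<lambda>i \<omega>. f i (X i \<omega>)) (insert i I)"
    by (rule indep_vars_compose2) (use insert in auto)
  then have ind: "indep_var borel ?Y borel ?S"
    using insert by (intro indep_vars_sum) auto
  have P: "integrable M (\<lambda>\<omega>. ?Y \<omega> * ?S \<omega>)" "expectation (\<lambda>\<omega>. ?Y \<omega> * ?S \<omega>) = 0"
    using indep_var_integrable[OF ind Y(1) IH(1)] indep_var_lebesgue_integral[OF ind Y(1) IH(1)] Y(2) by auto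
  have sq: "(?Y \<omega> + ?S \<omega>)\<^sup>2 = (?Y \<omega>)\<^sup>2 + 2 * (?Y \<omega> * ?S \<omega>) + (?S \<omega>)\<^sup>2" for \<omega>
    by (simp add: power2_sum)
  show ?case using insert(1,2) Y IH P by (simp add: sq)
qed

text \<open>The indicator of a half-line is enclosed between two Lipschitz ramps of width
  \<open>e / 2\<close>. One half of \<open>e\<close> pays for the limit theorem on ramps, the other
  for the variation of the normal distribution function across a ramp.\<close>

lemma chi2_uniform_cdf:
  assumes "0 < e"
  obtains \<delta> where "0 < \<delta>"
    "\<And>I w x. finite I \<Longrightarrow> I \<subseteq> J \<Longrightarrow> (\<Sum>i\<in>I. (w i)\<^sup>2) = 1 / 2 \<Longrightarrow> (\<And>i. i \<in> I \<Longrightarrow> \<bar>w i\<bar> \<le> \<delta>) \<Longrightarrow>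
      \<bar>prob {\<omega> \<in> space M. chi2 I w \<omega> \<le> x} - std_normal_cdf x\<bar> \<le> e"
proof -
  define d where "d = e / 2"
  have d: "0 < d" using assms by (simp add: d_def)
  \<comment> \<open>The ramp is 1 up to \<open>a\<close>, 0 from \<open>a + d\<close> on, and linear
    in between.\<close>
  define r where "r a x = max 0 (min 1 ((a + d - x) / d))" for a x :: real
  have r_bound: "\<bar>r a x\<bar> \<le> 1" for a x by (auto simp: r_def)
  have r_lip: "\<bar>r a x - r a y\<bar> \<le> (1 / d) * \<bar>x - y\<bar>" for a x y
  proof -
    have "\<bar>r a x - r a y\<bar> \<le> \<bar>(a + d - x) / d - (a + d - y) / d\<bar>" unfolding r_def by linarith
    also have "\<dots> = (1 / d) * \<bar>x - y\<bar>" using d by (simp add: abs_divide flip: diff_divide_distrib)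
    finally show ?thesis .
  qed
  have r_le: "r a x \<le> indicator {..a + d} x" and r_ge: "indicator {..a} x \<le> r a x" for a x
    using d by (auto simp: r_def indicator_def divide_simps)
  have r_meas [measurable]: "r a \<in> borel_measurable borel" for a unfolding r_def by measurable
  interpret N: real_distribution std_normal by (rule real_distribution_std_normal)
  have r_int: "std_normal_cdf a \<le> integral\<^sup>L std_normal (r a)" "integral\<^sup>L std_normal (r a) \<le> std_normal_cdf (a + d)" for a
  proof -
    have int: "integrable std_normal (r a)"
      using r_bound by (intro N.integrable_const_bound[where B=1]) auto
    have ind: "integrable std_normal (indicator {..z} :: real \<Rightarrow> real)" "integral\<^sup>L std_normal (indicator {..z}) = std_normal_cdf z" for z
      by (auto simp: std_normal_cdf_eq N.emeasure_eq_measure)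
    show "std_normal_cdf a \<le> integral\<^sup>L std_normal (r a)"
      unfolding ind(2)[symmetric] by (intro integral_mono ind int r_ge)
    show "integral\<^sup>L std_normal (r a) \<le> std_normal_cdf (a + d)"
      unfolding ind(2)[symmetric] by (intro integral_mono ind int r_le)
  qed
  obtain \<delta> where \<delta>: "0 < \<delta>"
    "\<And>I w g. finite I \<Longrightarrow> I \<subseteq> J \<Longrightarrow> (\<Sum>i\<in>I. (w i)\<^sup>2) = 1 / 2 \<Longrightarrow> (\<And>i. i \<in> I \<Longrightarrow> \<bar>w i\<bar> \<le> \<delta>) \<Longrightarrow>
      (\<And>x. \<bar>g x\<bar> \<le> 1) \<Longrightarrow> (\<And>x y. \<bar>g x - g y\<bar> \<le> (1 / d) * \<bar>x - y\<bar>) \<Longrightarrow>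
      \<bar>expectation (\<lambda>\<omega>. g (chi2 I w \<omega>)) - integral\<^sup>L std_normal g\<bar> \<le> d"
    using chi2_uniform_clt[OF d] by metis
  show ?thesis
  proof (rule that[OF \<delta>(1)])
    fix I w x assume I: "finite I" "I \<subseteq> J" and w: "(\<Sum>i\<in>I. (w i)\<^sup>2) = 1 / 2" "\<And>i. i \<in> I \<Longrightarrow> \<bar>w i\<bar> \<le> \<delta>"
    note clt = \<delta>(2)[OF I w r_bound r_lip]
    have [measurable]: "chi2 I w \<in> borel_measurable M" by (rule chi2_measurable[OF I(2)])
    have int: "integrable M (\<lambda>\<omega>. r a (chi2 I w \<omega>))" for a
      using r_bound by (intro integrable_const_bound[where B=1]) auto
    have ind: "integrable M (\<lambda>\<omega>. indicator {..z} (chi2 I w \<omega>) :: real)"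
      "expectation (\<lambda>\<omega>. indicator {..z} (chi2 I w \<omega>)) = prob {\<omega> \<in> space M. chi2 I w \<omega> \<le> z}" for z
    proof -
      show "integrable M (\<lambda>\<omega>. indicator {..z} (chi2 I w \<omega>) :: real)"
        by (intro integrable_const_bound[where B=1]) (auto simp: indicator_def)
      have "expectation (\<lambda>\<omega>. indicator {..z} (chi2 I w \<omega>)) = expectation (indicator {\<omega> \<in> space M. chi2 I w \<omega> \<le> z})"
        by (intro Bochner_Integration.integral_cong) (auto simp: indicator_def)
      also have "\<dots> = prob ({\<omega> \<in> space M. chi2 I w \<omega> \<le> z} \<inter> space M)"
        by (rule Bochner_Integration.integral_indicator)
      also have "{\<omega> \<in> space M. chi2 I w \<omega> \<le> z} \<inter> space M = {\<omega> \<in> space M. chi2 I w \<omega> \<le> z}"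
        by auto
      finally show "expectation (\<lambda>\<omega>. indicator {..z} (chi2 I w \<omega>)) = prob {\<omega> \<in> space M. chi2 I w \<omega> \<le> z}" .
    qed
    have "prob {\<omega> \<in> space M. chi2 I w \<omega> \<le> x} \<le> expectation (\<lambda>\<omega>. r x (chi2 I w \<omega>))"
      unfolding ind(2)[symmetric] by (intro integral_mono ind int r_ge)
    moreover have "expectation (\<lambda>\<omega>. r (x - d) (chi2 I w \<omega>)) \<le> prob {\<omega> \<in> space M. chi2 I w \<omega> \<le> x}"
      unfolding ind(2)[symmetric] using r_le[of "x - d"] by (intro integral_mono ind int) simp
    moreover have "std_normal_cdf (x + d) \<le> std_normal_cdf x + d" "std_normal_cdf x \<le> std_normal_cdf (x - d) + d"
      using std_normal_cdf_lipschitz[of x "x + d"] std_normal_cdf_lipschitz[of "x - d" x] d by auto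
    ultimately show "\<bar>prob {\<omega> \<in> space M. chi2 I w \<omega> \<le> x} - std_normal_cdf x\<bar> \<le> e"
      using clt[of x] clt[of "x - d"] r_int[of x] r_int[of "x - d"] unfolding d_def by linarith
  qed
qed

text \<open>The shifted statistic splits into \<open>chi2\<close>, a linear noise term and the
  signal. The signal can exceed \<open>u\<close> by any amount and the variance of the linear term
  grows with it, but only linearly, at most \<open>4 * d\<close> times the signal. The excess over
  \<open>u\<close> also enlarges the deviation the linear term must make, and its square wins in
  Chebyshev's bound, which is thus uniform over all shifts.\<close>

lemma prob_shifted_chi2_le:
  assumes I: "finite I" "I \<subseteq> J" and w: "\<And>i. i \<in> I \<Longrightarrow> 0 \<le> w i" "\<And>i. i \<in> I \<Longrightarrow> w i \<le> d" "0 \<le> d"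
    and u: "0 \<le> u" "u \<le> (\<Sum>i\<in>I. w i * (m i)\<^sup>2)" and \<delta>: "0 < \<delta>"
  shows "prob {\<omega> \<in> space M. (\<Sum>i\<in>I. w i * ((X i \<omega> + m i)\<^sup>2 - 1)) \<le> c}
    \<le> prob {\<omega> \<in> space M. chi2 I w \<omega> \<le> c - u + \<delta>} + 4 * d * (u / \<delta>\<^sup>2 + 1 / \<delta>)"
proof -
  define h where "h = (\<Sum>i\<in>I. w i * (m i)\<^sup>2)"
  define S where "S \<omega> = (\<Sum>i\<in>I. 2 * w i * m i * X i \<omega>)" for \<omega>
  define g where "g = h - u"
  have g: "0 \<le> g" using u by (simp add: g_def h_def)
  have [measurable]: "X i \<in> borel_measurable M" if "i \<in> I" for i using that I by auto
  have [measurable]: "chi2 I w \<in> borel_measurable M" "S \<in> borel_measurable M"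
    unfolding S_def[abs_def] by (auto intro!: chi2_measurable I)
  have n: "integrable std_normal (\<lambda>x. x)" "integral\<^sup>L std_normal (\<lambda>x. x) = 0" "integrable std_normal (\<lambda>x. x\<^sup>2)"
    using integrable_std_normal_distribution_moment[of 1] integrable_std_normal_distribution_moment[of 2]
      integral_std_normal_distribution_moment_odd[of 1] by simp_all
  have S2: "integrable M (\<lambda>\<omega>. (S \<omega>)\<^sup>2)" "expectation (\<lambda>\<omega>. (S \<omega>)\<^sup>2) = (\<Sum>i\<in>I. (2 * w i * m i)\<^sup>2)"
  proof -
    have a: "integrable std_normal (\<lambda>x. a * x)" "integral\<^sup>L std_normal (\<lambda>x. a * x) = 0"
      "integrable std_normal (\<lambda>x. (a * x)\<^sup>2)" "integral\<^sup>L std_normal (\<lambda>x. (a * x)\<^sup>2) = a\<^sup>2" for a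
      using n std_normal_moments(1) unfolding power_mult_distrib by simp_all
    have "integrable M (\<lambda>\<omega>. (S \<omega>)\<^sup>2) \<and> expectation (\<lambda>\<omega>. (S \<omega>)\<^sup>2) = (\<Sum>i\<in>I. integral\<^sup>L std_normal (\<lambda>x. (2 * w i * m i * x)\<^sup>2))"
      unfolding S_def
      by (rule expectation_square_sum[OF I, of "\<lambda>i x. 2 * w i * m i * x", THEN conjunct2, THEN conjunct2]) (simp_all only: a, simp)
    then show "integrable M (\<lambda>\<omega>. (S \<omega>)\<^sup>2)" "expectation (\<lambda>\<omega>. (S \<omega>)\<^sup>2) = (\<Sum>i\<in>I. (2 * w i * m i)\<^sup>2)"
      by (simp_all only: a)
  qed
  have "(\<Sum>i\<in>I. (2 * w i * m i)\<^sup>2) \<le> (\<Sum>i\<in>I. 4 * d * (w i * (m i)\<^sup>2))"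
  proof (rule sum_mono)
    fix i assume "i \<in> I"
    then have "w i * (w i * (m i)\<^sup>2) \<le> d * (w i * (m i)\<^sup>2)" using w by (intro mult_right_mono) auto
    then show "(2 * w i * m i)\<^sup>2 \<le> 4 * d * (w i * (m i)\<^sup>2)" by (simp add: power2_eq_square algebra_simps)
  qed
  then have S2_le: "expectation (\<lambda>\<omega>. (S \<omega>)\<^sup>2) \<le> 4 * d * h"
    unfolding S2 h_def by (simp add: sum_distrib_left)
  have "{\<omega> \<in> space M. (\<Sum>i\<in>I. w i * ((X i \<omega> + m i)\<^sup>2 - 1)) \<le> c}
     \<subseteq> {\<omega> \<in> space M. chi2 I w \<omega> \<le> c - u + \<delta>} \<union> {\<omega> \<in> space M. (g + \<delta>)\<^sup>2 \<le> (S \<omega>)\<^sup>2}"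
  proof
    fix \<omega> assume "\<omega> \<in> {\<omega> \<in> space M. (\<Sum>i\<in>I. w i * ((X i \<omega> + m i)\<^sup>2 - 1)) \<le> c}"
    then have \<omega>: "\<omega> \<in> space M" and le: "(\<Sum>i\<in>I. w i * ((X i \<omega> + m i)\<^sup>2 - 1)) \<le> c" by auto
    have "(\<Sum>i\<in>I. w i * ((X i \<omega> + m i)\<^sup>2 - 1)) = chi2 I w \<omega> + S \<omega> + h"
      unfolding chi2_def S_def h_def sum.distrib[symmetric]
      by (intro sum.cong) (auto simp: power2_eq_square algebra_simps)
    with le have *: "chi2 I w \<omega> + S \<omega> + g + u \<le> c" by (simp add: g_def)
    show "\<omega> \<in> {\<omega> \<in> space M. chi2 I w \<omega> \<le> c - u + \<delta>} \<union> {\<omega> \<in> space M. (g + \<delta>)\<^sup>2 \<le> (S \<omega>)\<^sup>2}"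
    proof (cases "chi2 I w \<omega> \<le> c - u + \<delta>")
      case False
      then have "g + \<delta> \<le> - S \<omega>" using * by linarith
      then have "(g + \<delta>)\<^sup>2 \<le> (- S \<omega>)\<^sup>2" using g \<delta> by (intro power_mono) auto
      with \<omega> show ?thesis by simp
    qed (use \<omega> in auto)
  qed
  then have "prob {\<omega> \<in> space M. (\<Sum>i\<in>I. w i * ((X i \<omega> + m i)\<^sup>2 - 1)) \<le> c}
     \<le> prob ({\<omega> \<in> space M. chi2 I w \<omega> \<le> c - u + \<delta>} \<union> {\<omega> \<in> space M. (g + \<delta>)\<^sup>2 \<le> (S \<omega>)\<^sup>2})"
    by (intro finite_measure_mono) measurable
  also have "\<dots> \<le> prob {\<omega> \<in> space M. chi2 I w \<omega> \<le> c - u + \<delta>} + prob {\<omega> \<in> space M. (g + \<delta>)\<^sup>2 \<le> (S \<omega>)\<^sup>2}"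
    by (intro measure_Un_le) measurable
  also have "prob {\<omega> \<in> space M. (g + \<delta>)\<^sup>2 \<le> (S \<omega>)\<^sup>2} \<le> 4 * d * (u / \<delta>\<^sup>2 + 1 / \<delta>)"
  proof -
    have "prob {\<omega> \<in> space M. (g + \<delta>)\<^sup>2 \<le> (S \<omega>)\<^sup>2} \<le> expectation (\<lambda>\<omega>. (S \<omega>)\<^sup>2) / (g + \<delta>)\<^sup>2"
      using g \<delta> S2(1) by (intro integral_Markov_inequality_measure[where A="{}"]) auto
    also have "\<dots> \<le> 4 * d * h / (g + \<delta>)\<^sup>2" using S2_le by (intro divide_right_mono) auto
    \<comment> \<open>Splitting the signal into \<open>u\<close> and its excess \<open>g\<close>
      makes both fractions bounded in \<open>g\<close>.\<close>
    also have "\<dots> = 4 * d * (u / (g + \<delta>)\<^sup>2 + g / (g + \<delta>)\<^sup>2)" by (simp add: g_def add_divide_distrib[symmetric])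
    also have "\<dots> \<le> 4 * d * (u / \<delta>\<^sup>2 + 1 / \<delta>)"
    proof (intro mult_left_mono add_mono)
      show "u / (g + \<delta>)\<^sup>2 \<le> u / \<delta>\<^sup>2" using g \<delta> u by (intro divide_left_mono power_mono) auto
      have "g / (g + \<delta>)\<^sup>2 \<le> (g + \<delta>) / (g + \<delta>)\<^sup>2" using \<delta> by (intro divide_right_mono) auto
      also have "\<dots> = 1 / (g + \<delta>)" by (simp add: power2_eq_square)
      also have "\<dots> \<le> 1 / \<delta>" using g \<delta> by (intro divide_left_mono) auto
      finally show "g / (g + \<delta>)\<^sup>2 \<le> 1 / \<delta>" .
    qed (use w in auto)
    finally show ?thesis .
  qed
  finally show ?thesis by simp
qed

text \<open>In the exponent supplied by \<open>cosh_ge_exp\<close>, the quadratic part is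
  \<open>u\<close> times a normalised \<open>chi2\<close>. The mean 3 of the fourth power turns the
  quartic part into \<open>- u\<^sup>2 / 2\<close> minus a centred remainder \<open>R\<close>. The
  truncated exponential is Lipschitz with constant \<open>c\<close>, so \<open>R\<close> costs at
  most \<open>c\<close> times its first absolute moment.\<close>

lemma expectation_likelihood_ge:
  fixes v :: "'i \<Rightarrow> real"
  assumes I: "finite I" "I \<subseteq> J" and u: "0 < u" "u\<^sup>2 = (\<Sum>i\<in>I. v i ^ 4) / 2"
    and d: "\<And>i. i \<in> I \<Longrightarrow> (v i)\<^sup>2 \<le> d" "0 < d" and c: "0 < c"
  shows "expectation (\<lambda>\<omega>. min (exp (u * chi2 I (\<lambda>i. (v i)\<^sup>2 / (2 * u)) \<omega> - u\<^sup>2 / 2)) c) - c * (2 * d * u)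
    \<le> expectation (\<lambda>\<omega>. min (\<Prod>i\<in>I. exp (- (v i)\<^sup>2 / 2) * cosh (v i * X i \<omega>)) c)"
proof -
  let ?w = "\<lambda>i. (v i)\<^sup>2 / (2 * u)"
  define L where "L \<omega> = (\<Prod>i\<in>I. exp (- (v i)\<^sup>2 / 2) * cosh (v i * X i \<omega>))" for \<omega>
  define R where "R \<omega> = (\<Sum>i\<in>I. v i ^ 4 / 12 * (X i \<omega> ^ 4 - 3))" for \<omega>
  have [measurable]: "X i \<in> borel_measurable M" if "i \<in> I" for i using that I by auto
  have [measurable]: "cosh \<in> borel_measurable (borel :: real measure)"
    by (intro borel_measurable_continuous_onI continuous_intros)
  have [measurable]: "chi2 I ?w \<in> borel_measurable M" "R \<in> borel_measurable M" "L \<in> borel_measurable M"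
    unfolding R_def[abs_def] L_def[abs_def] by (auto intro!: chi2_measurable I)
  have n: "integrable std_normal (\<lambda>x. x ^ k)" for k by (rule integrable_std_normal_distribution_moment)
  have N1: "integral\<^sup>L std_normal (\<lambda>x. 1) = (1::real)" by (rule std_normal_moment_0)
  interpret N: real_distribution std_normal by (rule real_distribution_std_normal)
  have sq: "(x ^ 4 - 3)\<^sup>2 = x ^ 8 - 6 * x ^ 4 + 9" for x :: real
    by (simp add: power2_eq_square algebra_simps flip: power_add)
  have i1: "integrable std_normal (\<lambda>x. x ^ 4 - 3)" "integral\<^sup>L std_normal (\<lambda>x. x ^ 4 - 3) = 0"
    using n[of 4] N1 std_normal_moments by simp_all
  \<comment> \<open>The variance of the fourth power of a standard normal variable is 105 - 9 =
    96.\<close>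
  have i2: "integrable std_normal (\<lambda>x. (x ^ 4 - 3)\<^sup>2)" "integral\<^sup>L std_normal (\<lambda>x. (x ^ 4 - 3)\<^sup>2) = 96"
    unfolding sq using n[of 4] n[of 8] N1 std_normal_moments by simp_all
  have R2: "integrable M (\<lambda>\<omega>. (R \<omega>)\<^sup>2)" "expectation (\<lambda>\<omega>. (R \<omega>)\<^sup>2) = (\<Sum>i\<in>I. (v i ^ 4 / 12)\<^sup>2 * 96)"
      "integrable M R"
  proof -
    have a: "integrable std_normal (\<lambda>x. a * (x ^ 4 - 3))" "integral\<^sup>L std_normal (\<lambda>x. a * (x ^ 4 - 3)) = 0"
      "integrable std_normal (\<lambda>x. (a * (x ^ 4 - 3))\<^sup>2)" "integral\<^sup>L std_normal (\<lambda>x. (a * (x ^ 4 - 3))\<^sup>2) = a\<^sup>2 * 96" for a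
      unfolding power_mult_distrib by (simp_all only: integrable_mult_right i1 i2 integral_mult_right_zero mult_zero_right)
    have "integrable M R \<and> expectation R = 0 \<and> integrable M (\<lambda>\<omega>. (R \<omega>)\<^sup>2) \<and>
       expectation (\<lambda>\<omega>. (R \<omega>)\<^sup>2) = (\<Sum>i\<in>I. integral\<^sup>L std_normal (\<lambda>x. (v i ^ 4 / 12 * (x ^ 4 - 3))\<^sup>2))"
      unfolding R_def
      by (rule expectation_square_sum[OF I, of "\<lambda>i x. v i ^ 4 / 12 * (x ^ 4 - 3)"]) (simp_all only: a, simp)
    then show "integrable M (\<lambda>\<omega>. (R \<omega>)\<^sup>2)" "expectation (\<lambda>\<omega>. (R \<omega>)\<^sup>2) = (\<Sum>i\<in>I. (v i ^ 4 / 12)\<^sup>2 * 96)" "integrable M R"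
      by (simp_all only: a)
  qed
  have "(\<Sum>i\<in>I. (v i ^ 4 / 12)\<^sup>2 * 96) \<le> (\<Sum>i\<in>I. d\<^sup>2 * v i ^ 4)"
  proof (rule sum_mono)
    fix i assume i: "i \<in> I"
    have "v i ^ 4 * v i ^ 4 \<le> d\<^sup>2 * v i ^ 4"
    proof (rule mult_right_mono)
      have "((v i)\<^sup>2)\<^sup>2 \<le> d\<^sup>2" using d(1)[OF i] by (intro power_mono) auto
      then show "v i ^ 4 \<le> d\<^sup>2" by simp
    qed simp
    moreover have "0 \<le> v i ^ 4 * v i ^ 4" by simp
    moreover have "(v i ^ 4 / 12)\<^sup>2 * 96 = 2 / 3 * (v i ^ 4 * v i ^ 4)" by (simp add: power2_eq_square)
    ultimately show "(v i ^ 4 / 12)\<^sup>2 * 96 \<le> d\<^sup>2 * v i ^ 4" by linarith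
  qed
  also have "\<dots> = 2 * (d * u)\<^sup>2" using u(2) by (simp add: power_mult_distrib flip: sum_distrib_left)
  finally have R2_le: "expectation (\<lambda>\<omega>. (R \<omega>)\<^sup>2) \<le> 2 * (d * u)\<^sup>2" unfolding R2 .
  have absR: "expectation (\<lambda>\<omega>. \<bar>R \<omega>\<bar>) \<le> 2 * d * u"
  proof -
    \<comment> \<open>The scale \<open>a\<close> balances the two terms of |R| \<le>
      \<open>R\<^sup>2 / (2 * a) + a / 2\<close>, because the second moment of \<open>R\<close> is
      at most \<open>2 * a\<^sup>2\<close>.\<close>
    define a where "a = d * u"
    have a: "0 < a" using d u by (simp add: a_def)
    have "expectation (\<lambda>\<omega>. \<bar>R \<omega>\<bar>) \<le> expectation (\<lambda>\<omega>. (R \<omega>)\<^sup>2 / (2 * a) + a / 2)"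
    proof (rule integral_mono)
      fix \<omega>
      have "0 \<le> (\<bar>R \<omega>\<bar> - a)\<^sup>2" by simp
      then have "2 * a * \<bar>R \<omega>\<bar> \<le> (R \<omega>)\<^sup>2 + a\<^sup>2" by (simp add: power2_diff mult_ac)
      then have "\<bar>R \<omega>\<bar> \<le> ((R \<omega>)\<^sup>2 + a\<^sup>2) / (2 * a)" using a by (simp add: field_simps)
      also have "\<dots> = (R \<omega>)\<^sup>2 / (2 * a) + a / 2" using a by (simp add: field_simps power2_eq_square)
      finally show "\<bar>R \<omega>\<bar> \<le> (R \<omega>)\<^sup>2 / (2 * a) + a / 2" .
    qed (use R2 in auto)
    also have "\<dots> = expectation (\<lambda>\<omega>. (R \<omega>)\<^sup>2) / (2 * a) + a / 2" using R2 by (simp add: prob_space)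
    also have "\<dots> \<le> 2 * a\<^sup>2 / (2 * a) + a / 2" using R2_le a by (intro add_mono divide_right_mono) (auto simp: a_def)
    also have "\<dots> \<le> 2 * a" using a by (simp add: power2_eq_square)
    finally show ?thesis by (simp add: a_def mult.assoc)
  qed
  have pt: "min (exp (u * chi2 I ?w \<omega> - u\<^sup>2 / 2)) c - c * \<bar>R \<omega>\<bar> \<le> min (L \<omega>) c" for \<omega>
  proof -
    have "exp (u * chi2 I ?w \<omega> - u\<^sup>2 / 2 - R \<omega>) = exp (\<Sum>i\<in>I. - (v i)\<^sup>2 / 2 + ((v i * X i \<omega>)\<^sup>2 / 2 - (v i * X i \<omega>) ^ 4 / 12))"
    proof -
      have "u * chi2 I ?w \<omega> = (\<Sum>i\<in>I. (v i)\<^sup>2 / 2 * ((X i \<omega>)\<^sup>2 - 1))"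
        unfolding chi2_def sum_distrib_left using u by (intro sum.cong) auto
      moreover have "u\<^sup>2 / 2 = (\<Sum>i\<in>I. v i ^ 4 / 4)" unfolding u by (simp add: sum_divide_distrib)
      ultimately have "u * chi2 I ?w \<omega> - u\<^sup>2 / 2 - R \<omega> = (\<Sum>i\<in>I. (v i)\<^sup>2 / 2 * ((X i \<omega>)\<^sup>2 - 1) - v i ^ 4 / 4 - v i ^ 4 / 12 * (X i \<omega> ^ 4 - 3))"
        unfolding R_def by (simp add: sum_subtractf)
      also have "\<dots> = (\<Sum>i\<in>I. - (v i)\<^sup>2 / 2 + ((v i * X i \<omega>)\<^sup>2 / 2 - (v i * X i \<omega>) ^ 4 / 12))"
        by (intro sum.cong) (auto simp: field_simps power_mult_distrib)
      finally show ?thesis by simp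
    qed
    also have "\<dots> = (\<Prod>i\<in>I. exp (- (v i)\<^sup>2 / 2) * exp ((v i * X i \<omega>)\<^sup>2 / 2 - (v i * X i \<omega>) ^ 4 / 12))"
      by (simp add: exp_sum I(1) exp_add[symmetric])
    also have "\<dots> \<le> L \<omega>"
      unfolding L_def by (intro prod_mono conjI mult_left_mono cosh_ge_exp) auto
    finally have "min (exp (u * chi2 I ?w \<omega> - u\<^sup>2 / 2 - R \<omega>)) c \<le> min (L \<omega>) c" by (intro min.mono) auto
    moreover have "\<bar>min (exp (u * chi2 I ?w \<omega> - u\<^sup>2 / 2)) c - min (exp (u * chi2 I ?w \<omega> - u\<^sup>2 / 2 - R \<omega>)) c\<bar> \<le> c * \<bar>R \<omega>\<bar>"
      using min_exp_lipschitz[OF c, of "u * chi2 I ?w \<omega> - u\<^sup>2 / 2" "u * chi2 I ?w \<omega> - u\<^sup>2 / 2 - R \<omega>"] by simp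
    ultimately show ?thesis by linarith
  qed
  have L0: "0 \<le> L \<omega>" for \<omega> unfolding L_def by (intro prod_nonneg) auto
  have int: "integrable M (\<lambda>\<omega>. min (exp (u * chi2 I ?w \<omega> - u\<^sup>2 / 2)) c)" "integrable M (\<lambda>\<omega>. min (L \<omega>) c)"
    using c L0 by (auto intro!: integrable_const_bound[where B=c])
  have "expectation (\<lambda>\<omega>. min (exp (u * chi2 I ?w \<omega> - u\<^sup>2 / 2)) c - c * \<bar>R \<omega>\<bar>) \<le> expectation (\<lambda>\<omega>. min (L \<omega>) c)"
    using int R2 by (intro integral_mono pt) auto
  then have "expectation (\<lambda>\<omega>. min (exp (u * chi2 I ?w \<omega> - u\<^sup>2 / 2)) c) - c * expectation (\<lambda>\<omega>. \<bar>R \<omega>\<bar>) \<le> expectation (\<lambda>\<omega>. min (L \<omega>) c)"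
    using int R2 by simp
  moreover have "c * expectation (\<lambda>\<omega>. \<bar>R \<omega>\<bar>) \<le> c * (2 * d * u)" using absR c by (intro mult_left_mono) auto
  ultimately show ?thesis unfolding L_def by linarith
qed

end

section \<open>Bounds on the minimax type II error\<close>

lemma idx_nonempty: "idx \<noteq> {}"
proof -
  have "(\<chi> j. 1) \<in> idx" by (simp add: idx_def)
  thus ?thesis by blast
qed

lemma space_obs: "space obs_space = (idx \<rightarrow>\<^sub>E UNIV)"
  by (simp add: obs_space_def space_PiM)

lemma observation_measurable [measurable]:
  "(\<lambda>\<xi>. \<lambda>l\<in>idx. m l + \<epsilon> * \<xi> l) \<in> measurable (noise idx) obs_space"
  unfolding obs_space_def measurable_noise_iff
  by (intro measurable_restrict borel_measurable_add borel_measurable_times borel_measurable_const)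
    (auto intro: measurable_component_singleton)

lemma prob_space_obs_law: "prob_space (obs_law b \<epsilon> \<theta>)"
  unfolding obs_law_def
  by (intro prob_space.prob_space_distr prob_space_noise observation_measurable)

lemma test_values: "\<psi> \<in> tests \<Longrightarrow> y \<in> space obs_space \<Longrightarrow> \<psi> y = 0 \<or> \<psi> y = 1"
  unfolding tests_def by (auto dest: measurable_space)

lemma test_sets:
  assumes "\<psi> \<in> tests"
  shows "{y \<in> space obs_space. \<psi> y = k} \<in> sets obs_space"
proof -
  have "\<psi> -` ({k} \<inter> {0, 1}) \<inter> space obs_space \<in> sets obs_space"
    using assms unfolding tests_def by (rule measurable_sets) auto
  also have "\<psi> -` ({k} \<inter> {0, 1}) \<inter> space obs_space = {y \<in> space obs_space. \<psi> y = k}"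
    using test_values[OF assms] by auto
  finally show ?thesis .
qed

lemma obs_law_test:
  assumes "\<psi> \<in> tests"
  shows "emeasure (obs_law b \<epsilon> \<theta>) {y \<in> space obs_space. \<psi> y = k} =
    emeasure (noise idx) {\<xi> \<in> space (noise idx). \<psi> (\<lambda>l\<in>idx. b l * \<theta> l + \<epsilon> * \<xi> l) = k}"
proof -
  have "(\<lambda>\<xi>. \<lambda>l\<in>idx. b l * \<theta> l + \<epsilon> * \<xi> l) -` {y \<in> space obs_space. \<psi> y = k} \<inter> space (noise idx)
     = {\<xi> \<in> space (noise idx). \<psi> (\<lambda>l\<in>idx. b l * \<theta> l + \<epsilon> * \<xi> l) = k}"
    by (auto simp: space_obs)
  then show ?thesis unfolding obs_law_def
    by (subst emeasure_distr[OF observation_measurable test_sets[OF assms]]) simp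
qed

lemma type_II_error_nonneg: "0 \<le> type_II_error b \<epsilon> \<Theta> \<psi>"
  by (simp add: type_II_error_def)

lemma minimax_le:
  assumes "\<psi> \<in> tests_of_level b \<epsilon> q"
  shows "minimax_type_II_error b \<epsilon> \<Theta> q \<le> type_II_error b \<epsilon> \<Theta> \<psi>"
  unfolding minimax_type_II_error_def using assms
  by (intro cINF_lower bdd_belowI2[where m=0] type_II_error_nonneg)

text \<open>The test that always accepts has type I error 0, so for nonnegative \<open>q\<close> the
  infimum runs over a nonempty set and a common lower bound passes to it.\<close>

lemma minimax_ge:
  assumes "0 \<le> q" "\<And>\<psi>. \<psi> \<in> tests_of_level b \<epsilon> q \<Longrightarrow> x \<le> type_II_error b \<epsilon> \<Theta> \<psi>"
  shows "x \<le> minimax_type_II_error b \<epsilon> \<Theta> q"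
proof -
  have "(\<lambda>_. 0) \<in> tests_of_level b \<epsilon> q" using assms(1) by (auto simp: tests_of_level_def tests_def)
  then show ?thesis
    unfolding minimax_type_II_error_def by (intro cINF_greatest assms(2)) auto
qed

lemma SUP_obs_law_le_1: "(SUP \<theta>\<in>\<Theta>. emeasure (obs_law b \<epsilon> \<theta>) A) \<le> 1"
  by (intro SUP_least prob_space.emeasure_le_1 prob_space_obs_law)

lemma type_II_error_mono:
  assumes "\<Theta> \<subseteq> \<Theta>'"
  shows "type_II_error b \<epsilon> \<Theta> \<psi> \<le> type_II_error b \<epsilon> \<Theta>' \<psi>"
  unfolding type_II_error_def
proof (rule enn2real_mono)
  show "(SUP \<theta>\<in>\<Theta>. emeasure (obs_law b \<epsilon> \<theta>) {y \<in> space obs_space. \<psi> y = 0})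
    \<le> (SUP \<theta>\<in>\<Theta>'. emeasure (obs_law b \<epsilon> \<theta>) {y \<in> space obs_space. \<psi> y = 0})"
    using assms by (intro SUP_subset_mono) auto
  show "(SUP \<theta>\<in>\<Theta>'. emeasure (obs_law b \<epsilon> \<theta>) {y \<in> space obs_space. \<psi> y = 0}) < \<top>"
    using SUP_obs_law_le_1 by (rule le_less_trans) simp
qed

lemma minimax_mono:
  assumes "0 \<le> q" "\<Theta> \<subseteq> \<Theta>'"
  shows "minimax_type_II_error b \<epsilon> \<Theta> q \<le> minimax_type_II_error b \<epsilon> \<Theta>' q"
  using assms by (intro minimax_ge order.trans[OF minimax_le type_II_error_mono]) auto

lemma minimax_nonneg: "0 \<le> q \<Longrightarrow> 0 \<le> minimax_type_II_error b \<epsilon> \<Theta> q"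
  by (intro minimax_ge type_II_error_nonneg)

text \<open>Averaging over independent signs turns the likelihood ratios into a product of hyperbolic
  cosines, so the type II error dominates the Bayes risk of that prior.\<close>

lemma type_II_error_sign_prior:
  fixes b \<theta> :: "nat ^ 'd \<Rightarrow> real"
  assumes I: "finite I" "I \<subseteq> idx" and \<epsilon>: "0 < \<epsilon>" and \<psi>: "\<psi> \<in> tests" and c: "0 \<le> c"
    and \<Theta>: "\<And>\<sigma>. (\<And>l. l \<in> I \<Longrightarrow> \<sigma> l \<in> {-1, 1}) \<Longrightarrow> (\<lambda>l. if l \<in> I then \<sigma> l * \<theta> l else 0) \<in> \<Theta>"
  defines "v \<equiv> \<lambda>l. b l * \<theta> l / \<epsilon>"
  shows "(\<integral>\<xi>. min (\<Prod>l\<in>I. exp (- (v l)\<^sup>2 / 2) * cosh (v l * \<xi> l)) c \<partial>noise idx)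
    \<le> type_II_error b \<epsilon> \<Theta> \<psi> + c * measure (obs_law b \<epsilon> (\<lambda>_. 0)) {y \<in> space obs_space. \<psi> y = 1}"
proof -
  interpret white_noise "noise idx" "\<lambda>l \<xi>. \<xi> l" "idx :: (nat ^ 'd) set"
    by (rule white_noise_coordinates[OF idx_nonempty])
  \<comment> \<open>The test is pulled back to the noise space: under the null hypothesis the data
    are the scaled noise, and a signal becomes a shift of the noise by \<open>v\<close> before
    scaling.\<close>
  let ?scale = "\<lambda>\<xi>. \<lambda>l\<in>idx. \<epsilon> * \<xi> l"
  define A where "A k = {\<xi> \<in> space (noise idx). \<psi> (?scale \<xi>) = k}" for k
  define L where "L \<xi> = (\<Prod>l\<in>I. exp (- (v l)\<^sup>2 / 2) * cosh (v l * \<xi> l))" for \<xi>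
  define S where "S = (SUP \<theta>\<in>\<Theta>. emeasure (obs_law b \<epsilon> \<theta>) {y \<in> space obs_space. \<psi> y = 0})"
  have scale [measurable]: "?scale \<in> measurable (noise idx) obs_space"
    using observation_measurable[of "\<lambda>_. 0" \<epsilon>] by simp
  have A_sets [measurable]: "A k \<in> sets (noise idx)" for k
  proof -
    have "A k = ?scale -` {y \<in> space obs_space. \<psi> y = k} \<inter> space (noise idx)"
      by (auto simp: A_def space_obs)
    then show ?thesis using measurable_sets[OF scale test_sets[OF \<psi>]] by simp
  qed
  have X [measurable]: "(\<lambda>\<xi>. \<xi> l) \<in> borel_measurable (noise idx)" if "l \<in> I" for l
    using I that by (intro random_variable_X) auto
  have [measurable]: "cosh \<in> borel_measurable (borel :: real measure)"
    by (intro borel_measurable_continuous_onI continuous_intros)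
  have L_meas [measurable]: "L \<in> borel_measurable (noise idx)"
    unfolding L_def[abs_def] by measurable
  have L0: "0 \<le> L \<xi>" for \<xi> unfolding L_def by (intro prod_nonneg) auto
  have S: "S = ennreal (type_II_error b \<epsilon> \<Theta> \<psi>)"
  proof -
    have "S < \<top>" unfolding S_def using SUP_obs_law_le_1 by (rule le_less_trans) simp
    then show ?thesis unfolding S_def type_II_error_def by (rule ennreal_enn2real[symmetric])
  qed
  have single: "(\<integral>\<^sup>+\<xi>. (\<Prod>l\<in>I. ennreal (exp (\<sigma> l * v l * \<xi> l - (v l)\<^sup>2 / 2))) * indicator (A 0) \<xi> \<partial>noise idx) \<le> S"
    if \<sigma>: "\<And>l. l \<in> I \<Longrightarrow> \<sigma> l \<in> {-1, 1}" for \<sigma>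
  proof -
    let ?\<theta> = "\<lambda>l. if l \<in> I then \<sigma> l * \<theta> l else 0"
    let ?shift = "\<lambda>\<xi>. \<lambda>l\<in>idx. \<xi> l + (if l \<in> I then \<sigma> l * v l else 0)"
    have shift: "?shift \<in> measurable (noise idx) (\<Pi>\<^sub>M l\<in>idx. borel)"
      unfolding measurable_noise_iff
      by (intro measurable_restrict borel_measurable_add borel_measurable_const)
        (auto intro: measurable_component_singleton)
    \<comment> \<open>Squaring removes the sign, so only the linear part of the exponent depends on
      it.\<close>
    have sq: "(\<sigma> l * v l)\<^sup>2 = (v l)\<^sup>2" if "l \<in> I" for l using \<sigma>[OF that] by auto
    have "(\<integral>\<^sup>+\<xi>. (\<Prod>l\<in>I. ennreal (exp (\<sigma> l * v l * \<xi> l - (v l)\<^sup>2 / 2))) * indicator (A 0) \<xi> \<partial>noise idx)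
      = (\<integral>\<^sup>+\<xi>. (\<Prod>l\<in>I. ennreal (exp (\<sigma> l * v l * \<xi> l - (\<sigma> l * v l)\<^sup>2 / 2))) * indicator (A 0) \<xi> \<partial>noise idx)"
      by (simp add: sq cong: prod.cong)
    also have "\<dots> = emeasure (density (noise idx) (\<lambda>\<xi>. \<Prod>l\<in>I. ennreal (exp (\<sigma> l * v l * \<xi> l - (\<sigma> l * v l)\<^sup>2 / 2)))) (A 0)"
      by (subst emeasure_density) (auto intro!: borel_measurable_prod_ennreal)
    also have "\<dots> = emeasure (distr (noise idx) (\<Pi>\<^sub>M l\<in>idx. borel) ?shift) (A 0)"
      by (subst noise_shift[OF I idx_nonempty]) (rule refl)
    also have "\<dots> = emeasure (noise idx) (?shift -` A 0 \<inter> space (noise idx))"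
      using A_sets[of 0] unfolding sets_noise by (intro emeasure_distr[OF shift])
    also have "?shift -` A 0 \<inter> space (noise idx) = {\<xi> \<in> space (noise idx). \<psi> (\<lambda>l\<in>idx. b l * ?\<theta> l + \<epsilon> * \<xi> l) = 0}"
    proof -
      have "?scale (?shift \<xi>) = (\<lambda>l\<in>idx. b l * ?\<theta> l + \<epsilon> * \<xi> l)" for \<xi>
        using \<epsilon> by (auto simp: v_def fun_eq_iff algebra_simps)
      moreover have "?shift \<xi> \<in> space (noise idx)" for \<xi> by (simp add: space_PiM)
      ultimately show ?thesis unfolding A_def vimage_def by (simp only: mem_Collect_eq) blast
    qed
    also have "emeasure (noise idx) \<dots> = emeasure (obs_law b \<epsilon> ?\<theta>) {y \<in> space obs_space. \<psi> y = 0}"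
      by (rule obs_law_test[OF \<psi>, symmetric])
    also have "\<dots> \<le> S"
      unfolding S_def by (intro SUP_upper \<Theta> \<sigma>)
    finally show ?thesis .
  qed
  let ?\<Sigma> = "I \<rightarrow>\<^sub>E {-1, 1 :: real}"
  have card: "card ?\<Sigma> = 2 ^ card I" using I by (simp add: card_PiE numeral_2_eq_2)
  \<comment> \<open>Summing one factor over its two signs gives twice a hyperbolic cosine.
    Exchanging product and sum then evaluates the sum over all sign patterns at once.\<close>
  have cosh_sum: "(\<Sum>s\<in>{-1, 1 :: real}. exp (s * a * x - a\<^sup>2 / 2)) = 2 * (exp (- a\<^sup>2 / 2) * cosh (a * x))" for a x :: real
    by (simp add: cosh_def algebra_simps flip: exp_add)
  have sum: "(\<Sum>\<sigma>\<in>?\<Sigma>. \<Prod>l\<in>I. ennreal (exp (\<sigma> l * v l * \<xi> l - (v l)\<^sup>2 / 2))) = ennreal (2 ^ card I) * ennreal (L \<xi>)" for \<xi>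
  proof -
    have "(\<Sum>\<sigma>\<in>?\<Sigma>. \<Prod>l\<in>I. ennreal (exp (\<sigma> l * v l * \<xi> l - (v l)\<^sup>2 / 2)))
       = ennreal (\<Sum>\<sigma>\<in>?\<Sigma>. \<Prod>l\<in>I. exp (\<sigma> l * v l * \<xi> l - (v l)\<^sup>2 / 2))"
      by (simp add: prod_ennreal sum_ennreal prod_nonneg)
    also have "(\<Sum>\<sigma>\<in>?\<Sigma>. \<Prod>l\<in>I. exp (\<sigma> l * v l * \<xi> l - (v l)\<^sup>2 / 2))
       = (\<Prod>l\<in>I. \<Sum>s\<in>{-1, 1}. exp (s * v l * \<xi> l - (v l)\<^sup>2 / 2))"
      using I by (intro prod_sum_PiE[symmetric]) auto
    also have "\<dots> = 2 ^ card I * L \<xi>"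
      unfolding cosh_sum L_def prod.distrib by simp
    finally show ?thesis using L0[of \<xi>] by (simp add: ennreal_mult)
  qed
  have "ennreal (2 ^ card I) * (\<integral>\<^sup>+\<xi>. ennreal (L \<xi>) * indicator (A 0) \<xi> \<partial>noise idx)
     = (\<integral>\<^sup>+\<xi>. (\<Sum>\<sigma>\<in>?\<Sigma>. (\<Prod>l\<in>I. ennreal (exp (\<sigma> l * v l * \<xi> l - (v l)\<^sup>2 / 2))) * indicator (A 0) \<xi>) \<partial>noise idx)"
    by (subst nn_integral_cmult[symmetric]) (auto simp: sum[symmetric] mult.assoc[symmetric] sum_distrib_right[symmetric])
  also have "\<dots> = (\<Sum>\<sigma>\<in>?\<Sigma>. \<integral>\<^sup>+\<xi>. (\<Prod>l\<in>I. ennreal (exp (\<sigma> l * v l * \<xi> l - (v l)\<^sup>2 / 2))) * indicator (A 0) \<xi> \<partial>noise idx)"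
    by (intro nn_integral_sum borel_measurable_times_ennreal borel_measurable_prod_ennreal borel_measurable_indicator) auto
  also have "\<dots> \<le> (\<Sum>\<sigma>\<in>?\<Sigma>. S)"
    by (intro sum_mono single) (auto simp: PiE_iff)
  also have "\<dots> = ennreal (2 ^ card I) * S"
    by (simp add: card ennreal_of_nat_eq_real_of_nat)
  finally have avg: "(\<integral>\<^sup>+\<xi>. ennreal (L \<xi>) * indicator (A 0) \<xi> \<partial>noise idx) \<le> S"
    by (subst (asm) ennreal_mult_le_mult_iff) auto
  have A1: "emeasure (noise idx) (A 1) = ennreal (measure (obs_law b \<epsilon> (\<lambda>_. 0)) {y \<in> space obs_space. \<psi> y = 1})"
  proof -
    interpret O: prob_space "obs_law b \<epsilon> (\<lambda>_. 0)" by (rule prob_space_obs_law)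
    show ?thesis unfolding A_def O.emeasure_eq_measure[symmetric] by (subst obs_law_test[OF \<psi>]) simp
  qed
  have "ennreal (\<integral>\<xi>. min (L \<xi>) c \<partial>noise idx) = (\<integral>\<^sup>+\<xi>. ennreal (min (L \<xi>) c) \<partial>noise idx)"
    using L0 c by (intro nn_integral_eq_integral[symmetric] integrable_const_bound[where B=c]) auto
  \<comment> \<open>Every point is accepted or rejected. On acceptance the minimum is replaced by
    \<open>L\<close>, on rejection by \<open>c\<close>.\<close>
  also have "\<dots> \<le> (\<integral>\<^sup>+\<xi>. ennreal (L \<xi>) * indicator (A 0) \<xi> + ennreal c * indicator (A 1) \<xi> \<partial>noise idx)"
  proof (intro nn_integral_mono)
    fix \<xi> assume \<xi>: "\<xi> \<in> space (noise (idx :: (nat ^ 'd) set))"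
    then have "?scale \<xi> \<in> space obs_space" by (simp add: space_obs)
    then have "\<xi> \<in> A 0 \<or> \<xi> \<in> A 1" using test_values[OF \<psi>] \<xi> by (auto simp: A_def)
    moreover have "ennreal (min (L \<xi>) c) \<le> ennreal (L \<xi>)" "ennreal (min (L \<xi>) c) \<le> ennreal c"
      by (auto intro!: ennreal_leI)
    ultimately show "ennreal (min (L \<xi>) c) \<le> ennreal (L \<xi>) * indicator (A 0) \<xi> + ennreal c * indicator (A 1) \<xi>"
      by (auto simp: indicator_def intro: add_increasing add_increasing2)
  qed
  also have "\<dots> = (\<integral>\<^sup>+\<xi>. ennreal (L \<xi>) * indicator (A 0) \<xi> \<partial>noise idx) + ennreal c * emeasure (noise idx) (A 1)"
    by (subst nn_integral_add) (auto simp: nn_integral_cmult_indicator)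
  also have "\<dots> \<le> ennreal (type_II_error b \<epsilon> \<Theta> \<psi>) + ennreal c * ennreal (measure (obs_law b \<epsilon> (\<lambda>_. 0)) {y \<in> space obs_space. \<psi> y = 1})"
    using avg S A1 by (intro add_mono) auto
  also have "\<dots> = ennreal (type_II_error b \<epsilon> \<Theta> \<psi> + c * measure (obs_law b \<epsilon> (\<lambda>_. 0)) {y \<in> space obs_space. \<psi> y = 1})"
    using c by (simp add: type_II_error_nonneg flip: ennreal_mult ennreal_plus)
  finally show ?thesis
    using c type_II_error_nonneg[of b \<epsilon> \<Theta> \<psi>] unfolding L_def by (subst (asm) ennreal_le_iff) auto
qed

section \<open>Error bounds with thresholds uniform in the model\<close>

text \<open>The truncation level is the Neyman-Pearson threshold at the quantile, for which the
  limiting Bayes risk equals the target error plus \<open>c * \<alpha>\<close>; the second term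
  cancels against the cost of the type I error. The lower bound \<open>k\<close> on \<open>u\<close>
  keeps the normalised weights small, the upper bound \<open>B\<close> gives one truncation and one
  Lipschitz constant for all \<open>u\<close>.\<close>

lemma minimax_lower_bound:
  fixes \<alpha> e k B :: real
  assumes \<alpha>: "0 < \<alpha>" "\<alpha> < 1" and e: "0 < e" and k: "0 < k" and B: "0 < B"
  obtains \<delta> where "0 < \<delta>"
    "\<And>I (b :: nat ^ 'd \<Rightarrow> real) \<epsilon> \<theta> \<Theta> u q. finite I \<Longrightarrow> I \<subseteq> idx \<Longrightarrow> 0 < \<epsilon> \<Longrightarrow>
      (\<And>\<sigma>. (\<And>l. l \<in> I \<Longrightarrow> \<sigma> l \<in> {-1, 1}) \<Longrightarrow> (\<lambda>l. if l \<in> I then \<sigma> l * \<theta> l else 0) \<in> \<Theta>) \<Longrightarrow>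
      u\<^sup>2 = (\<Sum>l\<in>I. (b l * \<theta> l / \<epsilon>) ^ 4) / 2 \<Longrightarrow> k \<le> u \<Longrightarrow> u \<le> B \<Longrightarrow>
      (\<And>l. l \<in> I \<Longrightarrow> (b l * \<theta> l / \<epsilon>)\<^sup>2 \<le> \<delta>) \<Longrightarrow> \<bar>q - \<alpha>\<bar> \<le> \<delta> \<Longrightarrow>
      std_normal_cdf (upper_quantile \<alpha> - u) - e \<le> minimax_type_II_error b \<epsilon> \<Theta> q"
proof -
  interpret white_noise "noise idx" "\<lambda>l \<xi>. \<xi> l" "idx :: (nat ^ 'd) set"
    by (rule white_noise_coordinates[OF idx_nonempty])
  define H where "H = upper_quantile \<alpha>"
  \<comment> \<open>A bound on the threshold \<open>exp (u * H - u\<^sup>2 / 2)\<close> valid for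
    all \<open>u\<close> between 0 and \<open>B\<close>.\<close>
  define C where "C = exp (B * \<bar>H\<bar>)"
  have C: "0 < C" by (simp add: C_def)
  have e4: "0 < e / 4" using e by simp
  obtain d where d: "0 < d"
    "\<And>I w g. finite I \<Longrightarrow> I \<subseteq> idx \<Longrightarrow> (\<Sum>i\<in>I. (w i)\<^sup>2) = 1 / 2 \<Longrightarrow> (\<And>i. i \<in> I \<Longrightarrow> \<bar>w i\<bar> \<le> d) \<Longrightarrow>
      (\<And>x. \<bar>g x\<bar> \<le> C) \<Longrightarrow> (\<And>x y. \<bar>g x - g y\<bar> \<le> (C * B) * \<bar>x - y\<bar>) \<Longrightarrow>
      \<bar>expectation (\<lambda>\<xi>. g (chi2 I w \<xi>)) - integral\<^sup>L std_normal g\<bar> \<le> e / 4"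
    using chi2_uniform_clt[OF e4] by metis
  \<comment> \<open>In this order: the normalised weights stay below \<open>d\<close>, the quartic
    remainder costs at most \<open>e / 4\<close>, the deviation of the level costs at most
    \<open>e / 4\<close>, and the level stays nonnegative.\<close>
  define \<delta> where "\<delta> = Min {2 * k * d, e / (8 * C * B), e / (4 * C), \<alpha>}"
  have \<delta>: "0 < \<delta>" "\<delta> \<le> 2 * k * d" "\<delta> \<le> e / (8 * C * B)" "\<delta> \<le> e / (4 * C)" "\<delta> \<le> \<alpha>"
    using k d C B e \<alpha> by (auto simp: \<delta>_def)
  show ?thesis
  proof (rule that[OF \<delta>(1)])
    fix I and b \<theta> :: "nat ^ 'd \<Rightarrow> real" and \<epsilon> u q :: real and \<Theta>
    assume I: "finite I" "I \<subseteq> idx" and \<epsilon>: "0 < \<epsilon>"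
      and \<Theta>: "\<And>\<sigma>. (\<And>l. l \<in> I \<Longrightarrow> \<sigma> l \<in> {-1, 1}) \<Longrightarrow> (\<lambda>l. if l \<in> I then \<sigma> l * \<theta> l else 0) \<in> \<Theta>"
      and u: "u\<^sup>2 = (\<Sum>l\<in>I. (b l * \<theta> l / \<epsilon>) ^ 4) / 2" "k \<le> u" "u \<le> B"
      and v: "\<And>l. l \<in> I \<Longrightarrow> (b l * \<theta> l / \<epsilon>)\<^sup>2 \<le> \<delta>" and q: "\<bar>q - \<alpha>\<bar> \<le> \<delta>"
    have u0: "0 < u" using k u by linarith
    define c where "c = exp (u * H - u\<^sup>2 / 2)"
    have c: "0 < c" "c \<le> C"
    proof -
      have "u * H \<le> u * \<bar>H\<bar>" using u0 by (intro mult_left_mono) auto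
      also have "\<dots> \<le> B * \<bar>H\<bar>" using u by (intro mult_right_mono) auto
      finally have "u * H - u\<^sup>2 / 2 \<le> B * \<bar>H\<bar>" using zero_le_power2[of u] by linarith
      then show "c \<le> C" unfolding c_def C_def by simp
    qed (simp add: c_def)
    define g where "g x = min (exp (u * x - u\<^sup>2 / 2)) c" for x
    let ?w = "\<lambda>l. (b l * \<theta> l / \<epsilon>)\<^sup>2 / (2 * u)"
    have w: "(\<Sum>l\<in>I. (?w l)\<^sup>2) = 1 / 2"
    proof -
      have "(\<Sum>l\<in>I. (?w l)\<^sup>2) = (\<Sum>l\<in>I. (b l * \<theta> l / \<epsilon>) ^ 4 / (4 * u\<^sup>2))"
        by (intro sum.cong refl) (simp add: power_divide power_mult_distrib)
      also have "\<dots> = (\<Sum>l\<in>I. (b l * \<theta> l / \<epsilon>) ^ 4) / (4 * u\<^sup>2)" by (simp add: sum_divide_distrib)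
      also have "(\<Sum>l\<in>I. (b l * \<theta> l / \<epsilon>) ^ 4) = 2 * u\<^sup>2" using u by simp
      finally show ?thesis using u0 by simp
    qed
    have wd: "\<bar>?w l\<bar> \<le> d" if "l \<in> I" for l
    proof -
      have "?w l \<le> (2 * k * d) / (2 * u)" using v[OF that] \<delta>(2) u0 by (intro divide_right_mono) auto
      also have "\<dots> \<le> (2 * u * d) / (2 * u)" using u u0 d by (intro divide_right_mono mult_right_mono) auto
      finally show ?thesis using u0 by simp
    qed
    have g1: "\<bar>g x\<bar> \<le> C" for x using c by (auto simp: g_def)
    have g2: "\<bar>g x - g y\<bar> \<le> (C * B) * \<bar>x - y\<bar>" for x y
    proof -
      have "\<bar>g x - g y\<bar> \<le> c * \<bar>(u * x - u\<^sup>2 / 2) - (u * y - u\<^sup>2 / 2)\<bar>"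
        unfolding g_def by (rule min_exp_lipschitz[OF c(1)])
      also have "\<dots> = (c * u) * \<bar>x - y\<bar>" using u0 by (simp add: abs_mult flip: right_diff_distrib)
      also have "\<dots> \<le> (C * B) * \<bar>x - y\<bar>" using c C u u0 by (intro mult_right_mono mult_mono) auto
      finally show ?thesis .
    qed
    have "integral\<^sup>L std_normal g = std_normal_cdf (H - u) + c * (1 - std_normal_cdf H)"
      unfolding g_def c_def by (rule integral_exp_min[OF u0])
    also have "\<dots> = std_normal_cdf (H - u) + c * \<alpha>"
      using std_normal_cdf_upper_quantile[OF \<alpha>] by (simp add: H_def)
    finally have g3: "std_normal_cdf (H - u) + c * \<alpha> - e / 4 \<le> expectation (\<lambda>\<xi>. g (chi2 I ?w \<xi>))"
      using d(2)[OF I w wd g1 g2] by linarith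
    have "c * (2 * \<delta> * u) \<le> C * (2 * \<delta> * B)"
      using c C u u0 \<delta> by (intro mult_mono) auto
    also have "\<dots> \<le> e / 4" using \<delta>(3) C B by (simp add: field_simps)
    finally have err1: "c * (2 * \<delta> * u) \<le> e / 4" .
    have "c * (q - \<alpha>) \<le> c * \<delta>" using c q by (intro mult_left_mono) auto
    also have "\<dots> \<le> C * \<delta>" using c \<delta> by (intro mult_right_mono) auto
    also have "\<dots> \<le> e / 4" using \<delta>(4) C by (simp add: field_simps)
    finally have err2: "c * (q - \<alpha>) \<le> e / 4" .
    show "std_normal_cdf (upper_quantile \<alpha> - u) - e \<le> minimax_type_II_error b \<epsilon> \<Theta> q"
    proof (rule minimax_ge)
      show "0 \<le> q" using q \<delta>(5) by linarith
      fix \<psi> :: "(nat ^ 'd \<Rightarrow> real) \<Rightarrow> nat" assume "\<psi> \<in> tests_of_level b \<epsilon> q"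
      then have \<psi>: "\<psi> \<in> tests" "measure (obs_law b \<epsilon> (\<lambda>_. 0)) {y \<in> space obs_space. \<psi> y = 1} \<le> q"
        by (auto simp: tests_of_level_def)
      have "expectation (\<lambda>\<xi>. g (chi2 I ?w \<xi>)) - c * (2 * \<delta> * u)
        \<le> expectation (\<lambda>\<xi>. min (\<Prod>l\<in>I. exp (- (b l * \<theta> l / \<epsilon>)\<^sup>2 / 2) * cosh (b l * \<theta> l / \<epsilon> * \<xi> l)) c)"
        unfolding g_def by (rule expectation_likelihood_ge[OF I u0 u(1) v \<delta>(1) c(1)])
      also have "\<dots> \<le> type_II_error b \<epsilon> \<Theta> \<psi> + c * measure (obs_law b \<epsilon> (\<lambda>_. 0)) {y \<in> space obs_space. \<psi> y = 1}"
        using c by (intro type_II_error_sign_prior[OF I \<epsilon> \<psi>(1) _ \<Theta>]) auto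
      also have "\<dots> \<le> type_II_error b \<epsilon> \<Theta> \<psi> + c * q" using \<psi>(2) c by (intro add_left_mono mult_left_mono) auto
      finally have "expectation (\<lambda>\<xi>. g (chi2 I ?w \<xi>)) - c * (2 * \<delta> * u) \<le> type_II_error b \<epsilon> \<Theta> \<psi> + c * q" .
      with g3 err1 err2 e show "std_normal_cdf (upper_quantile \<alpha> - u) - e \<le> type_II_error b \<epsilon> \<Theta> \<psi>"
        unfolding H_def[symmetric] by (simp add: right_diff_distrib)
    qed
  qed
qed

text \<open>The test rejects when the weighted chi-square statistic exceeds a threshold raised
  slightly above the quantile. This lowers the type I error strictly below \<alpha> in the limit and
  raises the type II error only by a Lipschitz amount. The level is bounded only from below, since a
  test of smaller level belongs to every larger class.\<close>

lemma minimax_upper_bound: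
  fixes \<alpha> e B :: real
  assumes \<alpha>: "0 < \<alpha>" "\<alpha> < 1" and e: "0 < e" and B: "0 \<le> B"
  obtains \<delta> where "0 < \<delta>"
    "\<And>I (b :: nat ^ 'd \<Rightarrow> real) \<epsilon> w \<Theta> u q. finite I \<Longrightarrow> I \<subseteq> idx \<Longrightarrow> 0 < \<epsilon> \<Longrightarrow>
      (\<Sum>l\<in>I. (w l)\<^sup>2) = 1 / 2 \<Longrightarrow> (\<And>l. l \<in> I \<Longrightarrow> 0 \<le> w l) \<Longrightarrow> (\<And>l. l \<in> I \<Longrightarrow> w l \<le> \<delta>) \<Longrightarrow>
      0 \<le> u \<Longrightarrow> u \<le> B \<Longrightarrow> (\<And>\<theta>. \<theta> \<in> \<Theta> \<Longrightarrow> u \<le> (\<Sum>l\<in>I. w l * (b l * \<theta> l / \<epsilon>)\<^sup>2)) \<Longrightarrow> \<alpha> - \<delta> \<le> q \<Longrightarrow>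
      minimax_type_II_error b \<epsilon> \<Theta> q \<le> std_normal_cdf (upper_quantile \<alpha> - u) + e"
proof -
  interpret white_noise "noise idx" "\<lambda>l \<xi>. \<xi> l" "idx :: (nat ^ 'd) set"
    by (rule white_noise_coordinates[OF idx_nonempty])
  define H where "H = upper_quantile \<alpha>"
  have H: "std_normal_cdf H = 1 - \<alpha>" unfolding H_def by (rule std_normal_cdf_upper_quantile[OF \<alpha>])
  define s where "s = e / 8"
  have s: "0 < s" using e by (simp add: s_def)
  \<comment> \<open>The raised threshold gains \<open>2 * \<gamma>\<close> in level: one \<gamma> is
    spent on the normal approximation, the other on levels below \<alpha>.\<close>
  define \<gamma> where "\<gamma> = (std_normal_cdf (H + s) - (1 - \<alpha>)) / 2"
  have \<gamma>: "0 < \<gamma>" using std_normal_cdf_strict_mono[of H "H + s"] s H by (simp add: \<gamma>_def)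
  have \<gamma>s: "0 < min \<gamma> s" using \<gamma> s by simp
  obtain d where d: "0 < d"
    "\<And>I w x. finite I \<Longrightarrow> I \<subseteq> idx \<Longrightarrow> (\<Sum>i\<in>I. (w i)\<^sup>2) = 1 / 2 \<Longrightarrow> (\<And>i. i \<in> I \<Longrightarrow> \<bar>w i\<bar> \<le> d) \<Longrightarrow>
      \<bar>prob {\<omega> \<in> space (noise idx). chi2 I w \<omega> \<le> x} - std_normal_cdf x\<bar> \<le> min \<gamma> s"
    by (rule chi2_uniform_cdf[OF \<gamma>s]) (erule that, blast)
  \<comment> \<open>The factor from the bound for shifted statistics, maximised over
    \<open>u\<close> up to \<open>B\<close>.\<close>
  define D where "D = B / s\<^sup>2 + 1 / s"
  have D: "0 < D" using B s by (simp add: D_def add_nonneg_pos)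
  define \<delta> where "\<delta> = Min {d, \<gamma>, s / (4 * D)}"
  have \<delta>: "0 < \<delta>" "\<delta> \<le> d" "\<delta> \<le> \<gamma>" "\<delta> \<le> s / (4 * D)"
    using d \<gamma> s D by (auto simp: \<delta>_def)
  show ?thesis
  proof (rule that[OF \<delta>(1)])
    fix I and b w :: "nat ^ 'd \<Rightarrow> real" and \<epsilon> u q :: real and \<Theta>
    assume I: "finite I" "I \<subseteq> idx" and \<epsilon>: "0 < \<epsilon>"
      and w: "(\<Sum>l\<in>I. (w l)\<^sup>2) = 1 / 2" "\<And>l. l \<in> I \<Longrightarrow> 0 \<le> w l" "\<And>l. l \<in> I \<Longrightarrow> w l \<le> \<delta>"
      and u: "0 \<le> u" "u \<le> B" and \<Theta>: "\<And>\<theta>. \<theta> \<in> \<Theta> \<Longrightarrow> u \<le> (\<Sum>l\<in>I. w l * (b l * \<theta> l / \<epsilon>)\<^sup>2)"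
      and q: "\<alpha> - \<delta> \<le> q"
    have wd: "\<bar>w l\<bar> \<le> d" if "l \<in> I" for l using w(2,3)[OF that] \<delta>(2) by linarith
    have clt: "\<bar>prob {\<xi> \<in> space (noise idx). chi2 I w \<xi> \<le> x} - std_normal_cdf x\<bar> \<le> \<gamma>"
      "\<bar>prob {\<xi> \<in> space (noise idx). chi2 I w \<xi> \<le> x} - std_normal_cdf x\<bar> \<le> s" for x
      using d(2)[OF I w(1) wd, of x] by simp_all
    define T where "T y = (\<Sum>l\<in>I. w l * ((y l / \<epsilon>)\<^sup>2 - 1))" for y
    define \<psi> :: "(nat ^ 'd \<Rightarrow> real) \<Rightarrow> nat" where "\<psi> y = (if H + s < T y then 1 else 0)" for y
    have [measurable]: "(\<lambda>y. y l) \<in> borel_measurable obs_space" if "l \<in> I" for l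
      unfolding obs_space_def using that I by (intro measurable_component_singleton) auto
    have [measurable]: "T \<in> borel_measurable obs_space"
      unfolding T_def[abs_def] by measurable
    have \<psi>: "\<psi> \<in> tests"
      unfolding tests_def \<psi>_def[abs_def] by measurable
    have T_obs: "T (\<lambda>l\<in>idx. b l * \<theta> l + \<epsilon> * \<xi> l) = (\<Sum>l\<in>I. w l * ((\<xi> l + b l * \<theta> l / \<epsilon>)\<^sup>2 - 1))" for \<theta> \<xi>
      unfolding T_def using I \<epsilon> by (intro sum.cong refl) (auto simp: field_simps)
    have type_I: "measure (obs_law b \<epsilon> (\<lambda>_. 0)) {y \<in> space obs_space. \<psi> y = 1} \<le> q"
    proof -
      have "measure (obs_law b \<epsilon> (\<lambda>_. 0)) {y \<in> space obs_space. \<psi> y = 1}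
        = prob {\<xi> \<in> space (noise idx). \<psi> (\<lambda>l\<in>idx. b l * 0 + \<epsilon> * \<xi> l) = 1}"
        unfolding measure_def by (subst obs_law_test[OF \<psi>]) simp
      also have "\<dots> = prob (space (noise idx) - {\<xi> \<in> space (noise idx). chi2 I w \<xi> \<le> H + s})"
      proof -
        have "\<psi> (\<lambda>l\<in>idx. b l * 0 + \<epsilon> * \<xi> l) = 1 \<longleftrightarrow> \<not> chi2 I w \<xi> \<le> H + s" for \<xi>
          unfolding \<psi>_def chi2_def using T_obs[of "\<lambda>_. 0" \<xi>] by (simp add: not_le)
        then show ?thesis by (intro arg_cong[where f=prob]) auto
      qed
      also have "\<dots> = 1 - prob {\<xi> \<in> space (noise idx). chi2 I w \<xi> \<le> H + s}"
      proof (rule prob_compl)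
        have [measurable]: "chi2 I w \<in> borel_measurable (noise idx)" by (rule chi2_measurable[OF I(2)])
        show "{\<xi> \<in> space (noise idx). chi2 I w \<xi> \<le> H + s} \<in> events"
          by (rule borel_measurable_le) simp_all
      qed
      also have "\<dots> \<le> \<alpha> - \<gamma>" 
      proof -
        have "2 * \<gamma> = std_normal_cdf (H + s) - (1 - \<alpha>)" by (simp add: \<gamma>_def)
        then show ?thesis using clt(1)[of "H + s"] by linarith
      qed
      finally show ?thesis using q \<delta>(3) by linarith
    qed
    have "type_II_error b \<epsilon> \<Theta> \<psi> \<le> std_normal_cdf (H - u) + e"
      unfolding type_II_error_def
    proof (rule enn2real_leI)
      show "0 \<le> std_normal_cdf (H - u) + e" using e by (simp add: std_normal_cdf_eq add_nonneg_pos)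
      show "(SUP \<theta>\<in>\<Theta>. emeasure (obs_law b \<epsilon> \<theta>) {y \<in> space obs_space. \<psi> y = 0}) \<le> ennreal (std_normal_cdf (H - u) + e)"
      proof (rule SUP_least)
        fix \<theta> assume \<theta>: "\<theta> \<in> \<Theta>"
        have "emeasure (obs_law b \<epsilon> \<theta>) {y \<in> space obs_space. \<psi> y = 0}
          = emeasure (noise idx) {\<xi> \<in> space (noise idx). \<psi> (\<lambda>l\<in>idx. b l * \<theta> l + \<epsilon> * \<xi> l) = 0}"
          by (rule obs_law_test[OF \<psi>])
        also have "{\<xi> \<in> space (noise idx). \<psi> (\<lambda>l\<in>idx. b l * \<theta> l + \<epsilon> * \<xi> l) = 0}
          = {\<xi> \<in> space (noise idx). (\<Sum>l\<in>I. w l * ((\<xi> l + b l * \<theta> l / \<epsilon>)\<^sup>2 - 1)) \<le> H + s}"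
          unfolding \<psi>_def T_obs by (auto simp: not_less)
        also have "emeasure (noise idx) \<dots> = ennreal (prob \<dots>)" by (rule emeasure_eq_measure)
        also have "\<dots> \<le> ennreal (std_normal_cdf (H - u) + e)"
        proof (rule ennreal_leI)
          have "prob {\<xi> \<in> space (noise idx). (\<Sum>l\<in>I. w l * ((\<xi> l + b l * \<theta> l / \<epsilon>)\<^sup>2 - 1)) \<le> H + s}
            \<le> prob {\<xi> \<in> space (noise idx). chi2 I w \<xi> \<le> H + s - u + s} + 4 * \<delta> * (u / s\<^sup>2 + 1 / s)"
            using I w \<delta>(1) u(1) \<Theta>[OF \<theta>] s by (intro prob_shifted_chi2_le) auto
          moreover have "4 * \<delta> * (u / s\<^sup>2 + 1 / s) \<le> 4 * \<delta> * D"
            unfolding D_def using \<delta>(1) u s by (intro mult_left_mono add_mono divide_right_mono) auto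
          moreover have "4 * \<delta> * D \<le> s" using \<delta>(4) D by (simp add: field_simps)
          moreover have "std_normal_cdf (H + s - u + s) \<le> std_normal_cdf (H - u) + 2 * s"
            using std_normal_cdf_lipschitz[of "H - u" "H + s - u + s"] s by simp
          moreover have "8 * s = e" by (simp add: s_def)
          ultimately show "prob {\<xi> \<in> space (noise idx). (\<Sum>l\<in>I. w l * ((\<xi> l + b l * \<theta> l / \<epsilon>)\<^sup>2 - 1)) \<le> H + s}
            \<le> std_normal_cdf (H - u) + e"
            using clt(2)[of "H + s - u + s"] e by linarith
        qed
        finally show "emeasure (obs_law b \<epsilon> \<theta>) {y \<in> space obs_space. \<psi> y = 0} \<le> ennreal (std_normal_cdf (H - u) + e)" .
      qed
    qed
    moreover have "minimax_type_II_error b \<epsilon> \<Theta> q \<le> type_II_error b \<epsilon> \<Theta> \<psi>"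
      using \<psi> type_I by (intro minimax_le) (simp add: tests_of_level_def)
    ultimately show "minimax_type_II_error b \<epsilon> \<Theta> q \<le> std_normal_cdf (upper_quantile \<alpha> - u) + e"
      unfolding H_def by linarith
  qed
qed

section \<open>Low frequencies and the extremal problem\<close>

lemma card_vec_box:
  fixes A :: "'d::finite \<Rightarrow> nat set"
  assumes "\<And>j. finite (A j)"
  shows "finite {l :: nat ^ 'd. \<forall>j. l $ j \<in> A j}"
    and "card {l :: nat ^ 'd. \<forall>j. l $ j \<in> A j} = (\<Prod>j\<in>UNIV. card (A j))"
proof -
  have bij: "bij_betw vec_nth {l :: nat ^ 'd. \<forall>j. l $ j \<in> A j} (Pi\<^sub>E UNIV A)"
    by (rule bij_betwI[where g=vec_lambda]) (auto simp: PiE_iff)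
  have "finite (Pi\<^sub>E UNIV A)" using assms by (intro finite_PiE) auto
  with bij_betw_finite[OF bij] show "finite {l :: nat ^ 'd. \<forall>j. l $ j \<in> A j}" by blast
  show "card {l :: nat ^ 'd. \<forall>j. l $ j \<in> A j} = (\<Prod>j\<in>UNIV. card (A j))"
    using bij_betw_same_card[OF bij] by (simp add: card_PiE)
qed

text \<open>The ellipsoid weights depend on \<open>l\<close> only through the sum of its
  coordinates, so their sublevel sets are these simplices.\<close>

definition low_freq :: "nat \<Rightarrow> (nat ^ 'd) set"
  where "low_freq N = {l \<in> idx. (\<Sum>j\<in>UNIV. l $ j) \<le> N}"

lemma low_freq_subset: "low_freq N \<subseteq> idx"
  by (auto simp: low_freq_def)

lemma low_freq_mono: "M \<le> N \<Longrightarrow> low_freq M \<subseteq> low_freq N"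
  by (auto simp: low_freq_def)

lemma low_freq_coordinates:
  assumes "l \<in> low_freq N"
  shows "l $ j \<in> {1..N}"
proof -
  have "l $ j \<le> (\<Sum>j\<in>UNIV. l $ j)" by (rule member_le_sum) auto
  then show ?thesis using assms by (auto simp: low_freq_def idx_def)
qed

lemma finite_low_freq: "finite (low_freq N)"
  by (rule finite_subset[OF _ card_vec_box(1)[of "\<lambda>_. {1..N}"]]) (use low_freq_coordinates in blast, simp)

text \<open>Replacing one coordinate by the total sum is injective. The new coordinate lies in
  \<open>{M<..N}\<close> and the others in \<open>{1..N}\<close>, so the thin shell embeds into a
  box.\<close>

lemma card_low_freq_diff:
  assumes "M \<le> N"
  shows "card (low_freq N - low_freq M :: (nat ^ 'd) set) \<le> N ^ (CARD('d) - 1) * (N - M)"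
proof -
  obtain j0 :: 'd where True by blast
  define f where "f l = (\<chi> j. if j = j0 then (\<Sum>j\<in>UNIV. l $ j) else l $ j)" for l :: "nat ^ 'd"
  define A where "A j = (if j = j0 then {M<..N} else {1..N})" for j
  have "inj_on f (low_freq N - low_freq M)"
  proof (rule inj_onI)
    fix l k assume eq: "f l = f k"
    have other: "l $ j = k $ j" if "j \<noteq> j0" for j
      using arg_cong[OF eq, of "\<lambda>v. v $ j"] that by (simp add: f_def)
    have "(\<Sum>j\<in>UNIV. l $ j) = (\<Sum>j\<in>UNIV. k $ j)"
      using arg_cong[OF eq, of "\<lambda>v. v $ j0"] by (simp add: f_def)
    then have "l $ j0 + (\<Sum>j\<in>UNIV - {j0}. l $ j) = k $ j0 + (\<Sum>j\<in>UNIV - {j0}. k $ j)"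
      by (simp add: sum.remove[of UNIV j0])
    moreover have "(\<Sum>j\<in>UNIV - {j0}. l $ j) = (\<Sum>j\<in>UNIV - {j0}. k $ j)"
      by (intro sum.cong) (auto simp: other)
    ultimately have "l $ j = k $ j" for j using other by (cases "j = j0") auto
    then show "l = k" by (simp add: vec_eq_iff)
  qed
  then have "card (low_freq N - low_freq M :: (nat ^ 'd) set) = card (f ` (low_freq N - low_freq M))" by (simp add: card_image)
  also have "\<dots> \<le> card {l :: nat ^ 'd. \<forall>j. l $ j \<in> A j}"
  proof (rule card_mono)
    show "finite {l :: nat ^ 'd. \<forall>j. l $ j \<in> A j}" by (rule card_vec_box) (simp add: A_def)
    show "f ` (low_freq N - low_freq M) \<subseteq> {l :: nat ^ 'd. \<forall>j. l $ j \<in> A j}"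
    proof safe
      fix l :: "nat ^ 'd" and j assume l: "l \<in> low_freq N" "l \<notin> low_freq M"
      then have "M < (\<Sum>j\<in>UNIV. l $ j)" "(\<Sum>j\<in>UNIV. l $ j) \<le> N" by (auto simp: low_freq_def)
      with low_freq_coordinates[OF l(1), of j] show "f l $ j \<in> A j" by (simp add: f_def A_def)
    qed
  qed
  also have "\<dots> = (\<Prod>j\<in>UNIV. card (A j))" by (rule card_vec_box) (simp add: A_def)
  also have "\<dots> = card (A j0) * (\<Prod>j\<in>UNIV - {j0}. card (A j))" by (simp add: prod.remove[of UNIV j0])
  also have "(\<Prod>j\<in>UNIV - {j0}. card (A j)) = (\<Prod>j\<in>UNIV - {j0}. N)" by (intro prod.cong) (auto simp: A_def)
  also have "\<dots> = N ^ (CARD('d) - 1)" by (simp add: card_Diff_singleton)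
  finally show ?thesis by (simp add: A_def mult.commute)
qed

section \<open>Masses of the low-frequency sets and the energy beyond them\<close>

locale exponential_ellipsoid =
  fixes a b :: "nat ^ 'd \<Rightarrow> real" and t :: "real ^ 'd" and R s :: real
  assumes R_pos: "R > 0" and t_nonneg: "\<And>j. t $ j \<ge> 0" and s_pos: "s > 0"
    and b_sq: "\<And>l. l \<in> idx \<Longrightarrow> (b l)\<^sup>2 = (\<Prod>j\<in>UNIV. real (l $ j) powr (- 2 * t $ j))"
    and a_sq: "\<And>l. l \<in> idx \<Longrightarrow> (a l)\<^sup>2 = (\<Prod>j\<in>UNIV. exp (2 * s * real (l $ j)))"
begin

definition inv_b2 :: "nat ^ 'd \<Rightarrow> real"
  where "inv_b2 l = (\<Prod>j\<in>UNIV. real (l $ j) powr (2 * t $ j))"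

definition \<tau> :: real where "\<tau> = (\<Sum>j\<in>UNIV. t $ j)"

definition dimn :: real where "dimn = real CARD('d)"

text \<open>This sum of \<open>b\<^sub>l\<close> to the power -4 is the Cauchy-Schwarz constant of
  the extremal problem on the simplex and the normalising constant of both the test and the
  prior.\<close>

definition mass :: "nat \<Rightarrow> real" where "mass N = (\<Sum>l\<in>low_freq N. (inv_b2 l)\<^sup>2)"

lemma \<tau>_nonneg: "0 \<le> \<tau>" unfolding \<tau>_def by (intro sum_nonneg t_nonneg)

lemma dimn_ge_1: "1 \<le> dimn"
  unfolding dimn_def by (simp add: Suc_leI)

lemma idx_pos: "l \<in> idx \<Longrightarrow> 0 < l $ j" by (auto simp: idx_def Suc_le_eq)

lemma inv_b2_pos: "l \<in> idx \<Longrightarrow> 0 < inv_b2 l"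
  unfolding inv_b2_def using idx_pos by (intro prod_pos) auto

lemma b_sq_inv: "l \<in> idx \<Longrightarrow> (b l)\<^sup>2 = 1 / inv_b2 l"
  unfolding inv_b2_def b_sq by (simp add: powr_minus_divide prod_dividef)

lemma inv_b2_ge_1:
  assumes "l \<in> idx"
  shows "1 \<le> inv_b2 l"
proof -
  have "(\<Prod>j\<in>(UNIV :: 'd set). 1) \<le> inv_b2 l" unfolding inv_b2_def
    using idx_pos[OF assms] t_nonneg by (intro prod_mono) (auto intro!: ge_one_powr_ge_zero simp: Suc_le_eq)
  then show ?thesis by simp
qed

lemma b_sq_le_1: "l \<in> idx \<Longrightarrow> (b l)\<^sup>2 \<le> 1"
  using inv_b2_ge_1[of l] by (simp add: b_sq_inv)

lemma a_sq_exp: "l \<in> idx \<Longrightarrow> (a l)\<^sup>2 = exp (2 * s * real (\<Sum>j\<in>UNIV. l $ j))"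
  unfolding a_sq by (simp add: exp_sum[symmetric] sum_distrib_left)

lemma prod_powr_const:
  fixes x :: real
  assumes "0 < x"
  shows "(\<Prod>j\<in>UNIV. x powr (2 * t $ j)) = x powr (2 * \<tau>)"
  using powr_sum[of x "\<lambda>j. 2 * t $ j" UNIV] assms by (simp add: \<tau>_def sum_distrib_left)

lemma inv_b2_le:
  assumes "l \<in> low_freq N"
  shows "inv_b2 l \<le> real N powr (2 * \<tau>)"
proof -
  have l: "1 \<le> l $ j" "l $ j \<le> N" for j using low_freq_coordinates[OF assms, of j] by auto
  have N: "0 < real N" using l[of undefined] by simp
  show ?thesis
    unfolding inv_b2_def prod_powr_const[OF N, symmetric]
    using l t_nonneg by (intro prod_mono) (auto intro!: powr_mono2)
qed

text \<open>The shell has at most \<open>N ^ (CARD('d) - 1) * (N - M)\<close> points, each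
  contributing at most \<open>real N powr (4 * \<tau>)\<close>. Compared with the full mass, this is
  a relative loss of order (N - M) / N.\<close>

lemma mass_diff:
  assumes "M \<le> N" "0 < N"
  shows "mass N - mass M \<le> (real N - real M) * real N powr (4 * \<tau> + dimn - 1)"
proof -
  have "mass N - mass M = (\<Sum>l\<in>low_freq N - low_freq M. (inv_b2 l)\<^sup>2)"
    unfolding mass_def by (intro sum_diff[symmetric] finite_low_freq low_freq_mono assms(1))
  also have "\<dots> \<le> (\<Sum>l\<in>(low_freq N - low_freq M :: (nat ^ 'd) set). (real N powr (2 * \<tau>))\<^sup>2)"
    using inv_b2_pos low_freq_subset by (intro sum_mono power_mono inv_b2_le) (auto intro!: less_imp_le)
  also have "\<dots> = real (card (low_freq N - low_freq M :: (nat ^ 'd) set)) * real N powr (4 * \<tau>)"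
    using assms by (simp add: power2_eq_square flip: powr_add)
  also have "\<dots> \<le> real (N ^ (CARD('d) - 1) * (N - M)) * real N powr (4 * \<tau>)"
    using card_low_freq_diff[OF assms(1), where 'd='d] by (intro mult_right_mono) (auto simp only: of_nat_le_iff powr_ge_zero)
  also have "\<dots> = (real N - real M) * (real N powr (dimn - 1) * real N powr (4 * \<tau>))"
  proof -
    have "real N ^ (CARD('d) - 1) = real N powr (dimn - 1)"
      using assms(2) by (subst powr_realpow[symmetric]) (auto simp: dimn_def of_nat_diff Suc_leI)
    then show ?thesis using assms by (simp add: of_nat_diff)
  qed
  finally show ?thesis by (simp add: algebra_simps flip: powr_add)
qed

lemma mass_0: "mass 0 = 0"
  using low_freq_coordinates[of _ 0] by (auto simp: mass_def intro!: sum.neutral)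

lemma mass_le: "0 < N \<Longrightarrow> mass N \<le> real N powr (4 * \<tau> + dimn)"
  using mass_diff[of 0 N] by (simp add: mass_0 powr_diff)

text \<open>A cube away from the axes, with all coordinates in \<open>{k<..2 * k}\<close>, fits into
  the simplex. Every factor on it is as large as the bound asks for.\<close>

lemma mass_ge_cube:
  assumes k: "0 < k" "2 * k * CARD('d) \<le> N"
  shows "real k powr (4 * \<tau> + dimn) \<le> mass N"
proof -
  let ?Q = "{l :: nat ^ 'd. \<forall>j. l $ j \<in> {k<..2 * k}}"
  have fin: "finite ?Q" and card: "card ?Q = k ^ CARD('d)"
    using card_vec_box[of "\<lambda>_::'d. {k<..2 * k}"] by simp_all
  have sub: "?Q \<subseteq> low_freq N"
  proof
    fix l assume l: "l \<in> ?Q"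
    then have "(\<Sum>j\<in>UNIV. l $ j) \<le> (\<Sum>j\<in>(UNIV :: 'd set). 2 * k)" by (intro sum_mono) auto
    also have "\<dots> \<le> N" using k by (simp add: mult.commute mult.left_commute)
    finally have "(\<Sum>j\<in>UNIV. l $ j) \<le> N" .
    moreover have "1 \<le> l $ j" for j using l by (auto dest!: spec[of _ j])
    ultimately show "l \<in> low_freq N" by (simp add: low_freq_def idx_def)
  qed
  have "real k powr (4 * \<tau> + dimn) = (\<Sum>l\<in>?Q. (real k powr (2 * \<tau>))\<^sup>2)"
  proof -
    have "real k powr dimn = real k ^ CARD('d)" using k by (simp add: dimn_def powr_realpow)
    moreover have "(real k powr (2 * \<tau>))\<^sup>2 = real k powr (4 * \<tau>)"
      by (simp add: power2_eq_square flip: powr_add)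
    ultimately show ?thesis unfolding sum_constant card by (simp add: powr_add)
  qed
  also have "\<dots> \<le> (\<Sum>l\<in>?Q. (inv_b2 l)\<^sup>2)"
  proof (intro sum_mono power_mono)
    fix l assume l: "l \<in> ?Q"
    show "real k powr (2 * \<tau>) \<le> inv_b2 l"
    proof -
      have "real k powr (2 * t $ j) \<le> real (l $ j) powr (2 * t $ j)" for j
        using l t_nonneg[of j] by (intro powr_mono2) (auto intro: less_imp_le)
      then show ?thesis
        unfolding inv_b2_def using k(1) by (subst prod_powr_const[symmetric]) (auto intro!: prod_mono)
    qed
  qed simp
  also have "\<dots> \<le> mass N" unfolding mass_def by (intro sum_mono2 finite_low_freq sub) auto
  finally show ?thesis .
qed

text \<open>The cube of \<open>mass_ge_cube\<close> is used with
  \<open>k = N div (2 * CARD('d))\<close>, which is at least \<open>N / (4 * dimn)\<close> once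
  \<open>N\<close> is at least \<open>4 * dimn\<close>.\<close>

definition mass_const :: real where "mass_const = (1 / (4 * dimn)) powr (4 * \<tau> + dimn)"

lemma mass_const_pos: "0 < mass_const"
  using dimn_ge_1 by (simp add: mass_const_def)

lemma mass_ge:
  assumes "4 * dimn \<le> real N"
  shows "mass_const * real N powr (4 * \<tau> + dimn) \<le> mass N"
proof -
  define k where "k = N div (2 * CARD('d))"
  have "real N / (2 * dimn) < real k + 1"
  proof -
    have "N < (k + 1) * (2 * CARD('d))" unfolding k_def
      by (metis Suc_eq_plus1 div_less_iff_less_mult lessI mult_pos_pos pos2 zero_less_card_finite)
    then have "real N < (real k + 1) * (2 * dimn)" unfolding dimn_def
      by (metis (mono_tags, opaque_lifting) of_nat_1 of_nat_add of_nat_less_iff of_nat_mult of_nat_numeral)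
    then show ?thesis using dimn_ge_1 by (simp add: field_simps)
  qed
  moreover have "1 \<le> real N / (4 * dimn)" using assms dimn_ge_1 by (simp add: field_simps)
  moreover have "real N / (2 * dimn) = 2 * (real N / (4 * dimn))" by simp
  ultimately have k: "real N / (4 * dimn) \<le> real k" "0 < k" by linarith+
  have "mass_const * real N powr (4 * \<tau> + dimn) = (real N / (4 * dimn)) powr (4 * \<tau> + dimn)"
    using dimn_ge_1 by (simp add: mass_const_def flip: powr_mult)
  also have "\<dots> \<le> real k powr (4 * \<tau> + dimn)"
    using k dimn_ge_1 \<tau>_nonneg by (intro powr_mono2) auto
  also have "\<dots> \<le> mass N"
  proof (rule mass_ge_cube[OF k(2)])
    have "k * (2 * CARD('d)) \<le> N" unfolding k_def by (rule div_times_less_eq_dividend)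
    then show "2 * k * CARD('d) \<le> N" by (simp only: ac_simps)
  qed
  finally show ?thesis .
qed

text \<open>Outside the simplex \<open>(a l)\<^sup>2\<close> is at least
  \<open>exp (2 * s * N)\<close>, so the ellipsoid constraint leaves at most
  \<open>R\<^sup>2 * exp (- 2 * s * N)\<close> of energy there.\<close>

lemma energy_low_frequencies:
  assumes \<theta>: "\<theta> \<in> alternative a R r" and r: "0 \<le> r"
  shows "r\<^sup>2 - R\<^sup>2 * exp (- 2 * s * real N) \<le> (\<Sum>l\<in>low_freq N. (\<theta> l)\<^sup>2)"
proof -
  have sum1: "(\<lambda>l. (\<theta> l)\<^sup>2) summable_on idx" and sum2: "(\<lambda>l. (a l)\<^sup>2 * (\<theta> l)\<^sup>2) summable_on idx"
    and le: "(\<Sum>\<^sub>\<infinity>l\<in>idx. (a l)\<^sup>2 * (\<theta> l)\<^sup>2) \<le> R\<^sup>2" and norm: "r \<le> sqrt (\<Sum>\<^sub>\<infinity>l\<in>idx. (\<theta> l)\<^sup>2)"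
    using \<theta> by (auto simp: alternative_def ellipsoid_def ell2_def ell2_norm_def)
  have "0 \<le> (\<Sum>\<^sub>\<infinity>l\<in>idx. (\<theta> l)\<^sup>2)" by (rule infsum_nonneg) simp
  then have "r\<^sup>2 \<le> (\<Sum>\<^sub>\<infinity>l\<in>idx. (\<theta> l)\<^sup>2)" using power_mono[OF norm r, of 2] by simp
  also have "\<dots> = (\<Sum>l\<in>low_freq N. (\<theta> l)\<^sup>2) + (\<Sum>\<^sub>\<infinity>l\<in>idx - low_freq N. (\<theta> l)\<^sup>2)"
  proof -
    have "idx = low_freq N \<union> (idx - low_freq N)" using low_freq_subset by blast
    then have "(\<Sum>\<^sub>\<infinity>l\<in>idx. (\<theta> l)\<^sup>2) = infsum (\<lambda>l. (\<theta> l)\<^sup>2) (low_freq N \<union> (idx - low_freq N))"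
      by (rule arg_cong)
    also have "\<dots> = infsum (\<lambda>l. (\<theta> l)\<^sup>2) (low_freq N) + infsum (\<lambda>l. (\<theta> l)\<^sup>2) (idx - low_freq N)"
      using low_freq_subset by (intro infsum_Un_disjoint summable_on_subset_banach[OF sum1]) auto
    finally show ?thesis by (simp add: finite_low_freq)
  qed
  also have "(\<Sum>\<^sub>\<infinity>l\<in>idx - low_freq N. (\<theta> l)\<^sup>2) \<le> (\<Sum>\<^sub>\<infinity>l\<in>idx. exp (- 2 * s * real N) * ((a l)\<^sup>2 * (\<theta> l)\<^sup>2))"
  proof (rule infsum_mono_neutral)
    show "(\<lambda>l. (\<theta> l)\<^sup>2) summable_on idx - low_freq N" by (intro summable_on_subset_banach[OF sum1]) auto
    show "(\<lambda>l. exp (- 2 * s * real N) * ((a l)\<^sup>2 * (\<theta> l)\<^sup>2)) summable_on idx"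
      by (intro summable_on_cmult_right sum2)
    fix l :: "nat ^ 'd" assume "l \<in> (idx - low_freq N) \<inter> idx"
    then have l: "l \<in> idx" and N: "N < (\<Sum>j\<in>UNIV. l $ j)" by (auto simp: low_freq_def)
    have "1 \<le> exp (- 2 * s * real N) * (a l)\<^sup>2"
      using N s_pos unfolding a_sq_exp[OF l] by (simp del: of_nat_sum flip: exp_add)
    then have "1 * (\<theta> l)\<^sup>2 \<le> (exp (- 2 * s * real N) * (a l)\<^sup>2) * (\<theta> l)\<^sup>2" by (intro mult_right_mono) auto
    then show "(\<theta> l)\<^sup>2 \<le> exp (- 2 * s * real N) * ((a l)\<^sup>2 * (\<theta> l)\<^sup>2)" by (simp add: mult.assoc)
  qed auto
  also have "\<dots> = exp (- 2 * s * real N) * (\<Sum>\<^sub>\<infinity>l\<in>idx. (a l)\<^sup>2 * (\<theta> l)\<^sup>2)"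
    by (rule infsum_cmult_right')
  also have "\<dots> \<le> exp (- 2 * s * real N) * R\<^sup>2" using le by (intro mult_left_mono) auto
  finally show ?thesis by (simp add: algebra_simps)
qed

section \<open>Lower and upper estimates of the extremal value\<close>

text \<open>The signal that the test of cutoff \<open>N\<close> is sure to see on the whole
  alternative, once the largest possible tail energy has been given away.\<close>

definition lower_u :: "real \<Rightarrow> real \<Rightarrow> nat \<Rightarrow> real"
  where "lower_u \<epsilon> r N = (r\<^sup>2 - R\<^sup>2 * exp (- 2 * s * real N)) / (\<epsilon>\<^sup>2 * sqrt (2 * mass N))"

text \<open>The value of \<open>u\<close> attained by the sequence \<open>prior\<close>, which
  spreads all of \<open>r\<^sup>2\<close> over the simplex of level \<open>M\<close>.\<close>

definition upper_u :: "real \<Rightarrow> real \<Rightarrow> nat \<Rightarrow> real"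
  where "upper_u \<epsilon> r M = r\<^sup>2 / (\<epsilon>\<^sup>2 * sqrt (2 * mass M))"

text \<open>Squared entries proportional to \<open>(inv_b2 l)\<^sup>2\<close> are the equality case
  of the Cauchy-Schwarz step in \<open>lower_u_le\<close>; the normalisation makes the norm equal to
  \<open>r\<close>.\<close>

definition prior :: "real \<Rightarrow> nat \<Rightarrow> nat ^ 'd \<Rightarrow> real"
  where "prior r M l = r * inv_b2 l / sqrt (mass M)"

lemma test_weights:
  assumes "0 < mass N"
  shows "(\<Sum>l\<in>low_freq N. (inv_b2 l / sqrt (2 * mass N))\<^sup>2) = 1 / 2"
  using assms by (simp add: power_divide mass_def flip: sum_divide_distrib)

text \<open>The weights \<open>inv_b2\<close> cancel the squares of \<open>b\<close>, so the signal
  in the statistic is the plain low-frequency energy, the quantity that the alternative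
  controls.\<close>

lemma test_signal:
  assumes \<theta>: "\<theta> \<in> alternative a R r" and r: "0 \<le> r" and \<epsilon>: "0 < \<epsilon>" and N: "0 < mass N"
  shows "lower_u \<epsilon> r N \<le> (\<Sum>l\<in>low_freq N. inv_b2 l / sqrt (2 * mass N) * (b l * \<theta> l / \<epsilon>)\<^sup>2)"
proof -
  have "lower_u \<epsilon> r N \<le> (\<Sum>l\<in>low_freq N. (\<theta> l)\<^sup>2) / (\<epsilon>\<^sup>2 * sqrt (2 * mass N))"
    unfolding lower_u_def using energy_low_frequencies[OF \<theta> r] \<epsilon> N by (intro divide_right_mono) auto
  also have "\<dots> = (\<Sum>l\<in>low_freq N. (\<theta> l)\<^sup>2 / (\<epsilon>\<^sup>2 * sqrt (2 * mass N)))" by (simp add: sum_divide_distrib)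
  also have "\<dots> = (\<Sum>l\<in>low_freq N. inv_b2 l / sqrt (2 * mass N) * (b l * \<theta> l / \<epsilon>)\<^sup>2)"
  proof (rule sum.cong)
    fix l :: "nat ^ 'd" assume "l \<in> low_freq N"
    then have l: "l \<in> idx" using low_freq_subset by auto
    show "(\<theta> l)\<^sup>2 / (\<epsilon>\<^sup>2 * sqrt (2 * mass N)) = inv_b2 l / sqrt (2 * mass N) * (b l * \<theta> l / \<epsilon>)\<^sup>2"
      using inv_b2_pos[OF l] by (simp add: power_divide power_mult_distrib b_sq_inv[OF l])
  qed simp
  finally show ?thesis .
qed

text \<open>Each squared entry is at most the full squared norm and \<open>b\<close> is at most 1 in
  modulus. Without summability the infinite sum, being 0 by default, would not dominate its finite
  parts.\<close>

lemma b4_summable: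
  assumes "\<theta> \<in> ell2"
  shows "(\<lambda>l. b l ^ 4 * \<theta> l ^ 4) summable_on idx"
proof -
  have sum1: "(\<lambda>l. (\<theta> l)\<^sup>2) summable_on idx" using assms by (simp add: ell2_def)
  define S where "S = (\<Sum>\<^sub>\<infinity>l\<in>idx. (\<theta> l)\<^sup>2)"
  have S: "(\<theta> l)\<^sup>2 \<le> S" if "l \<in> idx" for l
    unfolding S_def using finite_sum_le_infsum[OF sum1, of "{l}"] that by simp
  show ?thesis
  proof (rule summable_on_comparison_test)
    show "(\<lambda>l. S * (\<theta> l)\<^sup>2) summable_on idx" by (intro summable_on_cmult_right sum1)
    fix l :: "nat ^ 'd" assume l: "l \<in> idx"
    have "b l ^ 4 * \<theta> l ^ 4 = ((b l)\<^sup>2)\<^sup>2 * ((\<theta> l)\<^sup>2 * (\<theta> l)\<^sup>2)" by (simp add: power4_eq_xxxx power2_eq_square)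
    also have "\<dots> \<le> 1 * (S * (\<theta> l)\<^sup>2)"
    proof (rule mult_mono)
      show "((b l)\<^sup>2)\<^sup>2 \<le> 1" using b_sq_le_1[OF l] power_le_one[of "(b l)\<^sup>2" 2] by simp
      show "(\<theta> l)\<^sup>2 * (\<theta> l)\<^sup>2 \<le> S * (\<theta> l)\<^sup>2" by (intro mult_right_mono S[OF l]) simp
    qed auto
    finally show "b l ^ 4 * \<theta> l ^ 4 \<le> S * (\<theta> l)\<^sup>2" by simp
  qed simp
qed

lemma extremal_u_bdd: "bdd_below ((\<lambda>\<theta>. \<Sum>\<^sub>\<infinity>k\<in>idx. b k ^ 4 * \<theta> k ^ 4) ` A)"
  by (rule bdd_belowI2[where m=0]) (auto intro!: infsum_nonneg)

text \<open>Cauchy-Schwarz on the simplex after writing \<open>(\<theta> l)\<^sup>2\<close> as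
  \<open>((b l)\<^sup>2 * (\<theta> l)\<^sup>2) * inv_b2 l\<close>. The sign of
  \<open>lower_u\<close> allows the energy bound to be squared, and a nonempty alternative gives the
  infimum its meaning.\<close>

lemma lower_u_le:
  assumes r: "0 \<le> r" and \<epsilon>: "0 < \<epsilon>" and N: "0 < mass N" and ne: "alternative a R r \<noteq> {}"
    and u: "0 \<le> lower_u \<epsilon> r N"
  shows "lower_u \<epsilon> r N \<le> extremal_u a b R \<epsilon> r"
proof -
  let ?g = "r\<^sup>2 - R\<^sup>2 * exp (- 2 * s * real N)"
  have "0 < \<epsilon>\<^sup>2 * sqrt (2 * mass N)" using \<epsilon> N by simp
  then have g: "0 \<le> ?g" using u unfolding lower_u_def zero_le_divide_iff by linarith
  have "?g\<^sup>2 / mass N \<le> (INF \<theta>\<in>alternative a R r. \<Sum>\<^sub>\<infinity>k\<in>idx. b k ^ 4 * \<theta> k ^ 4)"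
  proof (rule cINF_greatest[OF ne])
    fix \<theta> assume \<theta>: "\<theta> \<in> alternative a R r"
    have "?g\<^sup>2 \<le> (\<Sum>l\<in>low_freq N. (\<theta> l)\<^sup>2)\<^sup>2"
      using energy_low_frequencies[OF \<theta> r] g by (intro power_mono)
    also have "\<dots> = (\<Sum>l\<in>low_freq N. ((b l)\<^sup>2 * (\<theta> l)\<^sup>2) * inv_b2 l)\<^sup>2"
    proof (intro arg_cong[where f="\<lambda>x. x\<^sup>2"] sum.cong refl)
      fix l :: "nat ^ 'd" assume "l \<in> low_freq N"
      then have l: "l \<in> idx" using low_freq_subset by auto
      show "(\<theta> l)\<^sup>2 = ((b l)\<^sup>2 * (\<theta> l)\<^sup>2) * inv_b2 l"
        using inv_b2_pos[OF l] by (simp add: b_sq_inv[OF l])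
    qed
    also have "\<dots> \<le> (\<Sum>l\<in>low_freq N. ((b l)\<^sup>2 * (\<theta> l)\<^sup>2)\<^sup>2) * mass N"
      unfolding mass_def by (rule Cauchy_Schwarz_ineq_sum)
    also have "\<dots> \<le> (\<Sum>\<^sub>\<infinity>l\<in>idx. b l ^ 4 * \<theta> l ^ 4) * mass N"
    proof (rule mult_right_mono)
      have "\<theta> \<in> ell2" using \<theta> by (simp add: alternative_def ellipsoid_def)
      then have "(\<Sum>l\<in>low_freq N. b l ^ 4 * \<theta> l ^ 4) \<le> (\<Sum>\<^sub>\<infinity>l\<in>idx. b l ^ 4 * \<theta> l ^ 4)"
        by (intro finite_sum_le_infsum b4_summable finite_low_freq low_freq_subset) auto
      then show "(\<Sum>l\<in>low_freq N. ((b l)\<^sup>2 * (\<theta> l)\<^sup>2)\<^sup>2) \<le> (\<Sum>\<^sub>\<infinity>l\<in>idx. b l ^ 4 * \<theta> l ^ 4)"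
        by (simp add: power_mult_distrib)
    qed (use N in simp)
    finally show "?g\<^sup>2 / mass N \<le> (\<Sum>\<^sub>\<infinity>k\<in>idx. b k ^ 4 * \<theta> k ^ 4)"
      using N by (simp add: divide_le_eq)
  qed
  then have "1 / (2 * \<epsilon> ^ 4) * (?g\<^sup>2 / mass N) \<le> 1 / (2 * \<epsilon> ^ 4) * (INF \<theta>\<in>alternative a R r. \<Sum>\<^sub>\<infinity>k\<in>idx. b k ^ 4 * \<theta> k ^ 4)"
    by (intro mult_left_mono) auto
  moreover have "1 / (2 * \<epsilon> ^ 4) * (?g\<^sup>2 / mass N) = (lower_u \<epsilon> r N)\<^sup>2"
    using N by (simp add: lower_u_def power_divide power_mult_distrib flip: power_mult)
  ultimately show ?thesis
    unfolding extremal_u_def by (intro real_le_rsqrt) simp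
qed

text \<open>Only squares enter norm and ellipsoid, so signs are harmless. On the simplex
  \<open>(a l)\<^sup>2\<close> is at most \<open>exp (2 * s * M)\<close>, and bounding all weights
  by this maximum reduces membership to one inequality on \<open>r\<close>.\<close>

lemma signed_prior_in_alternative:
  assumes M: "0 < mass M" and r: "0 \<le> r" and size: "exp (2 * s * real M) * r\<^sup>2 \<le> R\<^sup>2"
    and \<sigma>: "\<And>l. l \<in> low_freq M \<Longrightarrow> \<sigma> l \<in> {-1, 1 :: real}"
  shows "(\<lambda>l. if l \<in> low_freq M then \<sigma> l * prior r M l else 0) \<in> alternative a R r"
proof -
  let ?\<theta> = "\<lambda>l. if l \<in> low_freq M then \<sigma> l * prior r M l else 0"
  have sq: "(?\<theta> l)\<^sup>2 = (if l \<in> low_freq M then (prior r M l)\<^sup>2 else 0)" for l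
    using \<sigma>[of l] by (auto simp: power_mult_distrib)
  have fin: "((\<lambda>l. if l \<in> low_freq M then f l else 0) has_sum (sum f (low_freq M))) idx" for f :: "nat ^ 'd \<Rightarrow> real"
  proof -
    have "(f has_sum (sum f (low_freq M))) (low_freq M)" by (intro has_sum_finite finite_low_freq)
    then show ?thesis
      by (rule has_sum_cong_neutral[THEN iffD1, rotated -1]) (use low_freq_subset in auto)
  qed
  have n: "(\<Sum>l\<in>low_freq M. (prior r M l)\<^sup>2) = r\<^sup>2"
    using M by (simp add: prior_def power_divide power_mult_distrib mass_def flip: sum_divide_distrib sum_distrib_left)
  have h1: "((\<lambda>l. (?\<theta> l)\<^sup>2) has_sum r\<^sup>2) idx"
    unfolding sq n[symmetric] by (rule fin)
  have h2: "((\<lambda>l. (a l)\<^sup>2 * (?\<theta> l)\<^sup>2) has_sum (\<Sum>l\<in>low_freq M. (a l)\<^sup>2 * (prior r M l)\<^sup>2)) idx"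
    unfolding sq using fin[of "\<lambda>l. (a l)\<^sup>2 * (prior r M l)\<^sup>2"] by (simp add: if_distrib cong: if_cong)
  have "(\<Sum>l\<in>low_freq M. (a l)\<^sup>2 * (prior r M l)\<^sup>2) \<le> (\<Sum>l\<in>low_freq M. exp (2 * s * real M) * (prior r M l)\<^sup>2)"
  proof (intro sum_mono mult_right_mono)
    fix l :: "nat ^ 'd" assume l: "l \<in> low_freq M"
    then have "l \<in> idx" "(\<Sum>j\<in>UNIV. l $ j) \<le> M" by (auto simp: low_freq_def)
    then show "(a l)\<^sup>2 \<le> exp (2 * s * real M)" using s_pos by (simp add: a_sq_exp del: of_nat_sum)
  qed simp
  also have "\<dots> = exp (2 * s * real M) * r\<^sup>2" using n by (simp flip: sum_distrib_left)
  also have "\<dots> \<le> R\<^sup>2" by (rule size)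
  finally have le: "(\<Sum>l\<in>low_freq M. (a l)\<^sup>2 * (prior r M l)\<^sup>2) \<le> R\<^sup>2" .
  have "?\<theta> \<in> ell2" unfolding ell2_def using h1 by (auto simp: summable_on_def)
  moreover have "(\<lambda>l. (a l)\<^sup>2 * (?\<theta> l)\<^sup>2) summable_on idx" using h2 by (auto simp: summable_on_def)
  moreover have "(\<Sum>\<^sub>\<infinity>l\<in>idx. (a l)\<^sup>2 * (?\<theta> l)\<^sup>2) \<le> R\<^sup>2" using infsumI[OF h2] le by simp
  moreover have "ell2_norm ?\<theta> = r" unfolding ell2_norm_def infsumI[OF h1] using r by simp
  ultimately show ?thesis by (simp add: alternative_def ellipsoid_def)
qed

lemma prior_signal_sq:
  assumes M: "0 < mass M" and l: "l \<in> low_freq M"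
  shows "(b l * prior r M l / \<epsilon>)\<^sup>2 = r\<^sup>2 * inv_b2 l / (\<epsilon>\<^sup>2 * mass M)"
proof -
  have l: "l \<in> idx" using l low_freq_subset by auto
  show ?thesis using inv_b2_pos[OF l] M
    by (simp add: prior_def power_divide power_mult_distrib b_sq_inv[OF l] power2_eq_square[of "inv_b2 l"])
qed

text \<open>The squared signals are proportional to \<open>inv_b2\<close>, so their squares add up
  to a multiple of \<open>mass M\<close>. This matches \<open>upper_u\<close> with the
  \<open>u\<close> of the likelihood bound.\<close>

lemma prior_signal:
  assumes M: "0 < mass M"
  shows "(upper_u \<epsilon> r M)\<^sup>2 = (\<Sum>l\<in>low_freq M. (b l * prior r M l / \<epsilon>) ^ 4) / 2"
proof -
  have "(\<Sum>l\<in>low_freq M. (b l * prior r M l / \<epsilon>) ^ 4) = (\<Sum>l\<in>low_freq M. (r\<^sup>2 / (\<epsilon>\<^sup>2 * mass M))\<^sup>2 * (inv_b2 l)\<^sup>2)"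
  proof (rule sum.cong)
    fix l :: "nat ^ 'd" assume l: "l \<in> low_freq M"
    have "(b l * prior r M l / \<epsilon>) ^ 4 = ((b l * prior r M l / \<epsilon>)\<^sup>2)\<^sup>2" by (simp flip: power_mult)
    also have "\<dots> = (r\<^sup>2 / (\<epsilon>\<^sup>2 * mass M))\<^sup>2 * (inv_b2 l)\<^sup>2"
      unfolding prior_signal_sq[OF M l] by (simp add: power_divide power_mult_distrib)
    finally show "(b l * prior r M l / \<epsilon>) ^ 4 = (r\<^sup>2 / (\<epsilon>\<^sup>2 * mass M))\<^sup>2 * (inv_b2 l)\<^sup>2" .
  qed simp
  also have "\<dots> = (r\<^sup>2 / (\<epsilon>\<^sup>2 * mass M))\<^sup>2 * mass M" by (simp add: mass_def sum_distrib_left)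
  also have "\<dots> = 2 * (upper_u \<epsilon> r M)\<^sup>2"
    using M by (simp add: upper_u_def power_divide power_mult_distrib power2_eq_square[of "mass M"])
  finally show ?thesis by simp
qed

lemma extremal_u_le:
  assumes M: "0 < mass M" and r: "0 \<le> r" and size: "exp (2 * s * real M) * r\<^sup>2 \<le> R\<^sup>2" and \<epsilon>: "0 < \<epsilon>"
  shows "extremal_u a b R \<epsilon> r \<le> upper_u \<epsilon> r M"
proof -
  \<comment> \<open>The factor 1 is the constant sign pattern, in the shape expected by
    \<open>signed_prior_in_alternative\<close>.\<close>
  let ?\<theta> = "\<lambda>l. if l \<in> low_freq M then 1 * prior r M l else 0"
  have mem: "?\<theta> \<in> alternative a R r"
    by (rule signed_prior_in_alternative[OF M r size]) simp
  have "(INF \<theta>\<in>alternative a R r. \<Sum>\<^sub>\<infinity>k\<in>idx. b k ^ 4 * \<theta> k ^ 4) \<le> (\<Sum>\<^sub>\<infinity>k\<in>idx. b k ^ 4 * ?\<theta> k ^ 4)"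
    by (rule cINF_lower[OF extremal_u_bdd mem])
  also have "\<dots> = (\<Sum>\<^sub>\<infinity>k\<in>low_freq M. b k ^ 4 * prior r M k ^ 4)"
    using low_freq_subset by (intro infsum_cong_neutral) auto
  also have "\<dots> = (\<Sum>k\<in>low_freq M. b k ^ 4 * prior r M k ^ 4)" by (simp add: finite_low_freq)
  also have "\<dots> = \<epsilon> ^ 4 * (\<Sum>k\<in>low_freq M. (b k * prior r M k / \<epsilon>) ^ 4)"
    unfolding sum_distrib_left using \<epsilon> by (intro sum.cong) (auto simp: power_divide power_mult_distrib)
  also have "\<dots> = 2 * \<epsilon> ^ 4 * (upper_u \<epsilon> r M)\<^sup>2"
    using prior_signal[OF M, of \<epsilon> r] by simp
  finally have "1 / (2 * \<epsilon> ^ 4) * (INF \<theta>\<in>alternative a R r. \<Sum>\<^sub>\<infinity>k\<in>idx. b k ^ 4 * \<theta> k ^ 4) \<le> (upper_u \<epsilon> r M)\<^sup>2"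
    using \<epsilon> by (simp add: field_simps)
  then have "extremal_u a b R \<epsilon> r \<le> sqrt ((upper_u \<epsilon> r M)\<^sup>2)"
    unfolding extremal_u_def by (rule real_sqrt_le_mono)
  also have "\<dots> = upper_u \<epsilon> r M" using M by (simp add: upper_u_def)
  finally show ?thesis .
qed

end

section \<open>Asymptotics\<close>

context exponential_ellipsoid
begin

section \<open>Cutoffs and constants as functions of the noise level\<close>

text \<open>The root of \<open>mass N\<close> has order \<open>N powr expo\<close>. As
  \<open>u\<close> compares \<open>r\<^sup>2 / \<epsilon>\<^sup>2\<close> with this root, and
  \<open>N\<close> is of order \<open>ln (1 / \<epsilon>)\<close>, half of \<open>expo\<close> is
  the exponent in the rate.\<close>

definition expo :: real where "expo = 2 * \<tau> + dimn / 2"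

lemma expo_pos: "0 < expo"
  using \<tau>_nonneg dimn_ge_1 by (simp add: expo_def)

lemma expo_double: "4 * \<tau> + dimn = 2 * expo" by (simp add: expo_def)

definition rate :: "real \<Rightarrow> real" where "rate \<epsilon> = \<epsilon> * ln (1 / \<epsilon>) powr (expo / 2)"

lemma rate_sq:
  assumes "0 < \<epsilon>"
  shows "(C * rate \<epsilon>)\<^sup>2 = C\<^sup>2 * ln (1 / \<epsilon>) powr expo * \<epsilon>\<^sup>2"
  by (simp add: rate_def power_mult_distrib power2_eq_square[of "_ powr _"] flip: powr_add)

text \<open>From \<open>ln (1 / \<epsilon>) \<le> 2 * s * M\<close> and the lower bound on
  \<open>mass M\<close>.\<close>

definition upper_const :: real where "upper_const = (2 * s) powr expo / sqrt (2 * mass_const)"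

text \<open>From \<open>ln (1 / \<epsilon>) \<ge> s / 2 * N\<close> and the upper bound on
  \<open>mass N\<close>; the additional factor 1/2 pays for the tail energy.\<close>

definition lower_const :: real where "lower_const = (s / 2) powr expo / (2 * sqrt 2)"

lemma upper_const_pos: "0 < upper_const"
  using s_pos mass_const_pos by (simp add: upper_const_def)

lemma lower_const_pos: "0 < lower_const"
  using s_pos by (simp add: lower_const_def)

text \<open>Membership in the ellipsoid requires \<open>exp (- 2 * s * sqrt N)\<close> to absorb a
  power of \<open>N\<close>, so a bounded gap between the levels would not suffice. The square root
  grows faster than the logarithm that is required, yet it is small against \<open>N\<close>, so
  that the mass hardly changes.\<close>

definition prior_level :: "nat \<Rightarrow> nat" where "prior_level N = N - nat \<lfloor>sqrt (real N)\<rfloor>"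

text \<open>The least cutoff at which the tail energy is at most
  \<open>R\<^sup>2 * \<epsilon>\<^sup>2\<close>.\<close>

definition test_level :: "real \<Rightarrow> nat" where "test_level \<epsilon> = nat \<lceil>ln (1 / \<epsilon>) / s\<rceil>"

text \<open>One clause for each demand on the cutoff: room for the mass bounds and for
  \<open>sqrt x \<le> x / 2\<close>; the prior lies in the ellipsoid; the two estimates of
  \<open>u\<close> differ by at most \<open>e\<close>; the tail takes at most half of the signal;
  the test weights are below \<delta>; the squared prior signals are below \<delta>.\<close>

definition large_level :: "real \<Rightarrow> real \<Rightarrow> real \<Rightarrow> real \<Rightarrow> bool" where
  "large_level C e \<delta> x \<longleftrightarrow> 8 * dimn + 16 \<le> x \<and>
    C\<^sup>2 * (s * x) powr expo * exp (4 * s - 2 * s * sqrt x) \<le> R\<^sup>2 \<and>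
    C\<^sup>2 * upper_const / mass_const * x powr (- (1 / 2)) + R\<^sup>2 / sqrt (2 * mass_const) * x powr (- expo) \<le> e \<and>
    R\<^sup>2 * x powr (- expo) \<le> C\<^sup>2 * (s / 2) powr expo / 2 \<and>
    x powr (- (dimn / 2)) / sqrt (2 * mass_const) \<le> \<delta> \<and>
    C\<^sup>2 * (2 * s) powr expo / mass_const * (x / 2) powr (- (dimn / 2)) \<le> \<delta>"

lemma eventually_large_level:
  assumes C: "0 < C" and e: "0 < e" and \<delta>: "0 < \<delta>"
  shows "\<forall>\<^sub>F x in at_top. large_level C e \<delta> x"
proof -
  have d: "0 < dimn / 2" using dimn_ge_1 by simp
  have neg: "((\<lambda>x::real. c * x powr (- p)) \<longlongrightarrow> 0) at_top" if "0 < p" for p c :: real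
    using that by (intro tendsto_mult_right_zero tendsto_neg_powr filterlim_ident) auto
  have "\<forall>\<^sub>F x in at_top. 8 * dimn + 16 \<le> x" by (rule eventually_ge_at_top)
  moreover have "\<forall>\<^sub>F x in at_top. C\<^sup>2 * (s * x) powr expo * exp (4 * s - 2 * s * sqrt x) < R\<^sup>2"
  proof (rule order_tendstoD)
    show "((\<lambda>x. C\<^sup>2 * (s * x) powr expo * exp (4 * s - 2 * s * sqrt x)) \<longlongrightarrow> 0) at_top"
      using s_pos expo_pos C by real_asymp
  qed (use R_pos in simp)
  moreover have "\<forall>\<^sub>F x in at_top. C\<^sup>2 * upper_const / mass_const * x powr (- (1 / 2)) + R\<^sup>2 / sqrt (2 * mass_const) * x powr (- expo) < e"
    using e by (intro order_tendstoD(2)[OF tendsto_add_zero[OF neg neg]] expo_pos) auto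
  moreover have "\<forall>\<^sub>F x in at_top. R\<^sup>2 * x powr (- expo) < C\<^sup>2 * (s / 2) powr expo / 2"
    using C s_pos by (intro order_tendstoD(2)[OF neg] expo_pos) auto
  moreover have "\<forall>\<^sub>F x in at_top. 1 / sqrt (2 * mass_const) * x powr (- (dimn / 2)) < \<delta>"
    by (rule order_tendstoD(2)[OF neg[OF d] \<delta>])
  moreover have "\<forall>\<^sub>F x in at_top. C\<^sup>2 * (2 * s) powr expo / mass_const * (x / 2) powr (- (dimn / 2)) < \<delta>"
  proof -
    have "filterlim (\<lambda>x::real. x / 2) at_top at_top" by real_asymp
    from filterlim_compose[OF neg[OF d] this] show ?thesis by (rule order_tendstoD(2)[OF _ \<delta>])
  qed
  ultimately show ?thesis by eventually_elim (auto simp: large_level_def)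
qed

lemma large_level_consequences:
  assumes C: "0 < C" and e: "0 < e" and \<epsilon>: "0 < \<epsilon>" "\<epsilon> < 1"
    and large: "large_level C e \<delta> (real (test_level \<epsilon>))"
  defines "N \<equiv> test_level \<epsilon>" and "M \<equiv> prior_level (test_level \<epsilon>)" and "r \<equiv> C * rate \<epsilon>"
  shows "0 < mass N" "0 < mass M" "exp (2 * s * real M) * r\<^sup>2 \<le> R\<^sup>2"
    "upper_u \<epsilon> r M - lower_u \<epsilon> r N \<le> e"
    "lower_const * C\<^sup>2 \<le> lower_u \<epsilon> r N" "upper_u \<epsilon> r M \<le> upper_const * C\<^sup>2"
    "\<And>l. l \<in> low_freq N \<Longrightarrow> inv_b2 l / sqrt (2 * mass N) \<le> \<delta>"
    "\<And>l. l \<in> low_freq M \<Longrightarrow> r\<^sup>2 * inv_b2 l / (\<epsilon>\<^sup>2 * mass M) \<le> \<delta>"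
proof -
  define L where "L = ln (1 / \<epsilon>)"
  define x where "x = real N"
  define y where "y = real M"
  define c where "c = mass_const"
  \<comment> \<open>\<open>Z\<close> is \<open>r\<^sup>2\<close> in units of
    \<open>\<epsilon>\<^sup>2\<close>. It grows without bound as \<epsilon> tends to 0, while the
    tail energy in these units stays below \<open>R\<^sup>2\<close>.\<close>
  define Z where "Z = C\<^sup>2 * L powr expo"
  have L: "0 < L" "exp (- L) = \<epsilon>" using \<epsilon> by (simp_all add: L_def ln_div)
  have c: "0 < c" unfolding c_def by (rule mass_const_pos)
  have r2: "r\<^sup>2 = Z * \<epsilon>\<^sup>2" unfolding r_def Z_def L_def by (rule rate_sq[OF \<epsilon>(1)])
  have Lx: "s * (x - 1) \<le> L" "L \<le> s * x"
  proof -
    have "real_of_int \<lceil>L / s\<rceil> = x" using L s_pos by (simp add: x_def N_def test_level_def L_def)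
    then have "L / s \<le> x" "x - 1 \<le> L / s" by linarith+
    then show "s * (x - 1) \<le> L" "L \<le> s * x" using s_pos by (simp_all add: field_simps)
  qed
  note lg = large[folded N_def x_def, unfolded large_level_def]
  have x: "8 * dimn + 16 \<le> x" using lg by blast
  have xpos: "0 < x" "16 \<le> x" using x dimn_ge_1 by auto
  have sqrt_le: "sqrt x \<le> x / 2"
  proof -
    have "4 * x \<le> x * x" using xpos by (intro mult_right_mono) auto
    then have "x \<le> (x / 2)\<^sup>2" by (simp add: power2_eq_square field_simps)
    then show ?thesis using xpos by (intro real_le_lsqrt) auto
  qed
  have y: "x - sqrt x \<le> y" "y \<le> x - sqrt x + 1"
  proof -
    define f where "f = nat \<lfloor>sqrt x\<rfloor>"
    have "real f = of_int \<lfloor>sqrt x\<rfloor>" using xpos by (simp add: f_def)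
    then have f: "real f \<le> sqrt x" "sqrt x - 1 \<le> real f" by linarith+
    then have "f \<le> N" using sqrt_le xpos unfolding x_def by linarith
    then have "y = x - real f" unfolding y_def M_def prior_level_def N_def[symmetric] x_def f_def by (simp add: of_nat_diff)
    then show "x - sqrt x \<le> y" "y \<le> x - sqrt x + 1" using f by simp_all
  qed
  have yx: "x / 2 \<le> y" "y \<le> x" "0 < y" "4 * dimn \<le> y"
  proof -
    have "4 \<le> sqrt x" using xpos by (intro real_le_rsqrt) auto
    then show "x / 2 \<le> y" "y \<le> x" "0 < y" "4 * dimn \<le> y" using y sqrt_le xpos x dimn_ge_1 by linarith+
  qed
  have MN: "M \<le> N" "0 < N" using yx xpos unfolding x_def y_def by simp_all
  have massN: "c * x powr (2 * expo) \<le> mass N" "mass N \<le> x powr (2 * expo)"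
    using mass_ge[of N] mass_le[of N] x dimn_ge_1 MN by (simp_all add: expo_double x_def c_def)
  have massM: "c * y powr (2 * expo) \<le> mass M"
    using mass_ge[of M] yx by (simp add: expo_double y_def c_def)
  have sq2: "sqrt (2 * (c * z powr (2 * expo))) = sqrt (2 * c) * z powr expo" if "0 < z" for z
  proof -
    have "z powr (2 * expo) = (z powr expo)\<^sup>2" by (simp add: power2_eq_square flip: powr_add)
    then have "2 * (c * z powr (2 * expo)) = (2 * c) * (z powr expo)\<^sup>2" by simp
    then show ?thesis by (simp only: real_sqrt_mult real_sqrt_abs abs_of_nonneg powr_ge_zero)
  qed
  have "0 < c * x powr (2 * expo)" "0 < c * y powr (2 * expo)" using c xpos yx by auto
  then show mass_pos: "0 < mass N" "0 < mass M" using massN massM by linarith+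
  have sqN: "sqrt (2 * c) * x powr expo \<le> sqrt (2 * mass N)" "sqrt (2 * mass N) \<le> sqrt 2 * x powr expo"
  proof -
    show "sqrt (2 * c) * x powr expo \<le> sqrt (2 * mass N)"
      unfolding sq2[OF xpos(1), symmetric] using massN by simp
    have "sqrt (2 * mass N) \<le> sqrt (2 * x powr (2 * expo))" using massN by simp
    also have "2 * x powr (2 * expo) = 2 * (x powr expo)\<^sup>2" by (simp add: power2_eq_square flip: powr_add)
    also have "sqrt (2 * (x powr expo)\<^sup>2) = sqrt 2 * x powr expo" by (simp add: real_sqrt_mult)
    finally show "sqrt (2 * mass N) \<le> sqrt 2 * x powr expo" .
  qed
  have sqM: "sqrt (2 * c) * y powr expo \<le> sqrt (2 * mass M)"
    unfolding sq2[OF yx(3), symmetric] using massM by simp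
  have Z0: "0 < Z" using C L by (simp add: Z_def)
  have Zy: "Z \<le> C\<^sup>2 * (2 * s) powr expo * y powr expo"
  proof -
    have "L \<le> 2 * s * y"
    proof -
      have "s * x \<le> s * (2 * y)" using yx s_pos by (intro mult_left_mono) auto
      then show ?thesis using Lx by simp
    qed
    then have "L powr expo \<le> (2 * s * y) powr expo" using L expo_pos by (intro powr_mono2) auto
    also have "\<dots> = (2 * s) powr expo * y powr expo" using s_pos yx by (simp add: powr_mult)
    finally show ?thesis unfolding Z_def using C by (simp add: mult.assoc)
  qed
  show size: "exp (2 * s * real M) * r\<^sup>2 \<le> R\<^sup>2"
  proof -
    have "\<epsilon>\<^sup>2 = exp (- 2 * L)" unfolding L(2)[symmetric] by (simp add: power2_eq_square flip: exp_add)
    then have "exp (2 * s * real M) * r\<^sup>2 = Z * exp (2 * s * y - 2 * L)"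
      unfolding r2 y_def[symmetric] by (simp add: exp_diff exp_minus field_simps)
    also have "\<dots> \<le> (C\<^sup>2 * (s * x) powr expo) * exp (4 * s - 2 * s * sqrt x)"
    proof (rule mult_mono)
      show "Z \<le> C\<^sup>2 * (s * x) powr expo"
        unfolding Z_def using Lx L expo_pos by (intro mult_left_mono powr_mono2) auto
      \<comment> \<open>Rounding the two levels costs \<open>2 * s\<close> each in the exponent,
        hence the \<open>4 * s\<close>.\<close>
      have "s * y \<le> s * (x - sqrt x + 1)" using y s_pos by (intro mult_left_mono) auto
      then have "2 * s * y - 2 * L \<le> 4 * s - 2 * s * sqrt x" using Lx by (simp add: algebra_simps)
      then show "exp (2 * s * y - 2 * L) \<le> exp (4 * s - 2 * s * sqrt x)" by simp
    qed auto
    also have "\<dots> \<le> R\<^sup>2" using lg by blast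
    finally show ?thesis .
  qed
  have U: "upper_u \<epsilon> r M = Z / sqrt (2 * mass M)"
    unfolding upper_u_def r2 using \<epsilon> by simp
  have W: "(Z - R\<^sup>2) / sqrt (2 * mass N) \<le> lower_u \<epsilon> r N"
  proof -
    have "\<epsilon>\<^sup>2 = exp (- 2 * L)" unfolding L(2)[symmetric] by (simp add: power2_eq_square flip: exp_add)
    moreover have "exp (- 2 * s * real N) \<le> exp (- 2 * L)" using Lx by (simp add: x_def)
    ultimately have "R\<^sup>2 * exp (- 2 * s * real N) \<le> R\<^sup>2 * \<epsilon>\<^sup>2" by (intro mult_left_mono) auto
    then have "(Z * \<epsilon>\<^sup>2 - R\<^sup>2 * \<epsilon>\<^sup>2) / (\<epsilon>\<^sup>2 * sqrt (2 * mass N)) \<le> lower_u \<epsilon> r N"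
      unfolding lower_u_def r2 using \<epsilon> mass_pos by (intro divide_right_mono) auto
    moreover have "(Z * \<epsilon>\<^sup>2 - R\<^sup>2 * \<epsilon>\<^sup>2) / (\<epsilon>\<^sup>2 * sqrt (2 * mass N)) = (Z - R\<^sup>2) / sqrt (2 * mass N)"
      using \<epsilon> by (simp flip: left_diff_distrib)
    ultimately show ?thesis by simp
  qed
  show U_le: "upper_u \<epsilon> r M \<le> upper_const * C\<^sup>2"
  proof -
    have "Z / sqrt (2 * mass M) \<le> (C\<^sup>2 * (2 * s) powr expo * y powr expo) / (sqrt (2 * c) * y powr expo)"
      using Zy sqM Z0 c yx by (intro frac_le) auto
    also have "\<dots> = upper_const * C\<^sup>2" using yx by (simp add: upper_const_def c_def)
    finally show ?thesis unfolding U .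
  qed
  have inv_sqN: "R\<^sup>2 / sqrt (2 * mass N) \<le> R\<^sup>2 / sqrt (2 * c) * x powr (- expo)"
  proof -
    have "R\<^sup>2 / sqrt (2 * mass N) \<le> R\<^sup>2 / (sqrt (2 * c) * x powr expo)"
      using sqN c xpos mass_pos by (intro divide_left_mono) auto
    then show ?thesis by (simp add: powr_minus_divide)
  qed
  show "upper_u \<epsilon> r M - lower_u \<epsilon> r N \<le> e"
  proof -
    \<comment> \<open>The two estimates have denominators differing by the factor
      \<open>sqrt q\<close>. As q is at most 1, so that \<open>q \<le> sqrt q\<close>, it is enough
      to bound \<open>1 - q\<close>, which is the relative mass of the shell.\<close>
    define q where "q = mass M / mass N"
    have q: "0 < q" "q \<le> 1"
      using mass_pos sum_mono2[OF finite_low_freq low_freq_mono[OF MN(1)], of "\<lambda>l. (inv_b2 l)\<^sup>2"]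
      by (auto simp: q_def mass_def)
    have "1 - q \<le> x powr (- (1 / 2)) / c"
    proof -
      have "mass N - mass M \<le> (x - y) * x powr (2 * expo - 1)"
        using mass_diff[OF MN] by (simp add: expo_double x_def y_def)
      also have "\<dots> \<le> sqrt x * x powr (2 * expo - 1)" using y by (intro mult_right_mono) auto
      also have "\<dots> = x powr (- (1 / 2)) * x powr (2 * expo)"
        using xpos by (simp add: powr_half_sqrt[symmetric] flip: powr_add)
      finally have "1 - q \<le> (x powr (- (1 / 2)) * x powr (2 * expo)) / mass N"
        using mass_pos by (simp add: q_def diff_divide_eq_iff divide_right_mono)
      also have "\<dots> \<le> (x powr (- (1 / 2)) * x powr (2 * expo)) / (c * x powr (2 * expo))"
        using massN c xpos mass_pos by (intro divide_left_mono) auto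
      also have "\<dots> = x powr (- (1 / 2)) / c" using xpos by simp
      finally show ?thesis .
    qed
    moreover have "q \<le> sqrt q"
    proof (rule real_le_rsqrt)
      show "q\<^sup>2 \<le> q" using q by (simp add: power2_eq_square mult_left_le)
    qed
    ultimately have q1: "1 - sqrt q \<le> x powr (- (1 / 2)) / c" by linarith
    have "Z / sqrt (2 * mass N) = Z / sqrt (2 * mass M) * sqrt q"
      using mass_pos by (simp add: q_def real_sqrt_mult real_sqrt_divide)
    then have "Z / sqrt (2 * mass M) - (Z - R\<^sup>2) / sqrt (2 * mass N) = upper_u \<epsilon> r M * (1 - sqrt q) + R\<^sup>2 / sqrt (2 * mass N)"
      unfolding U by (simp add: diff_divide_distrib algebra_simps)
    also have "\<dots> \<le> (upper_const * C\<^sup>2) * (x powr (- (1 / 2)) / c) + R\<^sup>2 / sqrt (2 * c) * x powr (- expo)"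
    proof (intro add_mono inv_sqN)
      have "upper_u \<epsilon> r M * (1 - sqrt q) \<le> (upper_const * C\<^sup>2) * (1 - sqrt q)"
        using U_le q by (intro mult_right_mono) auto
      also have "\<dots> \<le> (upper_const * C\<^sup>2) * (x powr (- (1 / 2)) / c)"
        using q1 upper_const_pos by (intro mult_left_mono) auto
      finally show "upper_u \<epsilon> r M * (1 - sqrt q) \<le> (upper_const * C\<^sup>2) * (x powr (- (1 / 2)) / c)" .
    qed
    also have "\<dots> \<le> e"
    proof -
      have "C\<^sup>2 * upper_const / c * x powr (- (1 / 2)) + R\<^sup>2 / sqrt (2 * c) * x powr (- expo) \<le> e"
        using lg unfolding c_def by blast
      then show ?thesis by (simp add: mult.commute)
    qed
    finally show ?thesis using W unfolding U by linarith
  qed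
  show "lower_const * C\<^sup>2 \<le> lower_u \<epsilon> r N"
  proof -
    have "s / 2 * x \<le> L"
    proof -
      have "s * (x / 2) \<le> s * (x - 1)" using xpos s_pos by (intro mult_left_mono) auto
      then show ?thesis using Lx by simp
    qed
    then have "(s / 2 * x) powr expo \<le> L powr expo" using s_pos xpos expo_pos by (intro powr_mono2) auto
    moreover have "(s / 2 * x) powr expo = (s / 2) powr expo * x powr expo"
      by (rule powr_mult)
    ultimately have "C\<^sup>2 * ((s / 2) powr expo * x powr expo) \<le> Z"
      unfolding Z_def by (intro mult_left_mono) auto
    moreover have "R\<^sup>2 \<le> (C\<^sup>2 * (s / 2) powr expo / 2) * x powr expo"
    proof -
      have "R\<^sup>2 * x powr (- expo) \<le> C\<^sup>2 * (s / 2) powr expo / 2" using lg by blast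
      then have "R\<^sup>2 * x powr (- expo) * x powr expo \<le> (C\<^sup>2 * (s / 2) powr expo / 2) * x powr expo"
        by (intro mult_right_mono) auto
      then show ?thesis using xpos by (simp add: mult.assoc flip: powr_add)
    qed
    ultimately have ZR: "(C\<^sup>2 * (s / 2) powr expo / 2) * x powr expo \<le> Z - R\<^sup>2" by (simp add: algebra_simps)
    have "lower_const * C\<^sup>2 = ((C\<^sup>2 * (s / 2) powr expo / 2) * x powr expo) / (sqrt 2 * x powr expo)"
      using xpos by (simp add: lower_const_def)
    also have "\<dots> \<le> (Z - R\<^sup>2) / (sqrt 2 * x powr expo)"
      using ZR xpos by (intro divide_right_mono) auto
    also have "\<dots> \<le> (Z - R\<^sup>2) / sqrt (2 * mass N)"
    proof (rule divide_left_mono)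
      have "0 \<le> (C\<^sup>2 * (s / 2) powr expo / 2) * x powr expo" by simp
      then show "0 \<le> Z - R\<^sup>2" using ZR by linarith
    qed (use sqN mass_pos xpos in auto)
    finally show ?thesis using W by linarith
  qed
  \<comment> \<open>The largest \<open>inv_b2\<close> on a simplex falls short of the root of the
    mass by the factor \<open>z powr (dimn / 2)\<close>, which makes single coordinates
    negligible.\<close>
  have lvl: "z powr (2 * \<tau>) = z powr expo * z powr (- (dimn / 2))" if "0 < z" for z
    by (simp add: expo_def flip: powr_add)
  show "inv_b2 l / sqrt (2 * mass N) \<le> \<delta>" if l: "l \<in> low_freq N" for l
  proof -
    have "inv_b2 l / sqrt (2 * mass N) \<le> x powr (2 * \<tau>) / (sqrt (2 * c) * x powr expo)"
      using inv_b2_le[OF l] sqN c xpos by (intro frac_le) (auto simp: x_def)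
    also have "\<dots> = x powr (- (dimn / 2)) / sqrt (2 * c)" using xpos by (simp add: lvl)
    also have "\<dots> \<le> \<delta>" using lg unfolding c_def by blast
    finally show ?thesis .
  qed
  show "r\<^sup>2 * inv_b2 l / (\<epsilon>\<^sup>2 * mass M) \<le> \<delta>" if l: "l \<in> low_freq M" for l
  proof -
    have "r\<^sup>2 * inv_b2 l / (\<epsilon>\<^sup>2 * mass M) = Z * inv_b2 l / mass M" unfolding r2 using \<epsilon> by simp
    also have "\<dots> \<le> (C\<^sup>2 * (2 * s) powr expo * y powr expo * y powr (2 * \<tau>)) / (c * y powr (2 * expo))"
    proof (rule frac_le)
      show "Z * inv_b2 l \<le> C\<^sup>2 * (2 * s) powr expo * y powr expo * y powr (2 * \<tau>)"
        using inv_b2_le[OF l] Zy Z0 inv_b2_pos l low_freq_subset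
        by (intro mult_mono) (auto simp: y_def intro!: less_imp_le)
    qed (use massM c yx in auto)
    also have "\<dots> = C\<^sup>2 * (2 * s) powr expo / c * y powr (- (dimn / 2))"
    proof -
      have "y powr (2 * expo) = y powr expo * y powr expo" by (simp flip: powr_add)
      then show ?thesis using yx by (simp add: lvl)
    qed
    also have "\<dots> \<le> C\<^sup>2 * (2 * s) powr expo / c * (x / 2) powr (- (dimn / 2))"
      using yx xpos dimn_ge_1 c by (intro mult_left_mono powr_mono2') auto
    also have "\<dots> \<le> \<delta>" using lg unfolding c_def by blast
    finally show ?thesis .
  qed
qed

lemma filterlim_test_level: "filterlim (\<lambda>\<epsilon>. real (test_level \<epsilon>)) at_top (at_right 0)"
proof (rule filterlim_at_top_mono)
  show "filterlim (\<lambda>\<epsilon>. ln (1 / \<epsilon>) / s) at_top (at_right 0)"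
    using s_pos by real_asymp
  show "\<forall>\<^sub>F \<epsilon> in at_right 0. ln (1 / \<epsilon>) / s \<le> real (test_level \<epsilon>)"
    unfolding test_level_def by (intro always_eventually allI real_nat_ceiling_ge)
qed

text \<open>For fixed \<open>C\<close> the estimates of \<open>u\<close> stay between constants
  \<open>k\<close> and \<open>K\<close> not depending on \<epsilon>, so the thresholds of both error
  bounds can be fixed before \<epsilon>. Half of \<open>e\<close> goes into the error bounds and
  half into replacing \<open>lower_u\<close> or \<open>upper_u\<close> by the extremal
  value.\<close>

lemma sharp_asymptotics:
  fixes \<alpha> :: real
  assumes \<alpha>: "0 < \<alpha>" "\<alpha> < 1" and C: "0 < C" and e: "0 < e" and \<eta>: "level_remainder \<eta>"
  shows "\<forall>\<^sub>F \<epsilon> in at_right 0.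
    lower_const * C\<^sup>2 \<le> extremal_u a b R \<epsilon> (C * rate \<epsilon>) \<and> extremal_u a b R \<epsilon> (C * rate \<epsilon>) \<le> upper_const * C\<^sup>2 \<and>
    \<bar>minimax_type_II_error b \<epsilon> (alternative a R (C * rate \<epsilon>)) (\<alpha> + \<eta> \<epsilon>)
      - std_normal_cdf (upper_quantile \<alpha> - extremal_u a b R \<epsilon> (C * rate \<epsilon>))\<bar> \<le> e"
proof -
  define k where "k = lower_const * C\<^sup>2"
  define K where "K = upper_const * C\<^sup>2"
  have k: "0 < k" and K: "0 < K" using C lower_const_pos upper_const_pos by (simp_all add: k_def K_def)
  have e2: "0 < e / 2" using e by simp
  obtain \<delta>1 where \<delta>1: "0 < \<delta>1"
    "\<And>I (b :: nat ^ 'd \<Rightarrow> real) \<epsilon> \<theta> \<Theta> u q. finite I \<Longrightarrow> I \<subseteq> idx \<Longrightarrow> 0 < \<epsilon> \<Longrightarrow>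
      (\<And>\<sigma>. (\<And>l. l \<in> I \<Longrightarrow> \<sigma> l \<in> {-1, 1}) \<Longrightarrow> (\<lambda>l. if l \<in> I then \<sigma> l * \<theta> l else 0) \<in> \<Theta>) \<Longrightarrow>
      u\<^sup>2 = (\<Sum>l\<in>I. (b l * \<theta> l / \<epsilon>) ^ 4) / 2 \<Longrightarrow> k \<le> u \<Longrightarrow> u \<le> K \<Longrightarrow>
      (\<And>l. l \<in> I \<Longrightarrow> (b l * \<theta> l / \<epsilon>)\<^sup>2 \<le> \<delta>1) \<Longrightarrow> \<bar>q - \<alpha>\<bar> \<le> \<delta>1 \<Longrightarrow>
      std_normal_cdf (upper_quantile \<alpha> - u) - e / 2 \<le> minimax_type_II_error b \<epsilon> \<Theta> q"
    by (rule minimax_lower_bound[OF \<alpha> e2 k K]) (erule that, blast)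
  obtain \<delta>2 where \<delta>2: "0 < \<delta>2"
    "\<And>I (b :: nat ^ 'd \<Rightarrow> real) \<epsilon> w \<Theta> u q. finite I \<Longrightarrow> I \<subseteq> idx \<Longrightarrow> 0 < \<epsilon> \<Longrightarrow>
      (\<Sum>l\<in>I. (w l)\<^sup>2) = 1 / 2 \<Longrightarrow> (\<And>l. l \<in> I \<Longrightarrow> 0 \<le> w l) \<Longrightarrow> (\<And>l. l \<in> I \<Longrightarrow> w l \<le> \<delta>2) \<Longrightarrow>
      0 \<le> u \<Longrightarrow> u \<le> K \<Longrightarrow> (\<And>\<theta>. \<theta> \<in> \<Theta> \<Longrightarrow> u \<le> (\<Sum>l\<in>I. w l * (b l * \<theta> l / \<epsilon>)\<^sup>2)) \<Longrightarrow> \<alpha> - \<delta>2 \<le> q \<Longrightarrow>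
      minimax_type_II_error b \<epsilon> \<Theta> q \<le> std_normal_cdf (upper_quantile \<alpha> - u) + e / 2"
    by (rule minimax_upper_bound[OF \<alpha> e2 less_imp_le[OF K]]) (erule that, blast)
  define \<delta> where "\<delta> = min \<delta>1 \<delta>2"
  have \<delta>: "0 < \<delta>" "\<delta> \<le> \<delta>1" "\<delta> \<le> \<delta>2" using \<delta>1(1) \<delta>2(1) by (auto simp: \<delta>_def)
  have "\<forall>\<^sub>F \<epsilon> in at_right 0. large_level C (e / 2) \<delta> (real (test_level \<epsilon>))"
    by (rule eventually_compose_filterlim[OF eventually_large_level[OF C e2 \<delta>(1)] filterlim_test_level])
  moreover have "\<forall>\<^sub>F \<epsilon> in at_right 0. \<bar>\<eta> \<epsilon>\<bar> < \<delta>"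
    using tendstoD[OF \<eta>[unfolded level_remainder_def] \<delta>(1)] by (simp add: dist_real_def)
  moreover have "\<forall>\<^sub>F \<epsilon> in at_right (0::real). 0 < \<epsilon> \<and> \<epsilon> < 1"
    by (auto simp: eventually_at_right_field intro!: exI[of _ 1])
  ultimately show ?thesis
  proof eventually_elim
    case (elim \<epsilon>)
    then have \<epsilon>: "0 < \<epsilon>" "\<epsilon> < 1" by auto
    let ?N = "test_level \<epsilon>" and ?M = "prior_level (test_level \<epsilon>)" and ?r = "C * rate \<epsilon>"
    let ?u = "extremal_u a b R \<epsilon> ?r" and ?H = "upper_quantile \<alpha>"
    note cons = large_level_consequences[OF C e2 \<epsilon> elim(1)]
    have r: "0 \<le> ?r" using C \<epsilon> by (simp add: rate_def)
    have "alternative a R ?r \<noteq> {}"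
      using signed_prior_in_alternative[OF cons(2) r cons(3), of "\<lambda>_. 1"] by auto
    then have u1: "lower_u \<epsilon> ?r ?N \<le> ?u"
      using cons(5) k by (intro lower_u_le r \<epsilon> cons) (auto simp: k_def)
    have u2: "?u \<le> upper_u \<epsilon> ?r ?M"
      by (rule extremal_u_le[OF cons(2) r cons(3) \<epsilon>(1)])
    have "std_normal_cdf (?H - upper_u \<epsilon> ?r ?M) - e / 2
        \<le> minimax_type_II_error b \<epsilon> (alternative a R ?r) (\<alpha> + \<eta> \<epsilon>)"
    proof (rule \<delta>1(2)[OF finite_low_freq low_freq_subset \<epsilon>(1) _ prior_signal[OF cons(2)]])
      show "(\<lambda>l. if l \<in> low_freq ?M then \<sigma> l * prior ?r ?M l else 0) \<in> alternative a R ?r"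
        if "\<And>l. l \<in> low_freq ?M \<Longrightarrow> \<sigma> l \<in> {-1, 1}" for \<sigma>
        by (rule signed_prior_in_alternative[OF cons(2) r cons(3) that])
      show "k \<le> upper_u \<epsilon> ?r ?M" using cons(5) u1 u2 by (simp add: k_def)
      show "upper_u \<epsilon> ?r ?M \<le> K" using cons(6) by (simp add: K_def)
      show "(b l * prior ?r ?M l / \<epsilon>)\<^sup>2 \<le> \<delta>1" if "l \<in> low_freq ?M" for l
        using cons(8)[OF that] \<delta>(2) unfolding prior_signal_sq[OF cons(2) that] by linarith
      show "\<bar>\<alpha> + \<eta> \<epsilon> - \<alpha>\<bar> \<le> \<delta>1" using elim(2) \<delta>(2) by simp
    qed
    moreover have "minimax_type_II_error b \<epsilon> (alternative a R ?r) (\<alpha> + \<eta> \<epsilon>)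
        \<le> std_normal_cdf (?H - lower_u \<epsilon> ?r ?N) + e / 2"
    proof (rule \<delta>2(2)[OF finite_low_freq low_freq_subset \<epsilon>(1) test_weights[OF cons(1)]])
      show "0 \<le> inv_b2 l / sqrt (2 * mass ?N)" if "l \<in> low_freq ?N" for l
        using inv_b2_pos[of l] that low_freq_subset[of ?N] cons(1) by (auto intro!: divide_nonneg_nonneg less_imp_le)
      show "inv_b2 l / sqrt (2 * mass ?N) \<le> \<delta>2" if "l \<in> low_freq ?N" for l
        using cons(7)[OF that] \<delta>(3) by linarith
      show "0 \<le> lower_u \<epsilon> ?r ?N" using cons(5) k by (simp add: k_def)
      show "lower_u \<epsilon> ?r ?N \<le> K" using u1 u2 cons(6) by (simp add: K_def)
      show "lower_u \<epsilon> ?r ?N \<le> (\<Sum>l\<in>low_freq ?N. inv_b2 l / sqrt (2 * mass ?N) * (b l * \<theta> l / \<epsilon>)\<^sup>2)"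
        if "\<theta> \<in> alternative a R ?r" for \<theta>
        by (rule test_signal[OF that r \<epsilon>(1) cons(1)])
      show "\<alpha> - \<delta>2 \<le> \<alpha> + \<eta> \<epsilon>" using elim(2) \<delta>(3) by linarith
    qed
    moreover have "std_normal_cdf (?H - ?u) \<le> std_normal_cdf (?H - upper_u \<epsilon> ?r ?M) + e / 2"
      using std_normal_cdf_lipschitz[of "?H - upper_u \<epsilon> ?r ?M" "?H - ?u"] u1 u2 cons(4) by linarith
    moreover have "std_normal_cdf (?H - lower_u \<epsilon> ?r ?N) \<le> std_normal_cdf (?H - ?u) + e / 2"
      using std_normal_cdf_lipschitz[of "?H - ?u" "?H - lower_u \<epsilon> ?r ?N"] u1 u2 cons(4) by linarith
    ultimately show ?case using u1 u2 cons(5,6) by (intro conjI) linarith+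
  qed
qed

text \<open>Tests are not randomised, so error 1 - \<alpha> cannot be had by tossing a coin. The
  chi-square test takes this role: its signal is nonnegative for every sequence, so the upper bound
  applies with \<open>u = 0\<close> to any alternative.\<close>

lemma minimax_trivial_upper:
  fixes \<alpha> :: real
  assumes \<alpha>: "0 < \<alpha>" "\<alpha> < 1" and e: "0 < e" and \<eta>: "level_remainder \<eta>"
  shows "\<forall>\<^sub>F \<epsilon> in at_right 0. \<forall>\<Theta>. minimax_type_II_error b \<epsilon> \<Theta> (\<alpha> + \<eta> \<epsilon>) \<le> 1 - \<alpha> + e"
proof -
  obtain \<delta> where \<delta>: "0 < \<delta>"
    "\<And>I (b :: nat ^ 'd \<Rightarrow> real) \<epsilon> w \<Theta> u q. finite I \<Longrightarrow> I \<subseteq> idx \<Longrightarrow> 0 < \<epsilon> \<Longrightarrow>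
      (\<Sum>l\<in>I. (w l)\<^sup>2) = 1 / 2 \<Longrightarrow> (\<And>l. l \<in> I \<Longrightarrow> 0 \<le> w l) \<Longrightarrow> (\<And>l. l \<in> I \<Longrightarrow> w l \<le> \<delta>) \<Longrightarrow>
      0 \<le> u \<Longrightarrow> u \<le> 0 \<Longrightarrow> (\<And>\<theta>. \<theta> \<in> \<Theta> \<Longrightarrow> u \<le> (\<Sum>l\<in>I. w l * (b l * \<theta> l / \<epsilon>)\<^sup>2)) \<Longrightarrow> \<alpha> - \<delta> \<le> q \<Longrightarrow>
      minimax_type_II_error b \<epsilon> \<Theta> q \<le> std_normal_cdf (upper_quantile \<alpha> - u) + e"
    by (rule minimax_upper_bound[OF \<alpha> e order_refl]) (erule that, blast)
  \<comment> \<open>The two constants 1 are arbitrary; the positive mass and the small test weights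
    are what is taken from this.\<close>
  have "\<forall>\<^sub>F \<epsilon> in at_right 0. large_level 1 1 \<delta> (real (test_level \<epsilon>))"
    by (rule eventually_compose_filterlim[OF eventually_large_level[OF _ _ \<delta>(1)] filterlim_test_level]) auto
  moreover have "\<forall>\<^sub>F \<epsilon> in at_right 0. \<bar>\<eta> \<epsilon>\<bar> < \<delta>"
    using tendstoD[OF \<eta>[unfolded level_remainder_def] \<delta>(1)] by (simp add: dist_real_def)
  moreover have "\<forall>\<^sub>F \<epsilon> in at_right (0::real). 0 < \<epsilon> \<and> \<epsilon> < 1"
    by (auto simp: eventually_at_right_field intro!: exI[of _ 1])
  ultimately show ?thesis
  proof eventually_elim
    case (elim \<epsilon>)
    then have \<epsilon>: "0 < \<epsilon>" "\<epsilon> < 1" by auto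
    let ?N = "test_level \<epsilon>"
    note cons = large_level_consequences[OF _ _ \<epsilon> elim(1)]
    have mass: "0 < mass ?N" by (rule cons) auto
    have w: "0 \<le> inv_b2 l / sqrt (2 * mass ?N)" if "l \<in> low_freq ?N" for l
      using inv_b2_pos[of l] that low_freq_subset[of ?N] mass by (auto intro!: divide_nonneg_nonneg less_imp_le)
    show ?case
    proof
      fix \<Theta>
      have "minimax_type_II_error b \<epsilon> \<Theta> (\<alpha> + \<eta> \<epsilon>) \<le> std_normal_cdf (upper_quantile \<alpha> - 0) + e"
      proof (rule \<delta>(2)[OF finite_low_freq low_freq_subset \<epsilon>(1) test_weights[OF mass] w])
        show "inv_b2 l / sqrt (2 * mass ?N) \<le> \<delta>" if "l \<in> low_freq ?N" for l
          by (rule cons(7)[OF _ _ that]) auto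
        show "0 \<le> (\<Sum>l\<in>low_freq ?N. inv_b2 l / sqrt (2 * mass ?N) * (b l * \<theta> l / \<epsilon>)\<^sup>2)" for \<theta>
          by (intro sum_nonneg mult_nonneg_nonneg w) auto
        show "\<alpha> - \<delta> \<le> \<alpha> + \<eta> \<epsilon>" using elim(2) by linarith
      qed auto
      then show "minimax_type_II_error b \<epsilon> \<Theta> (\<alpha> + \<eta> \<epsilon>) \<le> 1 - \<alpha> + e"
        using std_normal_cdf_upper_quantile[OF \<alpha>] by simp
    qed
  qed
qed

end

section \<open>Uniqueness of separation rates up to order\<close>

text \<open>The set is the range of a sequence tending to 0 along which \<open>q\<close> exceeds the
  index: the analogue of passing to a subsequence for families indexed by a real parameter.\<close>

lemma frequently_at_right_thin_set:
  fixes q :: "real \<Rightarrow> real"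
  assumes "\<And>K. \<exists>\<^sub>F \<epsilon> in at_right 0. K < q \<epsilon>"
  obtains S where "\<And>K. \<forall>\<^sub>F \<epsilon> in at_right 0. \<epsilon> \<in> S \<longrightarrow> K < q \<epsilon>" "\<exists>\<^sub>F \<epsilon> in at_right 0. \<epsilon> \<in> S"
proof -
  have "\<exists>\<epsilon>. 0 < \<epsilon> \<and> \<epsilon> < 1 / (real n + 1) \<and> real n < q \<epsilon>" for n
  proof -
    have "\<forall>\<^sub>F \<epsilon> in at_right 0. 0 < \<epsilon> \<and> \<epsilon> < 1 / (real n + 1)"
      by (auto simp: eventually_at_right_field intro!: exI[of _ "1 / (real n + 1)"])
    with assms[of "real n"] have "\<exists>\<^sub>F \<epsilon> in at_right 0. (0 < \<epsilon> \<and> \<epsilon> < 1 / (real n + 1)) \<and> real n < q \<epsilon>"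
      by (rule frequently_eventually_conj)
    then show ?thesis by (auto dest: frequently_ex)
  qed
  then obtain f where f: "\<And>n. 0 < f n" "\<And>n. f n < 1 / (real n + 1)" "\<And>n. real n < q (f n)" by metis
  show ?thesis
  proof (rule that[of "range f"])
    fix K
    obtain n0 :: nat where n0: "K \<le> real n0" using real_arch_simple by blast
    \<comment> \<open>Below \<open>d\<close> none of the first \<open>n0\<close> points occurs, so
      any point of the range has index at least \<open>n0\<close>.\<close>
    define d where "d = Min (insert 1 (f ` {..<n0}))"
    have d: "0 < d" "\<And>n. n < n0 \<Longrightarrow> d \<le> f n" using f(1) by (auto simp: d_def)
    have "K < q \<epsilon>" if \<epsilon>: "\<epsilon> < d" "\<epsilon> \<in> range f" for \<epsilon>
    proof -
      from \<epsilon> obtain n where n: "\<epsilon> = f n" by blast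
      with d(2)[of n] \<epsilon>(1) have "n0 \<le> n" by (cases "n < n0") auto
      then have "real n0 \<le> real n" by simp
      with n0 f(3)[of n] show ?thesis unfolding n by linarith
    qed
    then show "\<forall>\<^sub>F \<epsilon> in at_right 0. \<epsilon> \<in> range f \<longrightarrow> K < q \<epsilon>"
      using d(1) unfolding eventually_at_right_field by blast
  next
    show "\<exists>\<^sub>F \<epsilon> in at_right 0. \<epsilon> \<in> range f"
      unfolding frequently_def eventually_at_right_field
    proof safe
      fix d :: real assume d: "0 < d" "\<forall>y>0. y < d \<longrightarrow> y \<notin> range f"
      obtain n where "1 / d < real n" using reals_Archimedean2 by blast
      then have "1 / (real n + 1) < d" using d(1) by (simp add: field_simps)
      with f(1,2)[of n] d(2) show False by (meson less_trans rangeI)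
    qed
  qed
qed

text \<open>If the ratio of the rates were unbounded, it would tend to infinity along a set
  \<open>S\<close> accumulating at 0. There the geometric mean of the rates is negligible against
  \<open>rs\<close> but dominates \<open>rs'\<close>, so the same error would have to approach both
  1 - \<alpha> and 0.\<close>

lemma separation_rates_comparable:
  assumes \<alpha>: "\<alpha> < 1" and rs: "minimax_separation_rate a b R \<alpha> rs" and rs': "minimax_separation_rate a b R \<alpha> rs'"
  shows "\<exists>K>0. \<forall>\<^sub>F \<epsilon> in at_right 0. rs \<epsilon> \<le> K * rs' \<epsilon>"
proof (rule ccontr)
  assume neg: "\<not> ?thesis"
  have pos: "\<forall>\<^sub>F \<epsilon> in at_right 0. 0 < rs \<epsilon>" "\<forall>\<^sub>F \<epsilon> in at_right 0. 0 < rs' \<epsilon>"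
    using rs rs' by (auto simp: minimax_separation_rate_def)
  define q where "q \<epsilon> = rs \<epsilon> / rs' \<epsilon>" for \<epsilon>
  have freq: "\<exists>\<^sub>F \<epsilon> in at_right 0. K < q \<epsilon>" for K
  proof -
    have "\<exists>\<^sub>F \<epsilon> in at_right 0. \<not> rs \<epsilon> \<le> max K 1 * rs' \<epsilon>"
      using neg by (auto simp: frequently_def dest!: spec[of _ "max K 1"])
    from frequently_eventually_conj[OF this pos(2)] show ?thesis
    proof (rule frequently_elim1)
      fix \<epsilon> assume *: "0 < rs' \<epsilon> \<and> \<not> rs \<epsilon> \<le> max K 1 * rs' \<epsilon>"
      then have "max K 1 < q \<epsilon>" by (simp add: q_def less_divide_eq not_le)
      then show "K < q \<epsilon>" by simp
    qed
  qed
  obtain S where S: "\<And>K. \<forall>\<^sub>F \<epsilon> in at_right 0. \<epsilon> \<in> S \<longrightarrow> K < q \<epsilon>" "\<exists>\<^sub>F \<epsilon> in at_right 0. \<epsilon> \<in> S"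
    by (rule frequently_at_right_thin_set[OF freq]) (erule that, blast)
  \<comment> \<open>On \<open>S\<close> both radii are the geometric mean. Off \<open>S\<close> they
    are filled in so that the two ratios converge along all \<epsilon>, as the definition of a
    separation rate demands.\<close>
  define r1 where "r1 \<epsilon> = (if \<epsilon> \<in> S then rs' \<epsilon> * sqrt (q \<epsilon>) else 0)" for \<epsilon>
  define r2 where "r2 \<epsilon> = (if \<epsilon> \<in> S then rs' \<epsilon> * sqrt (q \<epsilon>) else rs' \<epsilon> / \<epsilon>)" for \<epsilon>
  have "((\<lambda>\<epsilon>. r1 \<epsilon> / rs \<epsilon>) \<longlongrightarrow> 0) (at_right 0)"
  proof (rule tendstoI)
    fix e :: real assume e: "0 < e"
    show "\<forall>\<^sub>F \<epsilon> in at_right 0. dist (r1 \<epsilon> / rs \<epsilon>) 0 < e"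
      using S(1)[of "(1 / e)\<^sup>2"] pos
    proof eventually_elim
      case (elim \<epsilon>)
      show ?case
      proof (cases "\<epsilon> \<in> S")
        case True
        with elim have q: "(1 / e)\<^sup>2 < q \<epsilon>" by simp
        then have q': "1 / e < sqrt (q \<epsilon>)" using e by (intro real_less_rsqrt)
        have q0: "0 < q \<epsilon>" using elim by (simp add: q_def)
        define w where "w = sqrt (q \<epsilon>)"
        have w: "0 < w" "1 / e < w" using q0 q' by (simp_all add: w_def)
        have "rs \<epsilon> = rs' \<epsilon> * (w * w)" using elim q0 by (simp add: q_def w_def)
        then have "r1 \<epsilon> / rs \<epsilon> = 1 / w" using elim True w by (simp add: r1_def w_def[symmetric])
        moreover have "1 / w < e" using w e by (simp add: field_simps)
        ultimately show ?thesis using w by (simp add: dist_real_def)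
      qed (use e in \<open>simp add: r1_def\<close>)
    qed
  qed
  then have lim1: "((\<lambda>\<epsilon>. minimax_type_II_error b \<epsilon> (alternative a R (r1 \<epsilon>)) \<alpha>) \<longlongrightarrow> 1 - \<alpha>) (at_right 0)"
    using rs[unfolded minimax_separation_rate_def, THEN conjunct2, rule_format, of "\<lambda>_. 0"]
    by (simp add: level_remainder_def)
  have "filterlim (\<lambda>\<epsilon>. r2 \<epsilon> / rs' \<epsilon>) at_top (at_right 0)"
    unfolding filterlim_at_top
  proof
    fix Z :: real
    have "filterlim (\<lambda>\<epsilon>::real. 1 / \<epsilon>) at_top (at_right 0)" by real_asymp
    then have "\<forall>\<^sub>F \<epsilon> in at_right 0. Z \<le> 1 / \<epsilon>" by (simp add: filterlim_at_top)
    with S(1)[of "Z\<^sup>2"] pos show "\<forall>\<^sub>F \<epsilon> in at_right 0. Z \<le> r2 \<epsilon> / rs' \<epsilon>"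
    proof eventually_elim
      case (elim \<epsilon>)
      have "Z \<le> sqrt (q \<epsilon>)" if "\<epsilon> \<in> S" using elim that by (intro real_le_rsqrt) auto
      then show ?case using elim by (auto simp: r2_def)
    qed
  qed
  then have lim2: "((\<lambda>\<epsilon>. minimax_type_II_error b \<epsilon> (alternative a R (r2 \<epsilon>)) \<alpha>) \<longlongrightarrow> 0) (at_right 0)"
    using rs'[unfolded minimax_separation_rate_def, THEN conjunct2, rule_format, of "\<lambda>_. 0"]
    by (simp add: level_remainder_def)
  define m where "m = (1 - \<alpha>) / 2"
  have m: "0 < m" "m < 1 - \<alpha>" using \<alpha> by (simp_all add: m_def)
  have "\<forall>\<^sub>F \<epsilon> in at_right 0. \<epsilon> \<notin> S"
    using order_tendstoD(1)[OF lim1 m(2)] order_tendstoD(2)[OF lim2 m(1)]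
    by eventually_elim (auto simp: r1_def r2_def)
  with S(2) show False by (simp add: frequently_def)
qed

lemma separation_rates_same_order:
  assumes "\<alpha> < 1" "minimax_separation_rate a b R \<alpha> rs" "minimax_separation_rate a b R \<alpha> rs'"
  shows "same_order rs rs'"
proof -
  obtain K1 where K1: "0 < K1" "\<forall>\<^sub>F \<epsilon> in at_right 0. rs \<epsilon> \<le> K1 * rs' \<epsilon>"
    using separation_rates_comparable[OF assms] by blast
  obtain K0 where K0: "0 < K0" "\<forall>\<^sub>F \<epsilon> in at_right 0. rs' \<epsilon> \<le> K0 * rs \<epsilon>"
    using separation_rates_comparable[OF assms(1,3,2)] by blast
  have "\<forall>\<^sub>F \<epsilon> in at_right 0. (1 / K0) * rs' \<epsilon> \<le> rs \<epsilon> \<and> rs \<epsilon> \<le> K1 * rs' \<epsilon>"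
    using K0(2) K1(2) by eventually_elim (use K0(1) in \<open>simp add: field_simps\<close>)
  moreover have "0 < 1 / K0" using K0(1) by simp
  ultimately show ?thesis unfolding same_order_def using K1(1) by blast
qed

lemma alternative_antimono: "r \<le> r' \<Longrightarrow> alternative a R r' \<subseteq> alternative a R r"
  by (auto simp: alternative_def)

section \<open>The regimes below and above the rate\<close>

context exponential_ellipsoid
begin

lemma eventually_level_nonneg:
  assumes "0 < \<alpha>" "level_remainder \<eta>"
  shows "\<forall>\<^sub>F \<epsilon> in at_right 0. 0 \<le> \<alpha> + \<eta> \<epsilon>"
  using order_tendstoD(1)[OF assms(2)[unfolded level_remainder_def], of "- \<alpha>"] assms(1)
  by (auto elim!: eventually_mono)

lemma rate_pos: "0 < \<epsilon> \<Longrightarrow> \<epsilon> < 1 \<Longrightarrow> 0 < rate \<epsilon>"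
  by (simp add: rate_def ln_div)

lemma eventually_rate_pos: "\<forall>\<^sub>F \<epsilon> in at_right 0. 0 < rate \<epsilon>"
  unfolding eventually_at_right_field by (intro exI[of _ 1]) (auto intro: rate_pos)

text \<open>A radius below \<open>C * rate \<epsilon>\<close> gives a larger alternative and hence a
  larger error, and for small \<open>C\<close> the value of \<open>u\<close> at
  \<open>C * rate \<epsilon>\<close> is so small that this error is already close to 1 - \<alpha>.
  The trivial bound supplies the other side.\<close>

lemma error_below_rate:
  assumes \<alpha>: "0 < \<alpha>" "\<alpha> < 1" and \<eta>: "level_remainder \<eta>"
    and r: "((\<lambda>\<epsilon>. r \<epsilon> / rate \<epsilon>) \<longlongrightarrow> 0) (at_right 0)"
  shows "((\<lambda>\<epsilon>. minimax_type_II_error b \<epsilon> (alternative a R (r \<epsilon>)) (\<alpha> + \<eta> \<epsilon>)) \<longlongrightarrow> 1 - \<alpha>) (at_right 0)"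
proof (rule tendstoI)
  fix e :: real assume "0 < e"
  define e' where "e' = e / 3"
  have e': "0 < e'" "e = 3 * e'" using \<open>0 < e\<close> by (simp_all add: e'_def)
  define C where "C = sqrt (e' / upper_const)"
  have C: "0 < C" "upper_const * C\<^sup>2 = e'" using e' upper_const_pos by (simp_all add: C_def)
  show "\<forall>\<^sub>F \<epsilon> in at_right 0. dist (minimax_type_II_error b \<epsilon> (alternative a R (r \<epsilon>)) (\<alpha> + \<eta> \<epsilon>)) (1 - \<alpha>) < e"
    using sharp_asymptotics[OF \<alpha> C(1) e'(1) \<eta>] minimax_trivial_upper[OF \<alpha> e'(1) \<eta>]
      order_tendstoD(2)[OF r C(1)] eventually_rate_pos eventually_level_nonneg[OF \<alpha>(1) \<eta>]
  proof eventually_elim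
    case (elim \<epsilon>)
    let ?u = "extremal_u a b R \<epsilon> (C * rate \<epsilon>)" and ?H = "upper_quantile \<alpha>"
    let ?\<beta> = "\<lambda>r. minimax_type_II_error b \<epsilon> (alternative a R r) (\<alpha> + \<eta> \<epsilon>)"
    have "r \<epsilon> \<le> C * rate \<epsilon>" using elim(3,4) by (simp add: divide_less_eq)
    then have "?\<beta> (C * rate \<epsilon>) \<le> ?\<beta> (r \<epsilon>)"
      by (intro minimax_mono alternative_antimono elim(5))
    moreover have "?\<beta> (r \<epsilon>) \<le> 1 - \<alpha> + e'" using elim(2) by blast
    moreover have "0 \<le> lower_const * C\<^sup>2" using lower_const_pos by simp
    then have u: "0 \<le> ?u" "?u \<le> e'" using elim(1) C(2) by linarith+
    moreover have "1 - \<alpha> \<le> std_normal_cdf (?H - ?u) + ?u"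
      using std_normal_cdf_lipschitz[of "?H - ?u" ?H] std_normal_cdf_upper_quantile[OF \<alpha>] u by simp
    ultimately show ?case using elim(1) e' u unfolding dist_real_def by linarith
  qed
qed

text \<open>For every \<open>C\<close> the radius eventually exceeds
  \<open>C * rate \<epsilon>\<close>, which shrinks the alternative; a large \<open>C\<close> pushes
  the argument of the normal distribution function below any given \<open>z\<close>.\<close>

lemma error_above_rate:
  assumes \<alpha>: "0 < \<alpha>" "\<alpha> < 1" and \<eta>: "level_remainder \<eta>"
    and r: "filterlim (\<lambda>\<epsilon>. r \<epsilon> / rate \<epsilon>) at_top (at_right 0)"
  shows "((\<lambda>\<epsilon>. minimax_type_II_error b \<epsilon> (alternative a R (r \<epsilon>)) (\<alpha> + \<eta> \<epsilon>)) \<longlongrightarrow> 0) (at_right 0)"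
proof (rule tendstoI)
  fix e :: real assume "0 < e"
  define e' where "e' = e / 3"
  have e': "0 < e'" "e = 3 * e'" using \<open>0 < e\<close> by (simp_all add: e'_def)
  let ?H = "upper_quantile \<alpha>"
  interpret N: real_distribution std_normal by (rule real_distribution_std_normal)
  have "(std_normal_cdf \<longlongrightarrow> 0) at_bot" unfolding std_normal_cdf_def by (rule N.cdf_lim_at_bot)
  from order_tendstoD(2)[OF this e'(1)]
  have "\<forall>\<^sub>F z in at_bot. std_normal_cdf z < e' \<and> z < ?H"
    by (rule eventually_conj) (rule eventually_gt_at_bot)
  then obtain z where z: "std_normal_cdf z < e'" "z < ?H"
    using eventually_happens'[OF trivial_limit_at_bot_linorder] by blast
  \<comment> \<open>Chosen so that the lower estimate of \<open>u\<close> at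
    \<open>C * rate \<epsilon>\<close> is exactly \<open>?H - z\<close>.\<close>
  define C where "C = sqrt ((?H - z) / lower_const)"
  have C: "0 < C" "lower_const * C\<^sup>2 = ?H - z" using z lower_const_pos by (simp_all add: C_def)
  have "\<forall>\<^sub>F \<epsilon> in at_right 0. C \<le> r \<epsilon> / rate \<epsilon>" using r by (simp add: filterlim_at_top)
  with sharp_asymptotics[OF \<alpha> C(1) e'(1) \<eta>] eventually_rate_pos eventually_level_nonneg[OF \<alpha>(1) \<eta>]
  show "\<forall>\<^sub>F \<epsilon> in at_right 0. dist (minimax_type_II_error b \<epsilon> (alternative a R (r \<epsilon>)) (\<alpha> + \<eta> \<epsilon>)) 0 < e"
  proof eventually_elim
    case (elim \<epsilon>)
    let ?u = "extremal_u a b R \<epsilon> (C * rate \<epsilon>)"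
    let ?\<beta> = "\<lambda>r. minimax_type_II_error b \<epsilon> (alternative a R r) (\<alpha> + \<eta> \<epsilon>)"
    have "C * rate \<epsilon> \<le> r \<epsilon>" using elim by (simp add: le_divide_eq)
    then have "?\<beta> (r \<epsilon>) \<le> ?\<beta> (C * rate \<epsilon>)"
      by (intro minimax_mono alternative_antimono elim(3))
    moreover have "std_normal_cdf (?H - ?u) \<le> std_normal_cdf z"
      using elim(1) C(2) by (intro std_normal_cdf_mono) linarith
    moreover have "0 \<le> ?\<beta> (r \<epsilon>)" by (rule minimax_nonneg[OF elim(3)])
    ultimately show ?case using elim(1) e' z(1) unfolding dist_real_def by linarith
  qed
qed

lemma rate_is_separation_rate:
  assumes "0 < \<alpha>" "\<alpha> < 1"
  shows "minimax_separation_rate a b R \<alpha> rate"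
  unfolding minimax_separation_rate_def
  using eventually_rate_pos error_below_rate[OF assms] error_above_rate[OF assms] by blast

lemma extremal_u_bigo:
  assumes "0 < C"
  shows "(\<lambda>\<epsilon>. extremal_u a b R \<epsilon> (C * rate \<epsilon>)) \<in> O[at_right 0](\<lambda>_. 1)"
proof (rule bigoI)
  have "level_remainder (\<lambda>_. 0)" by (simp add: level_remainder_def)
  from sharp_asymptotics[OF _ _ assms _ this, of "1 / 2" 1]
  show "\<forall>\<^sub>F \<epsilon> in at_right 0. norm (extremal_u a b R \<epsilon> (C * rate \<epsilon>)) \<le> (upper_const * C\<^sup>2) * norm (1 :: real)"
  proof (simp, elim eventually_mono, elim conjE)
    fix \<epsilon> assume "lower_const * C\<^sup>2 \<le> extremal_u a b R \<epsilon> (C * rate \<epsilon>)"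
      "extremal_u a b R \<epsilon> (C * rate \<epsilon>) \<le> upper_const * C\<^sup>2"
    moreover have "0 \<le> lower_const * C\<^sup>2" using lower_const_pos by simp
    ultimately show "\<bar>extremal_u a b R \<epsilon> (C * rate \<epsilon>)\<bar> \<le> upper_const * C\<^sup>2" by linarith
  qed
qed

end

theorem proposition2:
  fixes a b :: "nat ^ 'd \<Rightarrow> real" and t :: "real ^ 'd" and R \<alpha> s :: real
  assumes "R > 0" and "0 < \<alpha>" and "\<alpha> < 1" and "\<And>j. t $ j \<ge> 0" and "s > 0"
    and "\<And>l. l \<in> idx \<Longrightarrow> (b l)\<^sup>2 = (\<Prod>j\<in>UNIV. real (l $ j) powr (- 2 * t $ j))"
    and "\<And>l. l \<in> idx \<Longrightarrow> (a l)\<^sup>2 = (\<Prod>j\<in>UNIV. exp (2 * s * real (l $ j)))"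
  defines "\<rho> \<equiv> \<lambda>\<epsilon>. \<epsilon> * ln (1 / \<epsilon>) powr (\<Sum>j\<in>UNIV. t $ j + 1 / 4)"
  shows "minimax_separation_rate a b R \<alpha> \<rho> \<and>
      (\<forall>rs. minimax_separation_rate a b R \<alpha> rs \<longrightarrow> same_order rs \<rho>) \<and>
      (\<forall>C>0. (\<lambda>\<epsilon>. extremal_u a b R \<epsilon> (C * \<rho> \<epsilon>)) \<in> O[at_right 0](\<lambda>_. 1) \<and>
        (\<forall>\<eta>. level_remainder \<eta> \<longrightarrow>
          ((\<lambda>\<epsilon>. minimax_type_II_error b \<epsilon> (alternative a R (C * \<rho> \<epsilon>)) (\<alpha> + \<eta> \<epsilon>)
              - std_normal_cdf (upper_quantile \<alpha> - extremal_u a b R \<epsilon> (C * \<rho> \<epsilon>))) \<longlongrightarrow> 0)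
            (at_right 0)))"
proof -
  interpret exponential_ellipsoid a b t R s
    by unfold_locales (use assms in auto)
  \<comment> \<open>Summing the constants 1/4 over the coordinates gives \<open>dimn / 4\<close>, so
    the exponent is \<open>expo / 2\<close>.\<close>
  have \<rho>: "\<rho> = rate"
    unfolding \<rho>_def rate_def expo_def \<tau>_def dimn_def by (simp add: sum.distrib add_divide_distrib)
  show ?thesis
    unfolding \<rho>
  proof (intro conjI allI impI)
    show "minimax_separation_rate a b R \<alpha> rate"
      by (rule rate_is_separation_rate[OF assms(2,3)])
    then show "same_order rs rate" if "minimax_separation_rate a b R \<alpha> rs" for rs
      using separation_rates_same_order[OF assms(3) that] by blast
    show "(\<lambda>\<epsilon>. extremal_u a b R \<epsilon> (C * rate \<epsilon>)) \<in> O[at_right 0](\<lambda>_. 1)" if "0 < C" for C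
      by (rule extremal_u_bigo[OF that])
    show "((\<lambda>\<epsilon>. minimax_type_II_error b \<epsilon> (alternative a R (C * rate \<epsilon>)) (\<alpha> + \<eta> \<epsilon>)
              - std_normal_cdf (upper_quantile \<alpha> - extremal_u a b R \<epsilon> (C * rate \<epsilon>))) \<longlongrightarrow> 0) (at_right 0)"
      if "0 < C" "level_remainder \<eta>" for C \<eta>
    proof (rule tendstoI)
      fix e :: real assume "0 < e"
      then have "0 < e / 2" by simp
      from sharp_asymptotics[OF assms(2,3) that(1) this that(2)]
      show "\<forall>\<^sub>F \<epsilon> in at_right 0. dist (minimax_type_II_error b \<epsilon> (alternative a R (C * rate \<epsilon>)) (\<alpha> + \<eta> \<epsilon>)
              - std_normal_cdf (upper_quantile \<alpha> - extremal_u a b R \<epsilon> (C * rate \<epsilon>))) 0 < e"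
        by eventually_elim (use \<open>0 < e\<close> in \<open>auto simp: dist_real_def\<close>)
    qed
  qed
qed

end
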